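(* Let $\varphi:\mathbb{R}\to\,]0,\infty[$ be a Borel function with $\int_{\mathbb{R}}\varphi(u)\,du=1$, $\Phi(x)=\int_{-\infty}^x\varphi(u)\,du$, $x\in\mathbb{R}$, and let $Q_x^\varphi$ be the probability measure on $(\Omega,\mathcal{F}_\infty)$ such that $Q_x^\varphi(\Gamma_t)=\frac{1}{1-\Phi(x)}E_x[1_{\Gamma_t}M_t^\varphi]$ for all $t\ge0$, $\Gamma_t\in\mathcal{F}_t$, where $M_t^\varphi=(S_t-X_t)\varphi(S_t)+1-\Phi(S_t)$. 1. Under $Q_x^\varphi$, the random variable $S_\infty$ is finite and admits $\frac{\varphi(y)}{1-\Phi(x)}1_{\{y\ge x\}}$ as a density function. 2. Let $g=\sup\{u\ge0;X_u=S_\infty\}$. Then $Q_x^\varphi(0<g<\infty)=1$, and under $Q_x^\varphi$: (a) the processes $(X_u;u\le g)$ and $(X_g-X_{u+g};u\ge0)$ are independent; (b) $(X_g-X_{u+g};u\ge0)$ is distributed as a three-dimensional Bessel process started at $0$; (c) conditionally on $S_\infty=z>x$, $(X_u;u\le g)$ is distributed as a Brownian motion started at $x$ and stopped at its first hitting time of $z$.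
   Context: $\Omega=\mathcal{C}(\mathbb{R}_+,\mathbb{R})$ is the canonical space, $(X_t)_{t\ge0}$ the coordinate process, $\mathcal{F}_t=\sigma(X_s;0\le s\le t)$, $\mathcal{F}_\infty=\sigma(X_s;s\ge0)$; $P_x$ is the law of Brownian motion started at $x$, with expectation $E_x$. $S_t=\sup_{0\le u\le t}X_u$, $S_\infty=\sup_{u\ge0}X_u$. The process $(M_t^\varphi)$ is a $P_x$-martingale with $M_0^\varphi=1-\Phi(x)$. Convention: $\sup\emptyset=0$. *)

theory Defs
  imports "HOL-Probability.Probability"
begin

text \<open>Elements of \<open>C(\<real>\<^sub>+, \<real>)\<close> are functions on \<open>{0..}\<close>, undefined (in the sense of
  \<^const>\<open>extensional\<close>) on negative times, so that each path has exactly one representative.\<close>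

definition paths :: "(real \<Rightarrow> real) set" where
  "paths = {w \<in> extensional {0..}. continuous_on {0..} w}"

definition coord_algebra :: "real set \<Rightarrow> (real \<Rightarrow> real) measure" where
  "coord_algebra I =
     sigma paths {{w \<in> paths. w s \<in> A} | s A. s \<in> I \<and> A \<in> sets borel}"

definition path_filt :: "real \<Rightarrow> (real \<Rightarrow> real) measure" where
  "path_filt t = coord_algebra {0..t}"

definition path_sigma :: "(real \<Rightarrow> real) measure" where
  "path_sigma = coord_algebra {0..}"

text \<open>The law of Brownian motion started at \<open>x\<close>; continuity of paths is built into
  \<^const>\<open>paths\<close>, and the second argument of \<^const>\<open>normal_density\<close> is the standard
  deviation.\<close>

definition wiener_law :: "real \<Rightarrow> (real \<Rightarrow> real) measure \<Rightarrow> bool" where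
  "wiener_law x P \<longleftrightarrow>
     prob_space P \<and> sets P = sets path_sigma \<and>
     (AE w in P. w 0 = x) \<and>
     (\<forall>s t. 0 \<le> s \<and> s < t \<longrightarrow>
        distributed P lborel (\<lambda>w. w t - w s) (normal_density 0 (sqrt (t - s))) \<and>
        prob_space.indep_set P (sets (path_filt s))
          (sets (vimage_algebra (space P) (\<lambda>w. w t - w s) borel)))"

text \<open>The three-dimensional Bessel process started at \<open>0\<close> is the Euclidean norm of a
  three-dimensional Brownian motion started at \<open>0\<close>; the argument \<open>W\<close> is the Wiener measure
  started at \<open>0\<close>.\<close>

definition bessel3_law :: "(real \<Rightarrow> real) measure \<Rightarrow> (real \<Rightarrow> real) measure" where
  "bessel3_law W =
     distr (W \<Otimes>\<^sub>M W \<Otimes>\<^sub>M W) path_sigma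
       (\<lambda>(a, b, c). \<lambda>u\<in>{0..}. sqrt ((a u)\<^sup>2 + (b u)\<^sup>2 + (c u)\<^sup>2))"

definition run_sup :: "real \<Rightarrow> (real \<Rightarrow> real) \<Rightarrow> real" where
  "run_sup t w = (SUP u\<in>{0..t}. w u)"

definition sup_inf :: "(real \<Rightarrow> real) \<Rightarrow> ereal" where
  "sup_inf w = (SUP u\<in>{0..}. ereal (w u))"

definition Phi :: "(real \<Rightarrow> real) \<Rightarrow> real \<Rightarrow> real" where
  "Phi \<phi> x = (LINT u:{..x}|lborel. \<phi> u)"

definition mart :: "(real \<Rightarrow> real) \<Rightarrow> real \<Rightarrow> (real \<Rightarrow> real) \<Rightarrow> real" where
  "mart \<phi> t w = (run_sup t w - w t) * \<phi> (run_sup t w) + 1 - Phi \<phi> (run_sup t w)"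

text \<open>In \<^typ>\<open>ennreal\<close> the supremum of the empty set is \<open>0\<close> and its infimum is \<open>\<infinity>\<close>.\<close>

definition last_max :: "(real \<Rightarrow> real) \<Rightarrow> ennreal" where
  "last_max w = (SUP u\<in>{u. 0 \<le> u \<and> ereal (w u) = sup_inf w}. ennreal u)"

definition hit_time :: "real \<Rightarrow> (real \<Rightarrow> real) \<Rightarrow> ennreal" where
  "hit_time z w = (INF u\<in>{u. 0 \<le> u \<and> w u = z}. ennreal u)"

text \<open>A path with random lifetime, \<open>(X\<^sub>u; u \<le> \<zeta>)\<close>, is encoded as the pair of its lifetime and the
  path frozen from the lifetime on.\<close>

definition path_upto :: "ennreal \<Rightarrow> (real \<Rightarrow> real) \<Rightarrow> ennreal \<times> (real \<Rightarrow> real)" where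
  "path_upto \<zeta> w = (\<zeta>, \<lambda>u\<in>{0..}. w (if ennreal u \<le> \<zeta> then u else enn2real \<zeta>))"

definition upto_algebra :: "(ennreal \<times> (real \<Rightarrow> real)) measure" where
  "upto_algebra = borel \<Otimes>\<^sub>M path_sigma"

definition pre_max :: "(real \<Rightarrow> real) \<Rightarrow> ennreal \<times> (real \<Rightarrow> real)" where
  "pre_max w = path_upto (last_max w) w"

text \<open>Arbitrary on the event where the last maximum time is infinite
  (there \<^const>\<open>enn2real\<close> returns \<open>0\<close>).\<close>

definition post_max :: "(real \<Rightarrow> real) \<Rightarrow> real \<Rightarrow> real" where
  "post_max w = (\<lambda>u\<in>{0..}. w (enn2real (last_max w)) - w (u + enn2real (last_max w)))"

definition stopped_bm_law ::
    "(real \<Rightarrow> real) measure \<Rightarrow> real \<Rightarrow> (ennreal \<times> (real \<Rightarrow> real)) measure" where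
  "stopped_bm_law P z = distr P upto_algebra (\<lambda>w. path_upto (hit_time z w) w)"

text \<open>Independence of two random variables with values in possibly different spaces, which
  \<open>prob_space.indep_var\<close> does not allow.\<close>

definition indep_rv ::
    "'a measure \<Rightarrow> 'b measure \<Rightarrow> ('a \<Rightarrow> 'b) \<Rightarrow> 'c measure \<Rightarrow> ('a \<Rightarrow> 'c) \<Rightarrow> bool" where
  "indep_rv Q N X N' Y \<longleftrightarrow>
     X \<in> measurable Q N \<and> Y \<in> measurable Q N' \<and>
     prob_space.indep_set Q (sets (vimage_algebra (space Q) X N))
       (sets (vimage_algebra (space Q) Y N'))"

text \<open>The kernel \<open>\<kappa>\<close> is a regular version of the law of \<open>X\<close> given \<open>Y = y\<close>, for \<open>y \<in> D\<close>.\<close>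

definition cond_law ::
    "'a measure \<Rightarrow> ('a \<Rightarrow> real) \<Rightarrow> real set \<Rightarrow> 'b measure \<Rightarrow> ('a \<Rightarrow> 'b) \<Rightarrow> (real \<Rightarrow> 'b measure) \<Rightarrow> bool"
  where
  "cond_law Q Y D N X \<kappa> \<longleftrightarrow>
     Y \<in> borel_measurable Q \<and> X \<in> measurable Q N \<and>
     \<kappa> \<in> measurable (restrict_space borel D) (prob_algebra N) \<and>
     (\<forall>A\<in>sets N. \<forall>B\<in>sets borel. B \<subseteq> D \<longrightarrow>
        emeasure Q {w \<in> space Q. X w \<in> A \<and> Y w \<in> B} =
          (\<integral>\<^sup>+y\<in>B. emeasure (\<kappa> y) A \<partial>distr Q borel Y))"

end

theory Submission imports Defs begin

text \<open>Let \<open>R\<close> be the law of the path obtained by drawing \<open>z\<close> with density proportional to \<open>\<phi>\<close> on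
  \<open>{x..}\<close>, running a Brownian motion from \<open>x\<close> up to its hitting time of \<open>z\<close>, and continuing with \<open>z - \<rho>\<close>
  for an independent three-dimensional Bessel process \<open>\<rho>\<close>.  All assertions can be read off from \<open>R\<close>, so
  the point is \<open>Q = R\<close>, which on events before \<open>t\<close> amounts to
  \<open>E[F (S\<^sub>t - X\<^sub>t); a < S\<^sub>t \<le> b] = \<integral>\<^sub>a\<^sup>b E[F(Y\<^sub>z); T\<^sub>z < t] dz\<close>, where \<open>Y\<^sub>z\<close> is the concatenated path.

  For \<open>\<epsilon> > 0\<close>, the Bessel process started at \<open>\<epsilon>\<close> is Brownian motion killed below \<open>0\<close> and
  weighted by its endpoint.  This is a Gaussian computation (exponentials of squares separate the
  three coordinates) combined with the reflection principle.  Applied after the first time of a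
  finite grid at which the path exceeds \<open>z\<close>, by the Markov property at deterministic times only, it
  gives \<open>E[F (z + \<epsilon> - X\<^sub>t); z < S\<^sub>t \<le> z + \<epsilon>] = \<epsilon> E[F(Y\<^sub>z\<^sup>\<epsilon>); T\<^sub>z < t]\<close> as the grid becomes dense.
  Integrating over \<open>z\<close> avoids exceptional levels, and \<open>\<epsilon> \<rightarrow> 0\<close> yields the identity.

  That \<open>\<rho>\<close> does not return to \<open>0\<close>, that is, that the maximum of \<open>Y\<^sub>z\<close> is attained only once, is inherited
  from Brownian motion, whose maximum on \<open>[0, t]\<close> is almost surely unique, since \<open>Q\<close> is absolutely
  continuous before \<open>t\<close>.\<close>

section \<open>Path space\<close>

text \<open>The two terms of \<open>mart\<close> correspond to the position of the drawn level z
  relative to the supremum S_t of the Brownian path. A level above S_t has not been reached by time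
  t, so the path up to t is still Brownian; such levels have mass proportional to 1 - Phi(S_t). A
  level below S_t has been passed, and integrating over such levels must produce (S_t - X_t)
  phi(S_t). Only this second term needs work.

  The Bessel process is the transform of killed Brownian motion by the harmonic function h(y) = y.
  At the start 0 this function vanishes and the density degenerates, which forces the detour through
  a positive starting point, where the density is the endpoint divided by the starting point.

  The obstacle in all limits is that this density is unbounded, both in the endpoint and as the
  starting point tends to 0. The first is met by test functions that vanish when the final position
  is large, the second by integrating over a window of levels whose length cancels the
  divisor.\<close>

lemma coord_algebra_gen: "{{w \<in> paths. w s \<in> A} | s A. s \<in> I \<and> A \<in> sets borel} \<subseteq> Pow paths"
  by auto

lemma space_coord_algebra [simp]: "space (coord_algebra I) = paths"
  unfolding coord_algebra_def by (rule space_measure_of[OF coord_algebra_gen])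

lemma sets_coord_algebra:
  "sets (coord_algebra I) =
     sigma_sets paths {{w \<in> paths. w s \<in> A} | s A. s \<in> I \<and> A \<in> sets borel}"
  unfolding coord_algebra_def by (rule sets_measure_of[OF coord_algebra_gen])

lemma space_path_filt [simp]: "space (path_filt t) = paths"
  and space_path_sigma [simp]: "space path_sigma = paths"
  unfolding path_filt_def path_sigma_def by simp_all

lemma space_eq_paths: "sets M = sets path_sigma \<Longrightarrow> space M = paths"
  using sets_eq_imp_space_eq[of M path_sigma] by simp

lemma sets_coord_algebra_mono: "I \<subseteq> J \<Longrightarrow> sets (coord_algebra I) \<subseteq> sets (coord_algebra J)"
  unfolding sets_coord_algebra by (rule sigma_sets_mono') blast

lemma sets_path_filt_mono: "s \<le> t \<Longrightarrow> sets (path_filt s) \<subseteq> sets (path_filt t)"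
  unfolding path_filt_def by (rule sets_coord_algebra_mono) auto

lemma sets_path_filt_le: "sets (path_filt t) \<subseteq> sets path_sigma"
  unfolding path_filt_def path_sigma_def by (rule sets_coord_algebra_mono) auto

lemma measurable_path_filt_path_sigma: "f \<in> measurable (path_filt s) N \<Longrightarrow> f \<in> measurable path_sigma N"
  using measurable_mono[OF order_refl refl sets_path_filt_le] by fastforce

lemma coord_measurable: "s \<in> I \<Longrightarrow> (\<lambda>w. w s) \<in> borel_measurable (coord_algebra I)"
proof (rule measurableI)
  fix A :: "real set" assume "s \<in> I" "A \<in> sets borel"
  then have "{w \<in> paths. w s \<in> A} \<in> sets (coord_algebra I)"
    unfolding sets_coord_algebra by (intro sigma_sets.Basic) blast
  then show "(\<lambda>w. w s) -` A \<inter> space (coord_algebra I) \<in> sets (coord_algebra I)"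
    by (auto simp: vimage_def Int_def conj_commute)
qed auto

lemma coord_measurable_filt: "0 \<le> s \<Longrightarrow> s \<le> t \<Longrightarrow> (\<lambda>w. w s) \<in> borel_measurable (path_filt t)"
  unfolding path_filt_def by (rule coord_measurable) auto

lemma coord_measurable_path_sigma: "0 \<le> s \<Longrightarrow> (\<lambda>w. w s) \<in> borel_measurable path_sigma"
  unfolding path_sigma_def by (rule coord_measurable) auto

lemma measurable_coord_algebraI:
  assumes "\<And>x. x \<in> space M \<Longrightarrow> f x \<in> paths" "\<And>s. s \<in> I \<Longrightarrow> (\<lambda>x. f x s) \<in> borel_measurable M"
  shows "f \<in> measurable M (coord_algebra I)"
  unfolding coord_algebra_def
proof (rule measurable_measure_of[OF coord_algebra_gen])
  show "f \<in> space M \<rightarrow> paths" using assms(1) by auto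
  fix Y assume "Y \<in> {{w \<in> paths. w s \<in> A} | s A. s \<in> I \<and> A \<in> sets borel}"
  then obtain s A where Y: "Y = {w \<in> paths. w s \<in> A}" "s \<in> I" "A \<in> sets borel" by auto
  have "f -` Y \<inter> space M = (\<lambda>x. f x s) -` A \<inter> space M" using assms(1) Y(1) by auto
  then show "f -` Y \<inter> space M \<in> sets M" using assms(2)[OF Y(2)] Y(3) by (auto intro: measurable_sets)
qed

lemma measurable_path_sigmaI:
  "(\<And>x. x \<in> space M \<Longrightarrow> f x \<in> paths) \<Longrightarrow> (\<And>s. 0 \<le> s \<Longrightarrow> (\<lambda>x. f x s) \<in> borel_measurable M)
    \<Longrightarrow> f \<in> measurable M path_sigma"
  unfolding path_sigma_def by (rule measurable_coord_algebraI) auto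

lemma measurable_path_filtI:
  "(\<And>x. x \<in> space M \<Longrightarrow> f x \<in> paths) \<Longrightarrow> (\<And>s. 0 \<le> s \<Longrightarrow> s \<le> t \<Longrightarrow> (\<lambda>x. f x s) \<in> borel_measurable M)
    \<Longrightarrow> f \<in> measurable M (path_filt t)"
  unfolding path_filt_def by (rule measurable_coord_algebraI) auto

lemma paths_continuous: "w \<in> paths \<Longrightarrow> continuous_on {0..} w"
  unfolding paths_def by auto

lemma paths_continuous_subset: "w \<in> paths \<Longrightarrow> 0 \<le> a \<Longrightarrow> continuous_on {a..b} w"
  by (rule continuous_on_subset[OF paths_continuous]) auto

lemma restrict_in_paths: "continuous_on {0..} f \<Longrightarrow> restrict f {0..} \<in> paths"
  unfolding paths_def using continuous_on_cong[of "{0..}" "{0..}" "restrict f {0..}" f] by auto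

lemma paths_tendsto:
  assumes "w \<in> paths" "u \<longlonglongrightarrow> a" "\<And>n. 0 \<le> u n" "0 \<le> a"
  shows "(\<lambda>n. w (u n)) \<longlonglongrightarrow> w a"
  using continuous_on_tendsto_compose[OF paths_continuous[OF assms(1)] assms(2)] assms(3,4) by auto

lemma paths_eqI: "v \<in> paths \<Longrightarrow> w \<in> paths \<Longrightarrow> (\<And>u. 0 \<le> u \<Longrightarrow> v u = w u) \<Longrightarrow> v = w"
  unfolding paths_def by (auto intro!: extensionalityI[of v _ w])

section \<open>Evaluation at random times and suprema over intervals\<close>

lemma tendsto_floor_div:
  fixes q :: real
  shows "(\<lambda>n. real_of_int \<lfloor>q * real (Suc n)\<rfloor> / real (Suc n)) \<longlonglongrightarrow> q"
proof (rule real_tendsto_sandwich[where f="\<lambda>n. q - 1 / real (Suc n)" and h="\<lambda>n. q"])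
  show "(\<lambda>n. q - 1 / real (Suc n)) \<longlonglongrightarrow> q"
    using tendsto_diff[OF tendsto_const[of q] LIMSEQ_Suc[OF lim_1_over_n]] by simp
  have "q - 1 / real (Suc n) \<le> real_of_int \<lfloor>q * real (Suc n)\<rfloor> / real (Suc n)"
    and "real_of_int \<lfloor>q * real (Suc n)\<rfloor> / real (Suc n) \<le> q" for n
  proof -
    have "q - 1 / real (Suc n) = (q * real (Suc n) - 1) / real (Suc n)"
      by (simp add: field_simps)
    also have "\<dots> \<le> real_of_int \<lfloor>q * real (Suc n)\<rfloor> / real (Suc n)"
      by (intro divide_right_mono) linarith+
    finally show "q - 1 / real (Suc n) \<le> real_of_int \<lfloor>q * real (Suc n)\<rfloor> / real (Suc n)" .
    have "real_of_int \<lfloor>q * real (Suc n)\<rfloor> / real (Suc n) \<le> (q * real (Suc n)) / real (Suc n)"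
      by (intro divide_right_mono) linarith+
    also have "\<dots> = q" by simp
    finally show "real_of_int \<lfloor>q * real (Suc n)\<rfloor> / real (Suc n) \<le> q" .
  qed
  note bounds = this
  show "\<forall>\<^sub>F n in sequentially. q - 1 / real (Suc n) \<le> real_of_int \<lfloor>q * real (Suc n)\<rfloor> / real (Suc n)"
    by (rule always_eventually) (rule allI, rule bounds(1))
  show "\<forall>\<^sub>F n in sequentially. real_of_int \<lfloor>q * real (Suc n)\<rfloor> / real (Suc n) \<le> q"
    by (rule always_eventually) (rule allI, rule bounds(2))
qed auto

text \<open>Rounding the random time down to multiples of 1 / (n + 1) leaves countably many values,
  for which evaluation is a countable case distinction; continuity of the path passes to the limit.
  Paths frozen, glued or reflected at random times are measurable for this reason.\<close>

lemma measurable_path_eval: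
  assumes f: "f \<in> measurable M path_sigma" and g: "g \<in> borel_measurable M"
    and pos: "\<And>x. x \<in> space M \<Longrightarrow> 0 \<le> g x"
  shows "(\<lambda>x. f x (g x)) \<in> borel_measurable M"
proof -
  let ?u = "\<lambda>n x. real (nat \<lfloor>g x * real (Suc n)\<rfloor>) / real (Suc n)"
  have fp: "f x \<in> paths" if "x \<in> space M" for x
    using measurable_space[OF f that] by simp
  have meas: "(\<lambda>x. f x (?u n x)) \<in> borel_measurable M" for n
  proof (rule measurable_compose_countable[where g="\<lambda>x. nat \<lfloor>g x * real (Suc n)\<rfloor>"])
    show "(\<lambda>x. f x (real i / real (Suc n))) \<in> borel_measurable M" for i
      by (rule measurable_compose[OF f coord_measurable_path_sigma]) auto
    show "(\<lambda>x. nat \<lfloor>g x * real (Suc n)\<rfloor>) \<in> M \<rightarrow>\<^sub>M count_space UNIV"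
      using g by measurable
  qed
  show ?thesis
  proof (rule borel_measurable_LIMSEQ_real[OF _ meas])
    fix x assume x: "x \<in> space M"
    have "?u n x = real_of_int \<lfloor>g x * real (Suc n)\<rfloor> / real (Suc n)" for n
      using pos[OF x] by simp
    then have "(\<lambda>n. ?u n x) \<longlonglongrightarrow> g x"
      by (simp only: tendsto_floor_div)
    from paths_tendsto[OF fp[OF x] this _ pos[OF x]]
    show "(\<lambda>n. f x (?u n x)) \<longlonglongrightarrow> f x (g x)" by simp
  qed
qed

text \<open>Parametrising the interval by [0, 1] makes the countable set of test points independent
  of the endpoints, which are random in \<open>measurable_path_le_on\<close>; the rationals of
  [a, b] itself would vary with the outcome.\<close>

lemma paths_le_on_iff_rat:
  assumes w: "w \<in> paths" and ab: "0 \<le> a" "a \<le> b"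
  shows "(\<forall>u\<in>{a..b}. w u \<le> c) \<longleftrightarrow> (\<forall>q\<in>\<rat> \<inter> {0..1}. w (a + (b - a) * q) \<le> (c::real))"
proof
  assume *: "\<forall>u\<in>{a..b}. w u \<le> c"
  show "\<forall>q\<in>\<rat> \<inter> {0..1}. w (a + (b - a) * q) \<le> c"
  proof
    fix q :: real assume "q \<in> \<rat> \<inter> {0..1}"
    then have "0 \<le> (b - a) * q" "(b - a) * q \<le> b - a" using ab by (auto simp: mult_left_le)
    then show "w (a + (b - a) * q) \<le> c" using * by auto
  qed
next
  assume *: "\<forall>q\<in>\<rat> \<inter> {0..1}. w (a + (b - a) * q) \<le> c"
  have "\<forall>q\<in>{0..1}. w (a + (b - a) * q) \<le> c"
  proof
    fix q :: real assume q: "q \<in> {0..1}"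
    \<comment> \<open>Rounding down keeps the approximants inside [0, 1], so the hypothesis applies
      to each of them.\<close>
    let ?q = "\<lambda>n::nat. real_of_int \<lfloor>q * real (Suc n)\<rfloor> / real (Suc n)"
    have lim: "?q \<longlonglongrightarrow> q" by (rule tendsto_floor_div)
    have mem: "?q n \<in> \<rat> \<inter> {0..1}" for n
    proof -
      have "of_int \<lfloor>q * real (Suc n)\<rfloor> \<le> q * real (Suc n)" by linarith
      also have "\<dots> \<le> real (Suc n)" using q by (simp add: mult_left_le_one_le)
      finally have "?q n \<le> 1" by simp
      moreover have "0 \<le> ?q n" using q by simp
      moreover have "?q n \<in> \<rat>" by (intro Rats_divide Rats_of_int Rats_of_nat)
      ultimately show ?thesis by simp
    qed
    have "(\<lambda>n. w (a + (b - a) * ?q n)) \<longlonglongrightarrow> w (a + (b - a) * q)"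
    proof (rule paths_tendsto[OF w])
      show "(\<lambda>n. a + (b - a) * ?q n) \<longlonglongrightarrow> a + (b - a) * q" by (intro tendsto_intros lim)
      show "0 \<le> a + (b - a) * ?q n" for n
        by (rule add_nonneg_nonneg[OF ab(1) mult_nonneg_nonneg]) (use ab mem[of n] in simp_all)
      show "0 \<le> a + (b - a) * q" using ab q by auto
    qed
    then show "w (a + (b - a) * q) \<le> c"
      by (rule LIMSEQ_le_const2) (use * mem in blast)
  qed
  note ** = this
  show "\<forall>u\<in>{a..b}. w u \<le> c"
  proof
    fix u assume u: "u \<in> {a..b}"
    show "w u \<le> c"
    proof (cases "a = b")
      case True then show ?thesis using u **[rule_format, of 0] by auto
    next
      case False
      then have "(u - a) / (b - a) \<in> {0..1}" "a + (b - a) * ((u - a) / (b - a)) = u"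
        using u ab by (auto simp: field_simps)
      then show ?thesis using ** by metis
    qed
  qed
qed

lemma measurable_path_le_on:
  assumes f: "f \<in> measurable M path_sigma" and [measurable]: "c \<in> borel_measurable M"
    "a \<in> borel_measurable M" "b \<in> borel_measurable M"
    and ab: "\<And>x. x \<in> space M \<Longrightarrow> 0 \<le> a x \<and> a x \<le> b x"
  shows "Measurable.pred M (\<lambda>x. \<forall>u\<in>{a x..b x}. f x u \<le> c x)"
proof -
  have fp: "f x \<in> paths" if "x \<in> space M" for x
    using measurable_space[OF f that] by simp
  have eq: "(\<forall>u\<in>{a x..b x}. f x u \<le> c x) \<longleftrightarrow>
      (\<forall>q\<in>\<rat> \<inter> {0..1}. f x (a x + (b x - a x) * q) \<le> c x)" if "x \<in> space M" for x
    using paths_le_on_iff_rat[OF fp[OF that]] ab[OF that] by auto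
  have cnt: "countable (\<rat> \<inter> {0..1::real})" by (intro countable_Int1 countable_rat)
  have [measurable]: "(\<lambda>x. f x (a x + (b x - a x) * q)) \<in> borel_measurable M"
    if "q \<in> \<rat> \<inter> {0..1}" for q
    by (rule measurable_path_eval[OF f]) (use ab that in auto)
  show ?thesis
    by (subst measurable_cong[OF eq]) (auto intro!: measurable_pred_countable cnt)
qed

lemma paths_bdd:
  assumes "w \<in> paths" "0 \<le> a"
  shows "bdd_above (w ` {a..b})" "bdd_below (w ` {a..b})"
  using compact_imp_bounded[OF compact_continuous_image[OF paths_continuous_subset[OF assms] compact_Icc]]
  by (auto intro: bounded_imp_bdd_above bounded_imp_bdd_below)

text \<open>Intervals that start away from 0 occur when maxima over two disjoint time intervals are
  compared and when the last maximum time is located.\<close>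

definition isup :: "real \<Rightarrow> real \<Rightarrow> (real \<Rightarrow> real) \<Rightarrow> real" where
  "isup a b w = (SUP u\<in>{a..b}. w u)"

lemma run_sup_eq_isup: "run_sup t = isup 0 t"
  by (simp add: fun_eq_iff run_sup_def isup_def)

lemma isup_le_iff: "w \<in> paths \<Longrightarrow> 0 \<le> a \<Longrightarrow> a \<le> b \<Longrightarrow> isup a b w \<le> c \<longleftrightarrow> (\<forall>u\<in>{a..b}. w u \<le> c)"
  unfolding isup_def by (subst cSUP_le_iff) (auto intro: paths_bdd)

lemma isup_attained:
  assumes "w \<in> paths" "0 \<le> a" "a \<le> b"
  obtains u where "u \<in> {a..b}" "w u = isup a b w"
proof -
  obtain u where u: "u \<in> {a..b}" "\<forall>v\<in>{a..b}. w v \<le> w u"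
    using continuous_attains_sup[OF compact_Icc _ paths_continuous_subset[OF assms(1,2)], of b] assms(3) by auto
  have "isup a b w = w u"
    unfolding isup_def by (rule cSup_eq_maximum) (use u in auto)
  then show ?thesis using that[OF u(1)] by simp
qed

lemma isup_ge: "w \<in> paths \<Longrightarrow> 0 \<le> a \<Longrightarrow> u \<in> {a..b} \<Longrightarrow> w u \<le> isup a b w"
  unfolding isup_def by (rule cSUP_upper) (auto intro: paths_bdd)

lemma isup_eqI:
  assumes "w \<in> paths" "0 \<le> a" "u \<in> {a..b}" "w u = c" "\<And>v. v \<in> {a..b} \<Longrightarrow> w v \<le> c"
  shows "isup a b w = c"
  unfolding isup_def by (rule cSup_eq_maximum) (use assms in auto)

lemma isup_measurable:
  assumes f: "f \<in> measurable M path_sigma" and [measurable]: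
    "a \<in> borel_measurable M" "b \<in> borel_measurable M"
    and ab: "\<And>x. x \<in> space M \<Longrightarrow> 0 \<le> a x \<and> a x \<le> b x"
  shows "(\<lambda>x. isup (a x) (b x) (f x)) \<in> borel_measurable M"
proof (subst borel_measurable_iff_le, rule allI)
  fix c :: real
  have "{x \<in> space M. isup (a x) (b x) (f x) \<le> c} = {x \<in> space M. \<forall>u\<in>{a x..b x}. f x u \<le> c}"
    using measurable_space[OF f] ab by (intro Collect_cong conj_cong refl isup_le_iff) auto
  also have "\<dots> \<in> sets M"
    using measurable_path_le_on[OF f borel_measurable_const assms(2,3) ab, of c] unfolding pred_def .
  finally show "{x \<in> space M. isup (a x) (b x) (f x) \<le> c} \<in> sets M" .
qed

section \<open>Stopping, shifting and gluing of paths\<close>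

definition stop_path :: "real \<Rightarrow> (real \<Rightarrow> real) \<Rightarrow> real \<Rightarrow> real" where
  "stop_path s w = (\<lambda>u\<in>{0..}. w (min u s))"

definition shift_path :: "real \<Rightarrow> (real \<Rightarrow> real) \<Rightarrow> real \<Rightarrow> real" where
  "shift_path s w = (\<lambda>u\<in>{0..}. w (s + u) - w s)"

text \<open>Subtracting \<open>v 0\<close> makes the result continuous at the junction for every
  \<open>v\<close> and makes gluing blind to vertical shifts of \<open>v\<close>. A process started
  anywhere can thus be attached without adjusting its starting value.\<close>

definition glue :: "real \<Rightarrow> (real \<Rightarrow> real) \<Rightarrow> (real \<Rightarrow> real) \<Rightarrow> real \<Rightarrow> real" where
  "glue s w v = (\<lambda>u\<in>{0..}. w (min u s) + (v (max 0 (u - s)) - v 0))"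

definition sub_path :: "real \<Rightarrow> (real \<Rightarrow> real) \<Rightarrow> real \<Rightarrow> real" where
  "sub_path c w = (\<lambda>u\<in>{0..}. c - w u)"

lemma paths_comp:
  assumes "w \<in> paths" "continuous_on {0..} g" "\<And>u. 0 \<le> u \<Longrightarrow> 0 \<le> g u"
  shows "continuous_on {0..} (\<lambda>u. w (g u))"
  by (rule continuous_on_compose2[OF paths_continuous[OF assms(1)] assms(2)]) (use assms(3) in auto)

lemma stop_path_in_paths: "0 \<le> s \<Longrightarrow> w \<in> paths \<Longrightarrow> stop_path s w \<in> paths"
  unfolding stop_path_def
  by (rule restrict_in_paths, rule paths_comp[where g="\<lambda>u. min u s"]) (auto intro!: continuous_intros)

lemma shift_path_in_paths: "0 \<le> s \<Longrightarrow> w \<in> paths \<Longrightarrow> shift_path s w \<in> paths"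
  unfolding shift_path_def
  by (rule restrict_in_paths, rule continuous_on_diff, rule paths_comp[where g="\<lambda>u. s + u"])
    (auto intro!: continuous_intros)

lemma glue_in_paths: "0 \<le> s \<Longrightarrow> w \<in> paths \<Longrightarrow> v \<in> paths \<Longrightarrow> glue s w v \<in> paths"
  unfolding glue_def
  by (rule restrict_in_paths, rule continuous_on_add, rule paths_comp[where g="\<lambda>u. min u s"], assumption)
    (auto intro!: continuous_on_diff paths_comp[where g="\<lambda>u. max 0 (u - s)"] continuous_intros)

lemma sub_path_in_paths: "w \<in> paths \<Longrightarrow> sub_path c w \<in> paths"
  unfolding sub_path_def
  by (intro restrict_in_paths continuous_intros paths_continuous)

text \<open>The stopped path uses only coordinates up to s. Hence every event of the stopped path,
  in the full path sigma-algebra, is an event of the past, to which independence of increments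
  applies.\<close>

lemma stop_path_measurable:
  assumes s: "0 \<le> s" shows "stop_path s \<in> measurable (path_filt s) path_sigma"
proof (rule measurable_path_sigmaI)
  show "stop_path s x \<in> paths" if "x \<in> space (path_filt s)" for x
    using that stop_path_in_paths[OF s] by simp
  show "(\<lambda>x. stop_path s x u) \<in> borel_measurable (path_filt s)" if "0 \<le> u" for u
    using that s coord_measurable_filt[of "min u s" s] by (simp add: stop_path_def)
qed

lemma stop_path_measurable': "0 \<le> s \<Longrightarrow> stop_path s \<in> measurable path_sigma path_sigma"
  by (rule measurable_path_filt_path_sigma[OF stop_path_measurable])

lemma shift_path_measurable_filt:
  assumes s: "0 \<le> s" shows "shift_path s \<in> measurable (path_filt (s + t)) (path_filt t)"
proof (rule measurable_path_filtI)
  show "shift_path s x \<in> paths" if "x \<in> space (path_filt (s + t))" for x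
    using that shift_path_in_paths[OF s] by simp
  show "(\<lambda>x. shift_path s x u) \<in> borel_measurable (path_filt (s + t))" if "0 \<le> u" "u \<le> t" for u
    using that s borel_measurable_diff[OF coord_measurable_filt[of "s + u" "s + t"] coord_measurable_filt[of s "s + t"]]
    by (simp add: shift_path_def)
qed

lemma shift_path_measurable:
  assumes s: "0 \<le> s" shows "shift_path s \<in> measurable path_sigma path_sigma"
proof (rule measurable_path_sigmaI)
  show "shift_path s x \<in> paths" if "x \<in> space path_sigma" for x
    using that shift_path_in_paths[OF s] by simp
  show "(\<lambda>x. shift_path s x u) \<in> borel_measurable path_sigma" if "0 \<le> u" for u
    using that s borel_measurable_diff[OF coord_measurable_path_sigma[of "s + u"] coord_measurable_path_sigma[of s]]
    by (simp add: shift_path_def)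
qed

lemma sub_path_measurable: "sub_path c \<in> measurable path_sigma path_sigma"
proof (rule measurable_path_sigmaI)
  show "sub_path c x \<in> paths" if "x \<in> space path_sigma" for x
    using that sub_path_in_paths by simp
  show "(\<lambda>x. sub_path c x u) \<in> borel_measurable path_sigma" if "0 \<le> u" for u
    using that borel_measurable_diff[OF borel_measurable_const coord_measurable_path_sigma[of u]]
    by (simp add: sub_path_def)
qed

lemma sub_path_measurable_filt: "sub_path c \<in> measurable (path_filt t) (path_filt t)"
proof (rule measurable_path_filtI)
  show "sub_path c x \<in> paths" if "x \<in> space (path_filt t)" for x
    using that sub_path_in_paths by simp
  show "(\<lambda>x. sub_path c x u) \<in> borel_measurable (path_filt t)" if "0 \<le> u" "u \<le> t" for u
    using that borel_measurable_diff[OF borel_measurable_const coord_measurable_filt[of u t]]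
    by (simp add: sub_path_def)
qed

lemma glue_measurable:
  assumes s: "s \<in> borel_measurable M" "\<And>x. x \<in> space M \<Longrightarrow> 0 \<le> s x"
    and f: "f \<in> measurable M path_sigma" and g: "g \<in> measurable M path_sigma"
  shows "(\<lambda>x. glue (s x) (f x) (g x)) \<in> measurable M path_sigma"
proof (rule measurable_path_sigmaI)
  show "glue (s x) (f x) (g x) \<in> paths" if "x \<in> space M" for x
    using that s(2) measurable_space[OF f that] measurable_space[OF g that] by (auto intro: glue_in_paths)
  show "(\<lambda>x. glue (s x) (f x) (g x) u) \<in> borel_measurable M" if u: "0 \<le> u" for u
  proof -
    note s(1)[measurable]
    have "(\<lambda>x. f x (min u (s x))) \<in> borel_measurable M"
      by (rule measurable_path_eval[OF f]) (use s(2) u in simp_all)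
    moreover have "(\<lambda>x. g x (max 0 (u - s x))) \<in> borel_measurable M"
      by (rule measurable_path_eval[OF g]) simp_all
    moreover have "(\<lambda>x. g x 0) \<in> borel_measurable M"
      by (rule measurable_path_eval[OF g]) simp_all
    ultimately show ?thesis unfolding glue_def using u by simp
  qed
qed

text \<open>It rewrites a functional of the path as a functional of the pair (past, future), the
  form in which the Markov property is applied.\<close>

lemma glue_stop_shift:
  assumes "0 \<le> s" "w \<in> paths" shows "glue s (stop_path s w) (shift_path s w) = w"
proof (rule paths_eqI)
  show "glue s (stop_path s w) (shift_path s w) \<in> paths"
    using assms by (intro glue_in_paths stop_path_in_paths shift_path_in_paths)
  show "glue s (stop_path s w) (shift_path s w) u = w u" if "0 \<le> u" for u
    using assms that by (cases "u \<le> s") (simp_all add: glue_def stop_path_def shift_path_def)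
qed fact

text \<open>All constraints are bounded and one at the distinguished time \<open>t\<close> is always
  present. Indicators of bounded open sets are limits of continuous functions of bounded support,
  and the forced factor at \<open>t\<close> later dominates densities that grow with the position at
  \<open>t\<close>.\<close>

definition boxes :: "real set \<Rightarrow> real \<Rightarrow> (real \<Rightarrow> real) set set" where
  "boxes I t = {{w \<in> paths. \<forall>j\<in>J. w j \<in> U j} | J U.
     finite J \<and> J \<subseteq> I \<and> t \<in> J \<and> (\<forall>j\<in>J. open (U j) \<and> bounded (U j))}"

lemma Int_stable_boxes: "Int_stable (boxes I t)"
proof (rule Int_stableI)
  fix A B assume "A \<in> boxes I t" "B \<in> boxes I t"
  then obtain J U K V where A: "A = {w \<in> paths. \<forall>j\<in>J. w j \<in> U j}" "finite J" "J \<subseteq> I" "t \<in> J"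
      "\<forall>j\<in>J. open (U j) \<and> bounded (U j)"
    and B: "B = {w \<in> paths. \<forall>j\<in>K. w j \<in> V j}" "finite K" "K \<subseteq> I"
      "\<forall>j\<in>K. open (V j) \<and> bounded (V j)"
    unfolding boxes_def by blast
  \<comment> \<open>A missing constraint is replaced by \<open>UNIV\<close>; boundedness survives
    because each index of the union carries at least one genuine constraint.\<close>
  let ?W = "\<lambda>j. (if j \<in> J then U j else UNIV) \<inter> (if j \<in> K then V j else UNIV)"
  have "A \<inter> B = {w \<in> paths. \<forall>j\<in>J \<union> K. w j \<in> ?W j}" unfolding A(1) B(1) by auto
  moreover have "\<forall>j\<in>J \<union> K. open (?W j) \<and> bounded (?W j)" using A(5) B(4) by (auto intro: bounded_Int)
  ultimately show "A \<inter> B \<in> boxes I t"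
    unfolding boxes_def using A(2-4) B(2,3)
    by (intro CollectI exI[of _ "J \<union> K"] exI[of _ ?W]) auto
qed

lemma coord_algebra_boxes:
  assumes "t \<in> I" shows "sets (coord_algebra I) = sigma_sets paths (boxes I t)"
proof
  have sub: "boxes I t \<subseteq> Pow paths" unfolding boxes_def by auto
  let ?S = "sigma paths (boxes I t)"
  have coord: "(\<lambda>w. w s) \<in> borel_measurable ?S" if s: "s \<in> I" for s
  proof (rule borel_measurableI)
    fix A :: "real set" assume A: "open A"
    \<comment> \<open>Truncation by balls supplies boundedness and the constraint at
      \<open>t\<close>; the union over n removes it again.\<close>
    let ?B = "\<lambda>n::nat. {w \<in> paths. \<forall>j\<in>{s, t}. w j \<in> (if j = s then A \<inter> ball 0 (real n) else ball 0 (real n))}"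
    have "?B n \<in> boxes I t" for n
      unfolding boxes_def
      by (intro CollectI exI[of _ "{s, t}"] exI[of _ "\<lambda>j. if j = s then A \<inter> ball 0 (real n) else ball 0 (real n)"])
        (use s assms A in \<open>auto intro: bounded_Int\<close>)
    then have "?B n \<in> sets ?S" for n using sub by simp
    then have "(\<Union>n. ?B n) \<in> sets ?S" by blast
    also have "(\<Union>n. ?B n) = (\<lambda>w. w s) -` A \<inter> space ?S"
    proof -
      have "\<exists>n. w \<in> ?B n" if "w \<in> paths" "w s \<in> A" for w
      proof -
        obtain n where "max \<bar>w s\<bar> \<bar>w t\<bar> < real n" using reals_Archimedean2 by blast
        then show ?thesis using that by (intro exI[of _ n]) auto
      qed
      then show ?thesis using sub by auto
    qed
    finally show "(\<lambda>w. w s) -` A \<inter> space ?S \<in> sets ?S" .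
  qed
  have "{w \<in> paths. w s \<in> A} \<in> sigma_sets paths (boxes I t)" if "s \<in> I" "A \<in> sets borel" for s A
  proof -
    have "{w \<in> paths. w s \<in> A} = (\<lambda>w. w s) -` A \<inter> space ?S" using sub by auto
    also have "\<dots> \<in> sets ?S" by (rule measurable_sets[OF coord[OF that(1)] that(2)])
    finally show ?thesis using sub by simp
  qed
  then show "sets (coord_algebra I) \<subseteq> sigma_sets paths (boxes I t)"
    unfolding sets_coord_algebra by (intro sigma_sets_mono) blast
  have "{w \<in> paths. \<forall>j\<in>J. w j \<in> U j} \<in> sets (coord_algebra I)"
    if J: "finite J" "J \<subseteq> I" "t \<in> J" and U: "\<forall>j\<in>J. open (U j) \<and> bounded (U j)" for J U
  proof -
    have "{w \<in> space (coord_algebra I). \<forall>j\<in>J. w j \<in> U j} \<in> sets (coord_algebra I)"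
    proof (rule sets.sets_Collect_finite_All'[OF _ J(1)])
      fix j assume j: "j \<in> J"
      have "{w \<in> space (coord_algebra I). w j \<in> U j} = (\<lambda>w. w j) -` U j \<inter> space (coord_algebra I)" by auto
      then show "{w \<in> space (coord_algebra I). w j \<in> U j} \<in> sets (coord_algebra I)"
        using measurable_sets[OF coord_measurable[of j I]] j J U by auto
    qed (use J in auto)
    then show ?thesis by simp
  qed
  then have "boxes I t \<subseteq> sets (coord_algebra I)" unfolding boxes_def by blast
  then show "sigma_sets paths (boxes I t) \<subseteq> sets (coord_algebra I)"
    using sets.sigma_sets_subset[of "boxes I t" "coord_algebra I"] by simp
qed

text \<open>Boundedness guarantees that the complement of \<open>U\<close> is nonempty: the distance
  to the empty set is 0 by convention, and the bumps would then vanish identically.\<close>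

lemma tendsto_bump_indicator:
  fixes U :: "real set"
  assumes "open U" "bounded U"
  shows "(\<lambda>m. min 1 (real m * infdist u (- U))) \<longlonglongrightarrow> indicator U u"
proof (cases "u \<in> U")
  case True
  have ne: "- U \<noteq> {}" using assms(2) not_bounded_UNIV by (metis compl_bot_eq double_complement)
  have "infdist u (- U) > 0"
    using True assms(1) ne in_closed_iff_infdist_zero[of "- U" u] infdist_nonneg[of u "- U"]
    by (auto simp: closed_Compl less_le)
  then obtain m0 :: nat where m0: "1 < real m0 * infdist u (- U)" using reals_Archimedean3 by blast
  have "min 1 (real m * infdist u (- U)) = 1" if "m \<ge> m0" for m
  proof -
    have "real m0 * infdist u (- U) \<le> real m * infdist u (- U)"
      by (rule mult_right_mono) (use that infdist_nonneg in auto)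
    then show ?thesis using m0 by simp
  qed
  then have "\<forall>\<^sub>F m in sequentially. min 1 (real m * infdist u (- U)) = 1"
    unfolding eventually_sequentially by blast
  then show ?thesis using True by (simp add: tendsto_eventually)
next
  case False then show ?thesis by simp
qed

text \<open>Products of bump functions increase to the indicator of a box, so monotone convergence
  carries the equality of integrals to the generating boxes. The test functions are continuous and
  have bounded support, as the later limits and dominations demand.\<close>

lemma coord_algebra_eqI:
  assumes t: "t \<in> I" and M: "sets M = sets (coord_algebra I)" and N: "sets N = sets (coord_algebra I)"
    and fin: "finite_measure M"
    and eq: "\<And>J f. finite J \<Longrightarrow> J \<subseteq> I \<Longrightarrow> t \<in> J \<Longrightarrow> (\<And>j. continuous_on UNIV (f j)) \<Longrightarrow>
      (\<And>j u. f j u \<in> {0..1}) \<Longrightarrow> (\<And>j. \<exists>K. \<forall>u. K < \<bar>u\<bar> \<longrightarrow> f j u = 0) \<Longrightarrow>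
      (\<integral>\<^sup>+w. ennreal (\<Prod>j\<in>J. f j (w j)) \<partial>M) = (\<integral>\<^sup>+w. ennreal (\<Prod>j\<in>J. f j (w j)) \<partial>N)"
  shows "M = N"
proof (rule measure_eqI_generator_eq[OF Int_stable_boxes[of I t], where \<Omega>=paths
      and A="\<lambda>n. {w \<in> paths. w t \<in> ball 0 (real n)}"])
  show "boxes I t \<subseteq> Pow paths" unfolding boxes_def by auto
  show "sets M = sigma_sets paths (boxes I t)" "sets N = sigma_sets paths (boxes I t)"
    using M N coord_algebra_boxes[OF t] by auto
  show "range (\<lambda>n. {w \<in> paths. w t \<in> ball 0 (real n)}) \<subseteq> boxes I t"
  proof (clarify)
    fix n :: nat
    show "{w \<in> paths. w t \<in> ball 0 (real n)} \<in> boxes I t"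
      unfolding boxes_def by (intro CollectI exI[of _ "{t}"] exI[of _ "\<lambda>_. ball 0 (real n)"]) (use t in auto)
  qed
  show "(\<Union>n. {w \<in> paths. w t \<in> ball 0 (real n)}) = paths"
    using reals_Archimedean2 by auto
  show "emeasure M {w \<in> paths. w t \<in> ball 0 (real n)} \<noteq> \<infinity>" for n
    using finite_measure.emeasure_finite[OF fin] by auto
  fix X assume "X \<in> boxes I t"
  then obtain J U where X: "X = {w \<in> paths. \<forall>j\<in>J. w j \<in> U j}" and J: "finite J" "J \<subseteq> I" "t \<in> J"
    and U: "\<forall>j\<in>J. open (U j) \<and> bounded (U j)"
    unfolding boxes_def by blast
  \<comment> \<open>Outside \<open>J\<close> the set is empty, so the bumps vanish there and the
    requirements on the test functions hold for every index.\<close>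
  define V where "V = (\<lambda>j. if j \<in> J then U j else {})"
  have V: "open (V j)" "bounded (V j)" for j using U by (auto simp: V_def)
  define f where "f = (\<lambda>m j u. min 1 (real m * infdist u (- V j)))"
  have f01: "f m j u \<in> {0..1}" for m j u unfolding f_def by (auto simp: infdist_nonneg)
  have fc: "continuous_on UNIV (f m j)" for m j
    unfolding f_def by (intro continuous_intros)
  have fK: "\<exists>K. \<forall>u. K < \<bar>u\<bar> \<longrightarrow> f m j u = 0" for m j
  proof -
    obtain K where K: "\<forall>u\<in>V j. \<bar>u\<bar> \<le> K" using V(2)[of j] unfolding bounded_iff by auto
    show ?thesis
    proof (intro exI[of _ K] allI impI)
      fix u :: real assume "K < \<bar>u\<bar>"
      then have "u \<in> - V j" using K by force
      then show "f m j u = 0" by (simp add: f_def)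
    qed
  qed
  have meas: "(\<lambda>w. ennreal (\<Prod>j\<in>J. f m j (w j))) \<in> borel_measurable L"
    if "sets L = sets (coord_algebra I)" for m L
  proof -
    have "(\<lambda>w. f m j (w j)) \<in> borel_measurable L" if "j \<in> J" for j
      using measurable_compose[OF coord_measurable[of j I] borel_measurable_continuous_onI[OF fc[of m j]]]
        that J(2) measurable_cong_sets[OF \<open>sets L = sets (coord_algebra I)\<close> refl] by blast
    then show ?thesis by measurable
  qed
  have inc: "incseq (\<lambda>m w. ennreal (\<Prod>j\<in>J. f m j (w j)))"
  proof (rule incseq_SucI, rule le_funI)
    fix m w
    have "f m j (w j) \<le> f (Suc m) j (w j)" for j
      unfolding f_def by (intro min.mono order_refl mult_right_mono) (auto simp: infdist_nonneg)
    then show "ennreal (\<Prod>j\<in>J. f m j (w j)) \<le> ennreal (\<Prod>j\<in>J. f (Suc m) j (w j))"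
      using f01 by (intro ennreal_leI prod_mono) auto
  qed
  have lim: "(\<lambda>m. ennreal (\<Prod>j\<in>J. f m j (w j))) \<longlonglongrightarrow> ennreal (\<Prod>j\<in>J. indicator (V j) (w j))" for w
    unfolding f_def by (intro tendsto_ennrealI tendsto_prod tendsto_bump_indicator V)
  have em: "(\<lambda>m. \<integral>\<^sup>+w. ennreal (\<Prod>j\<in>J. f m j (w j)) \<partial>L) \<longlonglongrightarrow> emeasure L X"
    if L: "sets L = sets (coord_algebra I)" for L
  proof -
    have "(\<lambda>m. \<integral>\<^sup>+w. ennreal (\<Prod>j\<in>J. f m j (w j)) \<partial>L)
        \<longlonglongrightarrow> (\<integral>\<^sup>+w. ennreal (\<Prod>j\<in>J. indicator (V j) (w j)) \<partial>L)"
      by (rule nn_integral_LIMSEQ[OF inc meas[OF L] lim])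
    also have "(\<integral>\<^sup>+w. ennreal (\<Prod>j\<in>J. indicator (V j) (w j)) \<partial>L) = (\<integral>\<^sup>+w. indicator X w \<partial>L)"
    proof (rule nn_integral_cong)
      fix w assume "w \<in> space L"
      then have w: "w \<in> paths" using sets_eq_imp_space_eq[OF L] by simp
      show "ennreal (\<Prod>j\<in>J. indicator (V j) (w j)) = indicator X w"
      proof (cases "w \<in> X")
        case True
        then have "(\<Prod>j\<in>J. indicator (V j) (w j)) = (1::real)"
          unfolding X V_def by (intro prod.neutral) auto
        then show ?thesis using True by simp
      next
        case False
        then obtain j where "j \<in> J" "w j \<notin> V j" using w unfolding X V_def by auto
        then have "(\<Prod>j\<in>J. indicator (V j) (w j)) = (0::real)"
          using J(1) \<open>j \<in> J\<close> by (intro prod_zero bexI[of _ j]) auto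
        then show ?thesis using False by simp
      qed
    qed
    also have "\<dots> = emeasure L X"
    proof -
      have "X \<in> sets L"
        using \<open>X \<in> boxes I t\<close> L coord_algebra_boxes[OF t] by auto
      then show ?thesis by simp
    qed
    finally show ?thesis .
  qed
  show "emeasure M X = emeasure N X"
    using LIMSEQ_unique[OF em[OF M]] em[OF N] eq[OF J fc f01 fK] by presburger
qed

section \<open>Uniqueness of Wiener measure and the Markov property\<close>

definition gauss :: "real \<Rightarrow> real measure" where
  "gauss d = density lborel (\<lambda>u. ennreal (normal_density 0 (sqrt d) u))"

lemma sets_gauss [measurable_cong, simp]: "sets (gauss d) = sets borel"
  and space_gauss [simp]: "space (gauss d) = UNIV"
  unfolding gauss_def by auto

lemma prob_space_gauss: "0 < d \<Longrightarrow> prob_space (gauss d)"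
  unfolding gauss_def by (rule prob_space_normal_density) simp

lemma emeasure_gauss_uminus:
  assumes A: "A \<in> sets borel" shows "emeasure (gauss d) {u. - u \<in> A} = emeasure (gauss d) A"
proof -
  have mA: "{u. - u \<in> A} \<in> sets borel"
    using measurable_sets[OF borel_measurable_uminus[OF measurable_ident] A] by (simp add: vimage_def)
  have "emeasure (gauss d) A = (\<integral>\<^sup>+u. ennreal (normal_density 0 (sqrt d) u) * indicator A u \<partial>lborel)"
    unfolding gauss_def using A by (subst emeasure_density) auto
  also have "\<dots> = (\<integral>\<^sup>+u. ennreal (normal_density 0 (sqrt d) (- u)) * indicator A (- u) \<partial>lborel)"
    using A by (subst nn_integral_real_affine[where c="-1" and t=0]) auto
  also have "\<dots> = (\<integral>\<^sup>+u. ennreal (normal_density 0 (sqrt d) u) * indicator {u. - u \<in> A} u \<partial>lborel)"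
    by (intro nn_integral_cong) (simp add: normal_density_def indicator_def)
  also have "\<dots> = emeasure (gauss d) {u. - u \<in> A}"
    unfolding gauss_def using mA by (subst emeasure_density) auto
  finally show ?thesis by simp
qed

lemma wiener_lawD:
  assumes "wiener_law x P"
  shows wiener_prob: "prob_space P" and wiener_sets: "sets P = sets path_sigma"
    and wiener_space: "space P = paths" and wiener_start: "AE w in P. w 0 = x"
  using assms space_eq_paths[of P] unfolding wiener_law_def by simp_all

lemma wiener_measurable: "wiener_law x P \<Longrightarrow> measurable P N = measurable path_sigma N"
  by (rule measurable_cong_sets[OF wiener_sets refl])

lemma wiener_path_filt: "wiener_law x P \<Longrightarrow> A \<in> sets (path_filt s) \<Longrightarrow> A \<in> sets P"
  using sets_path_filt_le wiener_sets by blast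

lemma wiener_incr_measurable:
  assumes "0 \<le> s" "0 \<le> t" shows "(\<lambda>w. w t - w s) \<in> borel_measurable path_sigma"
  using assms by (intro borel_measurable_diff coord_measurable_path_sigma)

lemma wiener_incr_set:
  assumes "0 \<le> s" "0 \<le> t" "B \<in> sets borel" shows "{w \<in> paths. w t - w s \<in> B} \<in> sets path_sigma"
  using measurable_sets[OF wiener_incr_measurable[OF assms(1,2)] assms(3)]
  by (simp add: vimage_def Int_def conj_commute)

lemma wiener_indep:
  assumes P: "wiener_law x P" and st: "0 \<le> s" "s < t"
    and A: "A \<in> sets (path_filt s)" and B: "B \<in> sets borel"
  shows "emeasure P (A \<inter> {w \<in> paths. w t - w s \<in> B}) = emeasure P A * emeasure (gauss (t - s)) B"
proof -
  interpret prob_space P using wiener_prob[OF P] .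
  have m: "(\<lambda>w. w t - w s) \<in> borel_measurable P"
    using wiener_incr_measurable[of s t] st by (simp add: wiener_measurable[OF P])
  have d: "distributed P lborel (\<lambda>w. w t - w s) (normal_density 0 (sqrt (t - s)))"
    and i: "indep_set (sets (path_filt s)) (sets (vimage_algebra (space P) (\<lambda>w. w t - w s) borel))"
    using P st unfolding wiener_law_def by auto
  let ?B = "{w \<in> paths. w t - w s \<in> B}"
  have B': "?B = (\<lambda>w. w t - w s) -` B \<inter> space P" using wiener_space[OF P] by auto
  have "?B \<in> sets (vimage_algebra (space P) (\<lambda>w. w t - w s) borel)"
    unfolding B' by (rule in_vimage_algebra[OF B])
  then have "prob (A \<inter> ?B) = prob A * prob ?B" by (rule indep_setD[OF i A])
  then have "emeasure P (A \<inter> ?B) = emeasure P A * emeasure P ?B"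
    by (simp only: emeasure_eq_measure ennreal_mult[OF measure_nonneg measure_nonneg])
  moreover have "emeasure P ?B = emeasure (gauss (t - s)) B"
  proof -
    have "emeasure P ?B = emeasure (distr P lborel (\<lambda>w. w t - w s)) B"
      unfolding B' using m B by (subst emeasure_distr) auto
    then show ?thesis using distributed_distr_eq_density[OF d] by (simp add: gauss_def)
  qed
  ultimately show ?thesis by (simp only:)
qed

text \<open>With A the whole space the product formula identifies the law of the increment; for
  general A it is then independence. A single identity per pair of times thus recognises Wiener
  measure.\<close>

lemma wiener_lawI:
  assumes P: "prob_space P" "sets P = sets path_sigma" "AE w in P. w 0 = x"
    and indep: "\<And>s t A B. 0 \<le> s \<Longrightarrow> s < t \<Longrightarrow> A \<in> sets (path_filt s) \<Longrightarrow> B \<in> sets borel \<Longrightarrow>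
      emeasure P (A \<inter> {w \<in> paths. w t - w s \<in> B}) = emeasure P A * emeasure (gauss (t - s)) B"
  shows "wiener_law x P"
  unfolding wiener_law_def
proof (intro conjI allI impI P)
  interpret prob_space P by fact
  have sp: "space P = paths" using space_eq_paths[OF P(2)] .
  fix s t :: real assume st: "0 \<le> s \<and> s < t"
  have m: "(\<lambda>w. w t - w s) \<in> borel_measurable P"
    using wiener_incr_measurable[of s t] st measurable_cong_sets[OF P(2) refl] by auto
  have B': "(\<lambda>w. w t - w s) -` B \<inter> space P = {w \<in> paths. w t - w s \<in> B}" for B using sp by auto
  have e: "emeasure P {w \<in> paths. w t - w s \<in> B} = emeasure (gauss (t - s)) B" if "B \<in> sets borel" for B
  proof -
    have "paths \<in> sets (path_filt s)" using sets.top[of "path_filt s"] by simp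
    from indep[OF _ _ this that, of t] st show ?thesis
      using emeasure_space_1 sp by (simp add: Int_absorb1)
  qed
  show "distributed P lborel (\<lambda>w. w t - w s) (normal_density 0 (sqrt (t - s)))"
    unfolding distributed_def
  proof (intro conjI)
    show "distr P lborel (\<lambda>w. w t - w s) = density lborel (normal_density 0 (sqrt (t - s)))"
    proof (rule measure_eqI)
      fix B assume "B \<in> sets (distr P lborel (\<lambda>w. w t - w s))"
      then have "B \<in> sets borel" by simp
      then show "emeasure (distr P lborel (\<lambda>w. w t - w s)) B
          = emeasure (density lborel (normal_density 0 (sqrt (t - s)))) B"
        using e[of B] m by (subst emeasure_distr) (auto simp: B' gauss_def)
    qed simp
  qed (use m in auto)
  show "indep_set (sets (path_filt s)) (sets (vimage_algebra (space P) (\<lambda>w. w t - w s) borel))"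
    unfolding indep_sets2_eq
  proof (intro conjI ballI)
    show "sets (path_filt s) \<subseteq> events" using sets_path_filt_le P(2) by simp
    show "sets (vimage_algebra (space P) (\<lambda>w. w t - w s) borel) \<subseteq> events"
      using m measurable_sets[OF m] by (auto simp: sets_vimage_algebra2)
    fix A b assume A: "A \<in> sets (path_filt s)"
      and "b \<in> sets (vimage_algebra (space P) (\<lambda>w. w t - w s) borel)"
    then obtain B where B: "B \<in> sets borel" "b = {w \<in> paths. w t - w s \<in> B}"
      using sp by (auto simp: sets_vimage_algebra2)
    have "emeasure P (A \<inter> b) = emeasure P A * emeasure P b"
      using indep[OF _ _ A B(1), of t] st e[OF B(1)] B(2) by simp
    then show "prob (A \<inter> b) = prob A * prob b"
      by (simp add: emeasure_eq_measure ennreal_mult''[symmetric])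
  qed
qed

text \<open>As a product measure, past and next increment are accessible to Fubini, which integrates
  out the increment with the past frozen.\<close>

lemma wiener_pair:
  assumes P: "wiener_law x P" and st: "0 \<le> s" "s < t"
  shows "distr P (path_filt s) (\<lambda>w. w) \<Otimes>\<^sub>M gauss (t - s) =
    distr P (path_filt s \<Otimes>\<^sub>M borel) (\<lambda>w. (w, w t - w s))"
proof -
  interpret prob_space P using wiener_prob[OF P] .
  interpret G: prob_space "gauss (t - s)" using prob_space_gauss[of "t - s"] st by simp
  have id: "(\<lambda>w. w) \<in> measurable P (path_filt s)"
    unfolding wiener_measurable[OF P] by (rule measurable_path_filtI) (auto intro: coord_measurable_path_sigma)
  interpret D: prob_space "distr P (path_filt s) (\<lambda>w. w)" by (rule prob_space_distr[OF id])
  have m: "(\<lambda>w. w t - w s) \<in> borel_measurable P"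
    using wiener_incr_measurable[of s t] st by (simp add: wiener_measurable[OF P])
  show ?thesis
  proof (rule pair_measure_eqI)
    show "sigma_finite_measure (distr P (path_filt s) (\<lambda>w. w))" ..
    show "sigma_finite_measure (gauss (t - s))" ..
    show "sets (distr P (path_filt s) (\<lambda>w. w) \<Otimes>\<^sub>M gauss (t - s)) =
        sets (distr P (path_filt s \<Otimes>\<^sub>M borel) (\<lambda>w. (w, w t - w s)))"
      by (simp cong: sets_pair_measure_cong)
    fix A B assume A: "A \<in> sets (distr P (path_filt s) (\<lambda>w. w))" and B: "B \<in> sets (gauss (t - s))"
    then have AB: "A \<in> sets (path_filt s)" "B \<in> sets borel" by auto
    have "(\<lambda>w. (w, w t - w s)) -` (A \<times> B) \<inter> space P = A \<inter> {w \<in> paths. w t - w s \<in> B}"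
      using wiener_space[OF P] by auto
    moreover have "(\<lambda>w. w) -` A \<inter> space P = A"
      using wiener_space[OF P] sets.sets_into_space[OF AB(1)] by auto
    ultimately show "emeasure (distr P (path_filt s) (\<lambda>w. w)) A * emeasure (gauss (t - s)) B
        = emeasure (distr P (path_filt s \<Otimes>\<^sub>M borel) (\<lambda>w. (w, w t - w s))) (A \<times> B)"
      unfolding emeasure_distr[OF id AB(1)] emeasure_distr[OF measurable_Pair[OF id m] pair_measureI[OF AB]]
      using wiener_indep[OF P st AB] by simp
  qed
qed

lemma wiener_nn_integral_incr:
  assumes P: "wiener_law x P" and st: "0 \<le> s" "s < t"
    and F: "F \<in> borel_measurable (path_filt s \<Otimes>\<^sub>M borel)"
  shows "(\<integral>\<^sup>+w. F (w, w t - w s) \<partial>P) = (\<integral>\<^sup>+w. \<integral>\<^sup>+u. F (w, u) \<partial>gauss (t - s) \<partial>P)"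
proof -
  interpret G: prob_space "gauss (t - s)" using prob_space_gauss[of "t - s"] st by simp
  have id: "(\<lambda>w. w) \<in> measurable P (path_filt s)"
    unfolding wiener_measurable[OF P] by (rule measurable_path_filtI) (auto intro: coord_measurable_path_sigma)
  have m: "(\<lambda>w. (w, w t - w s)) \<in> measurable P (path_filt s \<Otimes>\<^sub>M borel)"
    using wiener_incr_measurable[of s t] st
    by (intro measurable_Pair id) (simp add: wiener_measurable[OF P])
  have F': "F \<in> borel_measurable (path_filt s \<Otimes>\<^sub>M gauss (t - s))"
    using F by (simp cong: measurable_cong_sets sets_pair_measure_cong)
  then have F'': "F \<in> borel_measurable (distr P (path_filt s) (\<lambda>w. w) \<Otimes>\<^sub>M gauss (t - s))"
    by (simp cong: measurable_cong_sets sets_pair_measure_cong)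
  have "(\<integral>\<^sup>+w. F (w, w t - w s) \<partial>P) = (\<integral>\<^sup>+z. F z \<partial>distr P (path_filt s \<Otimes>\<^sub>M borel) (\<lambda>w. (w, w t - w s)))"
    by (subst nn_integral_distr[OF m]) (use F in simp_all)
  also have "\<dots> = (\<integral>\<^sup>+w. \<integral>\<^sup>+u. F (w, u) \<partial>gauss (t - s) \<partial>distr P (path_filt s) (\<lambda>w. w))"
    unfolding wiener_pair[OF P st, symmetric] by (rule G.nn_integral_fst[OF F'', symmetric])
  also have "\<dots> = (\<integral>\<^sup>+w. \<integral>\<^sup>+u. F (w, u) \<partial>gauss (t - s) \<partial>P)"
    using G.borel_measurable_nn_integral_fst[OF F'] by (subst nn_integral_distr[OF id]) simp_all
  finally show ?thesis .
qed

lemma wiener_integral_incr: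
  fixes F :: "_ \<Rightarrow> real"
  assumes P: "wiener_law x P" and st: "0 \<le> s" "s < t"
    and F: "F \<in> borel_measurable (path_filt s \<Otimes>\<^sub>M borel)" and bdd: "\<And>z. \<bar>F z\<bar> \<le> K"
  shows "(\<integral>w. F (w, w t - w s) \<partial>P) = (\<integral>w. \<integral>u. F (w, u) \<partial>gauss (t - s) \<partial>P)"
proof -
  interpret G: prob_space "gauss (t - s)" using prob_space_gauss[of "t - s"] st by simp
  interpret prob_space P using wiener_prob[OF P] .
  have id: "(\<lambda>w. w) \<in> measurable P (path_filt s)"
    unfolding wiener_measurable[OF P] by (rule measurable_path_filtI) (auto intro: coord_measurable_path_sigma)
  interpret D: prob_space "distr P (path_filt s) (\<lambda>w. w)" by (rule prob_space_distr[OF id])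
  interpret pair_sigma_finite "distr P (path_filt s) (\<lambda>w. w)" "gauss (t - s)" ..
  have m: "(\<lambda>w. (w, w t - w s)) \<in> measurable P (path_filt s \<Otimes>\<^sub>M borel)"
    using wiener_incr_measurable[of s t] st
    by (intro measurable_Pair id) (simp add: wiener_measurable[OF P])
  have F': "F \<in> borel_measurable (path_filt s \<Otimes>\<^sub>M gauss (t - s))"
    using F by (simp cong: measurable_cong_sets sets_pair_measure_cong)
  then have F'': "F \<in> borel_measurable (distr P (path_filt s) (\<lambda>w. w) \<Otimes>\<^sub>M gauss (t - s))"
    by (simp cong: measurable_cong_sets sets_pair_measure_cong)
  interpret DG: prob_space "distr P (path_filt s) (\<lambda>w. w) \<Otimes>\<^sub>M gauss (t - s)"
    by (rule prob_space_pair) unfold_locales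
  have "(\<integral>w. F (w, w t - w s) \<partial>P) = (\<integral>z. F z \<partial>distr P (path_filt s \<Otimes>\<^sub>M borel) (\<lambda>w. (w, w t - w s)))"
    by (rule integral_distr[OF m F, symmetric])
  also have "\<dots> = (\<integral>w. \<integral>u. F (w, u) \<partial>gauss (t - s) \<partial>distr P (path_filt s) (\<lambda>w. w))"
    unfolding wiener_pair[OF P st, symmetric]
    by (rule integral_fst'[symmetric]) (rule DG.integrable_const_bound[where B=K], use bdd F'' in auto)
  also have "\<dots> = (\<integral>w. \<integral>u. F (w, u) \<partial>gauss (t - s) \<partial>P)"
    by (rule integral_distr[OF id]) (use F' in measurable)
  finally show ?thesis .
qed

text \<open>The largest time b is removed by integrating over the increment from the preceding time
  s: its factor becomes a function of the position at s and is absorbed there. In the end only time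
  0 is left, where the position is x.\<close>

lemma wiener_fdd_unique:
  assumes P: "wiener_law x P" and Q: "wiener_law x Q" and J: "finite J"
  shows "J \<subseteq> {0..} \<Longrightarrow> 0 \<in> J \<Longrightarrow> (\<And>j. f j \<in> borel_measurable borel) \<Longrightarrow>
    (\<integral>\<^sup>+w. (\<Prod>j\<in>J. f j (w j)) \<partial>P) = (\<integral>\<^sup>+w. (\<Prod>j\<in>J. (f j (w j) :: ennreal)) \<partial>Q)"
  using J
proof (induction J arbitrary: f rule: finite_linorder_max_induct)
  case empty then show ?case by simp
next
  case (insert b A)
  have bA: "b \<notin> A" using insert.hyps by auto
  note fm = \<open>\<And>j. f j \<in> borel_measurable borel\<close>
  show ?case
  proof (cases "A = {}")
    case True
    then have b: "b = 0" using insert.prems by auto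
    have "(\<integral>\<^sup>+w. f 0 (w 0) \<partial>L) = f 0 x" if L: "wiener_law x L" for L
    proof -
      interpret prob_space L using wiener_prob[OF L] .
      have "(\<integral>\<^sup>+w. f 0 (w 0) \<partial>L) = (\<integral>\<^sup>+w. f 0 x \<partial>L)"
        by (rule nn_integral_cong_AE) (use wiener_start[OF L] in auto)
      then show ?thesis by (simp add: emeasure_space_1)
    qed
    then show ?thesis using True b P Q by simp
  next
    case False
    \<comment> \<open>Otherwise b = 0, although b exceeds every element of a nonempty set of
      nonnegative times.\<close>
    have A0: "0 \<in> A"
    proof (rule ccontr)
      assume "0 \<notin> A"
      then have "b = 0" using insert.prems by auto
      then show False using False insert.hyps insert.prems by fastforce
    qed
    define s where "s = Max A"
    have sA: "s \<in> A" unfolding s_def using insert.hyps False by simp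
    have As: "a \<le> s" "0 \<le> a" if "a \<in> A" for a
      using that insert.hyps insert.prems unfolding s_def by auto
    have sb: "0 \<le> s" "s < b" using sA As insert.hyps by auto
    interpret G: prob_space "gauss (b - s)" using prob_space_gauss[of "b - s"] sb by simp
    \<comment> \<open>This is the Brownian transition operator over the time b - s, applied to the
      factor at b.\<close>
    define h where "h = (\<lambda>y. \<integral>\<^sup>+u. f b (y + u) \<partial>gauss (b - s))"
    have hm: "h \<in> borel_measurable borel"
    proof -
      have "(\<lambda>(y, u). f b (y + u)) \<in> borel_measurable (borel \<Otimes>\<^sub>M gauss (b - s))"
        using measurable_compose[OF _ fm[of b], of "\<lambda>(y, u). y + u" "borel \<Otimes>\<^sub>M gauss (b - s)"]
        by (simp add: split_beta')
      then show ?thesis unfolding h_def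
        using G.borel_measurable_nn_integral_fst[of "\<lambda>(y, u). f b (y + u)" borel] by simp
    qed
    define g where "g = (\<lambda>j y. if j = s then f s y * h y else f j y)"
    have gm: "g j \<in> borel_measurable borel" for j unfolding g_def using fm hm by simp
    have red: "(\<integral>\<^sup>+w. (\<Prod>j\<in>insert b A. f j (w j)) \<partial>L) = (\<integral>\<^sup>+w. (\<Prod>j\<in>A. g j (w j)) \<partial>L)"
      if L: "wiener_law x L" for L
    proof -
      let ?F = "\<lambda>(w, u). (\<Prod>j\<in>A. f j (w j)) * f b (w s + u)"
      have cm: "(\<lambda>z. f j (fst z j)) \<in> borel_measurable (path_filt s \<Otimes>\<^sub>M borel)" if "j \<in> A" for j
        by (rule measurable_compose[OF measurable_compose[OF measurable_fst coord_measurable_filt] fm])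
          (use As that in auto)
      have "(\<lambda>z. fst z s + snd z) \<in> borel_measurable (path_filt s \<Otimes>\<^sub>M borel)"
        by (rule borel_measurable_add[OF measurable_compose[OF measurable_fst coord_measurable_filt]])
          (use sb in auto)
      then have bm: "(\<lambda>z. f b (fst z s + snd z)) \<in> borel_measurable (path_filt s \<Otimes>\<^sub>M borel)"
        by (rule measurable_compose[OF _ fm])
      have F: "?F \<in> borel_measurable (path_filt s \<Otimes>\<^sub>M borel)"
        unfolding split_beta' by (intro borel_measurable_times_ennreal borel_measurable_prod_ennreal cm bm)
      have "(\<integral>\<^sup>+w. (\<Prod>j\<in>insert b A. f j (w j)) \<partial>L) = (\<integral>\<^sup>+w. ?F (w, w b - w s) \<partial>L)"
        using insert.hyps bA by (simp add: mult.commute)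
      also have "\<dots> = (\<integral>\<^sup>+w. \<integral>\<^sup>+u. ?F (w, u) \<partial>gauss (b - s) \<partial>L)"
        by (rule wiener_nn_integral_incr[OF L sb F])
      also have "\<dots> = (\<integral>\<^sup>+w. (\<Prod>j\<in>A. f j (w j)) * h (w s) \<partial>L)"
      proof -
        have "(\<lambda>u. f b (c + u)) \<in> borel_measurable (gauss (b - s))" for c
          by (rule measurable_compose[OF _ fm]) simp
        then show ?thesis by (simp add: nn_integral_cmult h_def)
      qed
      also have "\<dots> = (\<integral>\<^sup>+w. (\<Prod>j\<in>A. g j (w j)) \<partial>L)"
      proof -
        have "(\<Prod>j\<in>A. g j (w j)) = (\<Prod>j\<in>A. f j (w j)) * h (w s)" for w
        proof -
          have "(\<Prod>j\<in>A. g j (w j)) = g s (w s) * (\<Prod>j\<in>A - {s}. g j (w j))"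
            using insert.hyps sA by (simp add: prod.remove)
          also have "(\<Prod>j\<in>A - {s}. g j (w j)) = (\<Prod>j\<in>A - {s}. f j (w j))"
            by (rule prod.cong) (auto simp: g_def)
          also have "g s (w s) * \<dots> = (f s (w s) * (\<Prod>j\<in>A - {s}. f j (w j))) * h (w s)"
            by (simp add: g_def mult_ac)
          also have "f s (w s) * (\<Prod>j\<in>A - {s}. f j (w j)) = (\<Prod>j\<in>A. f j (w j))"
            using insert.hyps sA by (simp add: prod.remove)
          finally show ?thesis .
        qed
        then show ?thesis by simp
      qed
      finally show ?thesis .
    qed
    show ?thesis unfolding red[OF P] red[OF Q] using insert.IH[of g] gm A0 insert.prems by auto
  qed
qed

text \<open>The distinguished time is taken to be 0, so that every index set contains 0, the base of
  the induction in \<open>wiener_fdd_unique\<close>.\<close>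

theorem wiener_law_unique:
  assumes P: "wiener_law x P" and Q: "wiener_law x Q"
  shows "P = Q"
proof (rule coord_algebra_eqI[where I="{0..}" and t=0])
  show "sets P = sets (coord_algebra {0..})" "sets Q = sets (coord_algebra {0..})"
    using wiener_sets[OF P] wiener_sets[OF Q] by (simp_all add: path_sigma_def)
  show "finite_measure P" using wiener_prob[OF P] by (rule prob_space.finite_measure)
  fix J :: "real set" and f :: "real \<Rightarrow> real \<Rightarrow> real"
  assume J: "finite J" "J \<subseteq> {0..}" "0 \<in> J" and f: "\<And>j. continuous_on UNIV (f j)" "\<And>j u. f j u \<in> {0..1}"
  have "(\<integral>\<^sup>+w. (\<Prod>j\<in>J. ennreal (f j (w j))) \<partial>P) = (\<integral>\<^sup>+w. (\<Prod>j\<in>J. ennreal (f j (w j))) \<partial>Q)"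
    using borel_measurable_continuous_onI[OF f(1)] by (intro wiener_fdd_unique[OF P Q J(1-3)]) auto
  then show "(\<integral>\<^sup>+w. ennreal (\<Prod>j\<in>J. f j (w j)) \<partial>P) = (\<integral>\<^sup>+w. ennreal (\<Prod>j\<in>J. f j (w j)) \<partial>Q)"
    using f(2) by (simp add: prod_ennreal)
qed simp

text \<open>Centred Gaussians are symmetric, so the negated path satisfies the same characterisation
  and uniqueness identifies its law. The reflection principle rests on this symmetry.\<close>

lemma wiener_law_uminus:
  assumes W: "wiener_law 0 W" shows "distr W path_sigma (sub_path 0) = W"
proof (rule wiener_law_unique[OF wiener_lawI W])
  have m: "sub_path 0 \<in> measurable W path_sigma"
    using sub_path_measurable by (simp add: wiener_measurable[OF W])
  interpret prob_space W using wiener_prob[OF W] .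
  show "prob_space (distr W path_sigma (sub_path 0))" by (rule prob_space_distr[OF m])
  show "sets (distr W path_sigma (sub_path 0)) = sets path_sigma" by simp
  have "{w \<in> space path_sigma. w 0 = 0} \<in> sets path_sigma"
    using measurable_sets[OF coord_measurable_path_sigma[of 0], of "{0}"]
    by (simp add: vimage_def Int_def conj_commute)
  then show "AE w in distr W path_sigma (sub_path 0). w 0 = 0"
    using wiener_start[OF W] by (subst AE_distr_iff[OF m]) (auto simp: sub_path_def)
  fix s t :: real and A B assume st: "0 \<le> s" "s < t" and A: "A \<in> sets (path_filt s)" and B: "B \<in> sets (borel :: real measure)"
  let ?A = "sub_path 0 -` A \<inter> paths"
  have A': "?A \<in> sets (path_filt s)"
    using measurable_sets[OF sub_path_measurable_filt[of 0 s] A] by simp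
  have B': "{u. - u \<in> B} \<in> sets borel"
    using measurable_sets[OF borel_measurable_uminus[OF measurable_ident] B] by (simp add: vimage_def)
  have "sub_path 0 -` (A \<inter> {w \<in> paths. w t - w s \<in> B}) \<inter> space W
      = ?A \<inter> {w \<in> paths. w t - w s \<in> {u. - u \<in> B}}"
    using st sub_path_in_paths[of _ 0] by (auto simp: sub_path_def wiener_space[OF W])
  moreover have "A \<inter> {w \<in> paths. w t - w s \<in> B} \<in> sets path_sigma"
    using A sets_path_filt_le wiener_incr_set[of s t B] st B by auto
  ultimately have "emeasure (distr W path_sigma (sub_path 0)) (A \<inter> {w \<in> paths. w t - w s \<in> B})
      = emeasure W ?A * emeasure (gauss (t - s)) {u. - u \<in> B}"
    using wiener_indep[OF W st A' B'] by (simp add: emeasure_distr[OF m])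
  also have "emeasure W ?A = emeasure (distr W path_sigma (sub_path 0)) A"
    using A sets_path_filt_le by (subst emeasure_distr[OF m]) (auto simp: wiener_space[OF W])
  finally show "emeasure (distr W path_sigma (sub_path 0)) (A \<inter> {w \<in> paths. w t - w s \<in> B})
      = emeasure (distr W path_sigma (sub_path 0)) A * emeasure (gauss (t - s)) B"
    by (simp add: emeasure_gauss_uminus[OF B])
qed

text \<open>Given an event of positive probability that is determined by the path up to time \<open>s\<close>, the
  shifted path satisfies the characterisation of Wiener measure, hence has its law.\<close>

theorem weak_markov:
  assumes P: "wiener_law x P" and W: "wiener_law 0 W" and s: "0 \<le> s"
  shows "distr P path_sigma (stop_path s) \<Otimes>\<^sub>M W =
    distr P (path_sigma \<Otimes>\<^sub>M path_sigma) (\<lambda>w. (stop_path s w, shift_path s w))"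
proof -
  interpret prob_space P using wiener_prob[OF P] .
  interpret W: prob_space W using wiener_prob[OF W] .
  have m1: "stop_path s \<in> measurable P path_sigma"
    using stop_path_measurable'[OF s] by (simp add: wiener_measurable[OF P])
  have m2: "shift_path s \<in> measurable P path_sigma"
    using shift_path_measurable[OF s] by (simp add: wiener_measurable[OF P])
  interpret S: prob_space "distr P path_sigma (stop_path s)" by (rule prob_space_distr[OF m1])
  have key: "emeasure P (G \<inter> (shift_path s -` B \<inter> paths)) = emeasure P G * emeasure W B"
    if G: "G \<in> sets (path_filt s)" and B: "B \<in> sets path_sigma" for G B
  proof (cases "emeasure P G = 0")
    case True
    have "G \<in> null_sets P" using True wiener_path_filt[OF P G] by auto
    then have "G \<inter> (shift_path s -` B \<inter> paths) \<in> null_sets P"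
      using measurable_sets[OF m2 B] wiener_space[OF P] by (auto intro: null_set_Int2)
    then show ?thesis using True by auto
  next
    case False
    have GP: "G \<in> sets P" by (rule wiener_path_filt[OF P G])
    define U where "U = uniform_measure P G"
    interpret U: prob_space U unfolding U_def
      by (rule prob_space_uniform_measure) (use False in auto)
    have setsU: "sets U = sets P" unfolding U_def by simp
    have m3: "shift_path s \<in> measurable U path_sigma"
      using m2 measurable_cong_sets[OF setsU refl] by auto
    have "wiener_law 0 (distr U path_sigma (shift_path s))"
    proof (rule wiener_lawI)
      show "prob_space (distr U path_sigma (shift_path s))" by (rule U.prob_space_distr[OF m3])
      show "sets (distr U path_sigma (shift_path s)) = sets path_sigma" by simp
      have "{w \<in> space path_sigma. w 0 = 0} \<in> sets path_sigma"
        using measurable_sets[OF coord_measurable_path_sigma[of 0], of "{0}"]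
        by (simp add: vimage_def Int_def conj_commute)
      then show "AE w in distr U path_sigma (shift_path s). w 0 = 0"
        by (subst AE_distr_iff[OF m3]) (auto simp: shift_path_def)
      fix a t :: real and A C assume at: "0 \<le> a" "a < t" and A: "A \<in> sets (path_filt a)"
        and C: "C \<in> sets (borel :: real measure)"
      let ?A = "shift_path s -` A \<inter> paths"
      have A': "?A \<in> sets (path_filt (s + a))"
        using measurable_sets[OF shift_path_measurable_filt[OF s] A] by simp
      have GA: "G \<inter> ?A \<in> sets (path_filt (s + a))"
        using A' G sets_path_filt_mono[of s "s + a"] at by auto
      have AC: "A \<inter> {w \<in> paths. w t - w a \<in> C} \<in> sets path_sigma"
        using A sets_path_filt_le wiener_incr_set[of a t C] at C by auto
      have A2: "A \<in> sets path_sigma" using A sets_path_filt_le by auto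
      have vim: "shift_path s -` (A \<inter> {w \<in> paths. w t - w a \<in> C}) \<inter> space U
          = ?A \<inter> {w \<in> paths. w (s + t) - w (s + a) \<in> C}"
        using at shift_path_in_paths[OF s] wiener_space[OF P] sets_eq_imp_space_eq[OF setsU]
        by (auto simp: shift_path_def)
      have "emeasure (distr U path_sigma (shift_path s)) (A \<inter> {w \<in> paths. w t - w a \<in> C})
          = emeasure U (?A \<inter> {w \<in> paths. w (s + t) - w (s + a) \<in> C})"
        by (simp only: emeasure_distr[OF m3 AC] vim)
      also have "\<dots> = emeasure P (G \<inter> (?A \<inter> {w \<in> paths. w (s + t) - w (s + a) \<in> C})) / emeasure P G"
        unfolding U_def
        by (rule emeasure_uniform_measure[OF GP])
          (use measurable_sets[OF m3 AC] vim setsU in auto)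
      also have "G \<inter> (?A \<inter> {w \<in> paths. w (s + t) - w (s + a) \<in> C})
          = (G \<inter> ?A) \<inter> {w \<in> paths. w (s + t) - w (s + a) \<in> C}" by auto
      also have "emeasure P \<dots> = emeasure P (G \<inter> ?A) * emeasure (gauss (t - a)) C"
        using wiener_indep[OF P _ _ GA C, of "s + t"] s at by simp
      also have "emeasure P (G \<inter> ?A) * emeasure (gauss (t - a)) C / emeasure P G
          = (emeasure P (G \<inter> ?A) / emeasure P G) * emeasure (gauss (t - a)) C"
        by (simp add: divide_ennreal_def mult_ac)
      also have "emeasure P (G \<inter> ?A) / emeasure P G = emeasure U ?A"
        unfolding U_def
        by (rule emeasure_uniform_measure[OF GP, symmetric])
          (rule wiener_path_filt[OF P A'])
      also have "emeasure U ?A = emeasure (distr U path_sigma (shift_path s)) A"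
        using sets_eq_imp_space_eq[OF setsU] wiener_space[OF P] by (simp add: emeasure_distr[OF m3 A2])
      finally show "emeasure (distr U path_sigma (shift_path s)) (A \<inter> {w \<in> paths. w t - w a \<in> C})
          = emeasure (distr U path_sigma (shift_path s)) A * emeasure (gauss (t - a)) C" .
    qed
    then have "distr U path_sigma (shift_path s) = W" by (rule wiener_law_unique[OF _ W])
    then have "emeasure W B = emeasure U (shift_path s -` B \<inter> paths)"
      using emeasure_distr[OF m3 B] sets_eq_imp_space_eq[OF setsU] wiener_space[OF P] by simp
    also have "\<dots> = emeasure P (G \<inter> (shift_path s -` B \<inter> paths)) / emeasure P G"
      unfolding U_def
      by (rule emeasure_uniform_measure[OF GP]) (use measurable_sets[OF m2 B] wiener_space[OF P] in auto)
    finally show ?thesis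
      using False by (simp add: ennreal_times_divide mult.commute[of "emeasure P G"] ennreal_mult_divide_eq)
  qed
  show ?thesis
  proof (rule pair_measure_eqI)
    show "sigma_finite_measure (distr P path_sigma (stop_path s))" ..
    show "sigma_finite_measure W" ..
    show "sets (distr P path_sigma (stop_path s) \<Otimes>\<^sub>M W) =
        sets (distr P (path_sigma \<Otimes>\<^sub>M path_sigma) (\<lambda>w. (stop_path s w, shift_path s w)))"
      using wiener_sets[OF W] by (simp cong: sets_pair_measure_cong)
    fix A B assume A: "A \<in> sets (distr P path_sigma (stop_path s))" and B: "B \<in> sets W"
    have A': "A \<in> sets path_sigma" and B': "B \<in> sets path_sigma" using A B wiener_sets[OF W] by auto
    \<comment> \<open>An event of the stopped path is an event of the past, as \<open>key\<close>
      requires.\<close>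
    have G: "stop_path s -` A \<inter> paths \<in> sets (path_filt s)"
      using measurable_sets[OF stop_path_measurable[OF s] A'] by simp
    have "(\<lambda>w. (stop_path s w, shift_path s w)) -` (A \<times> B) \<inter> space P
        = (stop_path s -` A \<inter> paths) \<inter> (shift_path s -` B \<inter> paths)"
      using wiener_space[OF P] by auto
    then show "emeasure (distr P path_sigma (stop_path s)) A * emeasure W B =
        emeasure (distr P (path_sigma \<Otimes>\<^sub>M path_sigma) (\<lambda>w. (stop_path s w, shift_path s w))) (A \<times> B)"
      unfolding emeasure_distr[OF m1 A'] emeasure_distr[OF measurable_Pair[OF m1 m2] pair_measureI[OF A' B']]
      using key[OF G B'] by (simp only: wiener_space[OF P])
  qed
qed

lemma weak_markov_nn_integral:
  assumes P: "wiener_law x P" and W: "wiener_law 0 W" and s: "0 \<le> s"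
    and F: "F \<in> borel_measurable (path_sigma \<Otimes>\<^sub>M path_sigma)"
  shows "(\<integral>\<^sup>+w. F (stop_path s w, shift_path s w) \<partial>P) = (\<integral>\<^sup>+w. \<integral>\<^sup>+v. F (stop_path s w, v) \<partial>W \<partial>P)"
proof -
  interpret W: prob_space W using wiener_prob[OF W] .
  have m1: "stop_path s \<in> measurable P path_sigma"
    using stop_path_measurable'[OF s] by (simp add: wiener_measurable[OF P])
  have m2: "shift_path s \<in> measurable P path_sigma"
    using shift_path_measurable[OF s] by (simp add: wiener_measurable[OF P])
  have F': "F \<in> borel_measurable (path_sigma \<Otimes>\<^sub>M W)"
    using F wiener_sets[OF W] by (simp cong: measurable_cong_sets sets_pair_measure_cong)
  then have F'': "F \<in> borel_measurable (distr P path_sigma (stop_path s) \<Otimes>\<^sub>M W)"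
    by (simp cong: measurable_cong_sets sets_pair_measure_cong)
  have "(\<integral>\<^sup>+w. F (stop_path s w, shift_path s w) \<partial>P)
      = (\<integral>\<^sup>+z. F z \<partial>distr P (path_sigma \<Otimes>\<^sub>M path_sigma) (\<lambda>w. (stop_path s w, shift_path s w)))"
    by (subst nn_integral_distr[OF measurable_Pair[OF m1 m2]]) (use F in simp_all)
  also have "\<dots> = (\<integral>\<^sup>+w. \<integral>\<^sup>+v. F (w, v) \<partial>W \<partial>distr P path_sigma (stop_path s))"
    unfolding weak_markov[OF P W s, symmetric] by (rule W.nn_integral_fst[OF F'', symmetric])
  also have "\<dots> = (\<integral>\<^sup>+w. \<integral>\<^sup>+v. F (stop_path s w, v) \<partial>W \<partial>P)"
    using W.borel_measurable_nn_integral_fst[OF F'] by (subst nn_integral_distr[OF m1]) simp_all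
  finally show ?thesis .
qed

section \<open>Gaussian transforms and separation by moments\<close>

text \<open>Completing the square: the tilted law is Gaussian with its variance multiplied by q, and
  its mean is such that y plus the mean equals q y.\<close>

lemma normal_density_times_exp:
  fixes l d y u :: real
  assumes d: "0 < d" and l: "0 \<le> l"
  defines "q \<equiv> 1 / (1 + 2 * l * d)"
  shows "normal_density 0 (sqrt d) u * exp (- l * (y + u)\<^sup>2) =
    sqrt q * exp (- (l * q) * y\<^sup>2) * normal_density (- 2 * l * d * q * y) (sqrt (d * q)) u"
proof -
  have D: "0 < 1 + 2 * l * d" using d l by (simp add: add_pos_nonneg)
  have q: "0 < q" and qD: "q * (1 + 2 * l * d) = 1" using D by (simp_all add: q_def)
  have e: "- u\<^sup>2 / (2 * d) - l * (y + u)\<^sup>2 = - (l * q) * y\<^sup>2 - (u - (- 2 * l * d * q * y))\<^sup>2 / (2 * (d * q))"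
    using d D unfolding q_def by (simp add: divide_simps) (simp add: power2_eq_square algebra_simps)
  have s: "1 / sqrt (2 * pi * d) = sqrt q * (1 / sqrt (2 * pi * (d * q)))"
    using d q by (simp add: real_sqrt_mult)
  have "normal_density 0 (sqrt d) u * exp (- l * (y + u)\<^sup>2)
      = 1 / sqrt (2 * pi * d) * exp (- u\<^sup>2 / (2 * d) - l * (y + u)\<^sup>2)"
    using d by (simp add: normal_density_def exp_add[symmetric] mult.assoc)
  also have "\<dots> = sqrt q * (1 / sqrt (2 * pi * (d * q))) *
      exp (- (l * q) * y\<^sup>2 - (u - (- 2 * l * d * q * y))\<^sup>2 / (2 * (d * q)))"
    unfolding e s ..
  also have "exp (- (l * q) * y\<^sup>2 - (u - (- 2 * l * d * q * y))\<^sup>2 / (2 * (d * q)))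
      = exp (- (l * q) * y\<^sup>2) * exp (- ((u - (- 2 * l * d * q * y))\<^sup>2 / (2 * (d * q))))"
    by (simp only: diff_conv_add_uminus exp_add)
  also have "sqrt q * (1 / sqrt (2 * pi * (d * q))) *
      (exp (- (l * q) * y\<^sup>2) * exp (- ((u - (- 2 * l * d * q * y))\<^sup>2 / (2 * (d * q)))))
    = sqrt q * exp (- (l * q) * y\<^sup>2) * normal_density (- 2 * l * d * q * y) (sqrt (d * q)) u"
    using d q by (simp add: normal_density_def)
  finally show ?thesis .
qed

lemma integral_gauss:
  assumes "f \<in> borel_measurable borel"
  shows "(\<integral>u. f u \<partial>gauss d) = (\<integral>u. normal_density 0 (sqrt d) u * (f u :: real) \<partial>lborel)"
  unfolding gauss_def using assms by (subst integral_density) auto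

text \<open>Tilting alone costs the factor sqrt q. The mean of y + u under the tilted law is q y, so
  inserting y + u costs another q, the square of sqrt q; this is the origin of the cube.\<close>

lemma integral_gauss_exp:
  fixes l d y :: real
  assumes d: "0 < d" and l: "0 \<le> l"
  defines "q \<equiv> 1 / (1 + 2 * l * d)"
  shows "(\<integral>u. exp (- l * (y + u)\<^sup>2) \<partial>gauss d) = sqrt q * exp (- (l * q) * y\<^sup>2)" (is ?A)
    and "(\<integral>u. exp (- l * (y + u)\<^sup>2) * (y + u) \<partial>gauss d) = sqrt q ^ 3 * (y * exp (- (l * q) * y\<^sup>2))" (is ?B)
proof -
  have D: "0 < 1 + 2 * l * d" using d l by (simp add: add_pos_nonneg)
  have q: "0 < q" and qD: "q * (1 + 2 * l * d) = 1" using D by (simp_all add: q_def)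
  let ?m = "- 2 * l * d * q * y" and ?s = "sqrt (d * q)"
  have s: "0 < ?s" using d q by simp
  note nd = normal_density_times_exp[OF d l, folded q_def]
  have i1: "has_bochner_integral lborel (normal_density ?m ?s) 1"
    using s integrable_normal_density[OF s, of ?m] integral_normal_density[OF s, of ?m]
    by (simp add: has_bochner_integral_iff)
  have i2: "has_bochner_integral lborel (\<lambda>u. normal_density ?m ?s u * (u - ?m)) 0"
    using normal_moment_odd[OF s, of ?m 0] by simp
  show ?A
    by (subst integral_gauss, measurable, subst nd, subst integral_mult_right_zero)
      (use i1 in \<open>simp add: has_bochner_integral_iff\<close>)
  have ym: "y + ?m = q * y"
  proof -
    have "q * y = q * (1 + 2 * l * d) * y - 2 * l * d * q * y" by (simp add: algebra_simps)
    then show ?thesis using qD by simp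
  qed
  \<comment> \<open>The centred first moment vanishes, so only the constant part y + ?m
    survives.\<close>
  have "has_bochner_integral lborel (\<lambda>u. normal_density ?m ?s u * (u - ?m) + normal_density ?m ?s u * (y + ?m))
     (0 + 1 * (y + ?m))"
    by (intro has_bochner_integral_add has_bochner_integral_mult_left i1 i2)
  also have "(\<lambda>u. normal_density ?m ?s u * (u - ?m) + normal_density ?m ?s u * (y + ?m))
    = (\<lambda>u. normal_density ?m ?s u * (y + u))" by (simp add: fun_eq_iff algebra_simps)
  finally have i3: "(\<integral>u. normal_density ?m ?s u * (y + u) \<partial>lborel) = q * y"
    unfolding ym by (simp add: has_bochner_integral_iff)
  have "(\<integral>u. exp (- l * (y + u)\<^sup>2) * (y + u) \<partial>gauss d)
      = (\<integral>u. (normal_density 0 (sqrt d) u * exp (- l * (y + u)\<^sup>2)) * (y + u) \<partial>lborel)"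
    by (subst integral_gauss) (simp_all add: mult.assoc)
  also have "\<dots> = (\<integral>u. (sqrt q * exp (- (l * q) * y\<^sup>2)) * (normal_density ?m ?s u * (y + u)) \<partial>lborel)"
    unfolding nd by (simp only: mult.assoc)
  also have "\<dots> = sqrt q * exp (- (l * q) * y\<^sup>2) * (q * y)"
    unfolding integral_mult_right_zero i3 ..
  also have "\<dots> = sqrt q ^ 3 * (y * exp (- (l * q) * y\<^sup>2))"
    using q by (simp add: power3_eq_cube)
  finally show ?B .
qed

text \<open>Boundedness admits the endpoint-weighted integrands to Fubini and to dominated
  convergence. The constant comes from 1 + z^2 <= (1 + 1/l) (1 + l z^2) and 1 + s <= exp s.\<close>

lemma abs_times_exp_le:
  fixes z l :: real
  assumes "0 < l" shows "\<bar>exp (- l * z\<^sup>2) * z\<bar> \<le> 1 + 1 / l"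
proof -
  have "\<bar>z\<bar> \<le> 1 + z\<^sup>2"
    using sum_squares_bound[of "\<bar>z\<bar>" 1] by simp
  also have "\<dots> \<le> (1 + 1 / l) * (1 + l * z\<^sup>2)" using assms by (simp add: field_simps)
  also have "\<dots> \<le> (1 + 1 / l) * exp (l * z\<^sup>2)"
    using assms exp_ge_add_one_self[of "l * z\<^sup>2"] by (intro mult_left_mono) auto
  finally have "\<bar>z\<bar> * exp (- l * z\<^sup>2) \<le> (1 + 1 / l) * exp (l * z\<^sup>2) * exp (- l * z\<^sup>2)"
    by (intro mult_right_mono) auto
  also have "\<dots> = 1 + 1 / l" by (simp add: mult.assoc exp_add[symmetric])
  finally show ?thesis by (simp add: abs_mult mult.commute)
qed

text \<open>Gaussian transforms of exponentials of squares are again such exponentials, and inserting the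
  final position turns the constant \<open>c\<close> into \<open>c\<^sup>3\<close>: this is how the three-dimensional norm is
  matched with the one-dimensional motion weighted by its endpoint.\<close>

lemma wiener_exp_chain:
  assumes W: "wiener_law 0 W" and J: "finite J"
  shows "J \<subseteq> {0..} \<Longrightarrow> 0 \<in> J \<Longrightarrow> (\<And>j. 0 \<le> l j) \<Longrightarrow> 0 < l (Max J) \<Longrightarrow>
    \<exists>c L. \<forall>y. (\<integral>w. (\<Prod>j\<in>J. exp (- l j * (y + w j)\<^sup>2)) \<partial>W) = c * exp (- L * y\<^sup>2) \<and>
      (\<integral>w. (\<Prod>j\<in>J. exp (- l j * (y + w j)\<^sup>2)) * (y + w (Max J)) \<partial>W) = c ^ 3 * (y * exp (- L * y\<^sup>2))"
  using J
proof (induction J arbitrary: l rule: finite_linorder_max_induct)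
  case empty then show ?case by simp
next
  case (insert b A)
  interpret prob_space W using wiener_prob[OF W] .
  have bA: "b \<notin> A" using insert.hyps by auto
  have Mb: "Max (insert b A) = b" using insert.hyps by (intro Max_eqI) auto
  show ?case
  proof (cases "A = {}")
    case True
    then have b: "b = 0" using insert.prems by auto
    have c0: "(\<lambda>w. w 0) \<in> borel_measurable W"
      using coord_measurable_path_sigma[of 0] by (simp add: wiener_measurable[OF W])
    have "(\<integral>w. exp (- l 0 * (y + w 0)\<^sup>2) \<partial>W) = exp (- l 0 * y\<^sup>2)" for y
    proof -
      have "(\<integral>w. exp (- l 0 * (y + w 0)\<^sup>2) \<partial>W) = (\<integral>w. exp (- l 0 * y\<^sup>2) \<partial>W)"
      proof (rule integral_cong_AE)
        show "AE w in W. exp (- l 0 * (y + w 0)\<^sup>2) = exp (- l 0 * y\<^sup>2)" using wiener_start[OF W] by eventually_elim simp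
      qed (use c0 in simp_all)
      then show ?thesis using prob_space by simp
    qed
    moreover have "(\<integral>w. exp (- l 0 * (y + w 0)\<^sup>2) * (y + w 0) \<partial>W) = y * exp (- l 0 * y\<^sup>2)" for y
    proof -
      have "(\<integral>w. exp (- l 0 * (y + w 0)\<^sup>2) * (y + w 0) \<partial>W) = (\<integral>w. exp (- l 0 * y\<^sup>2) * y \<partial>W)"
      proof (rule integral_cong_AE)
        show "AE w in W. exp (- l 0 * (y + w 0)\<^sup>2) * (y + w 0) = exp (- l 0 * y\<^sup>2) * y" using wiener_start[OF W] by eventually_elim simp
      qed (use c0 in simp_all)
      then show ?thesis using prob_space by (simp add: mult.commute)
    qed
    ultimately show ?thesis using True b Mb by (intro exI[of _ 1] exI[of _ "l 0"]) simp
  next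
    case False
    have A0: "0 \<in> A"
    proof (rule ccontr)
      assume "0 \<notin> A"
      then have "b = 0" using insert.prems by auto
      then show False using False insert.hyps insert.prems by fastforce
    qed
    define s where "s = Max A"
    have sA: "s \<in> A" unfolding s_def using insert.hyps False by simp
    have As: "a \<le> s" "0 \<le> a" if "a \<in> A" for a
      using that insert.hyps insert.prems unfolding s_def by auto
    have sb: "0 \<le> s" "s < b" using sA As insert.hyps by auto
    have d: "0 < b - s" using sb by simp
    have lb: "0 \<le> l b" "0 < l b" using insert.prems Mb by auto
    define q where "q = 1 / (1 + 2 * l b * (b - s))"
    have q: "0 < q" using d lb by (simp add: q_def add_pos_nonneg)
    \<comment> \<open>Integrating out the position at b leaves a weight \<open>l b * q\<close> at s,
      which is added to the one already there. The weight at the last time therefore stays positive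
      even if \<open>l s = 0\<close>, and the integrand with the endpoint stays bounded throughout
      the induction.\<close>
    define k where "k = l(s := l s + l b * q)"
    have k: "0 \<le> k j" "0 < k (Max A)" for j
    proof -
      have "0 < l b * q" using lb(2) q by simp
      then show "0 \<le> k j" "0 < k (Max A)"
        using insert.prems(3)[of j] insert.prems(3)[of s] by (auto simp: k_def s_def)
    qed
    have prodk: "(\<Prod>j\<in>A. exp (- l j * (y + w j)\<^sup>2)) * exp (- (l b * q) * (y + w s)\<^sup>2)
        = (\<Prod>j\<in>A. exp (- k j * (y + w j)\<^sup>2))" for y and w :: "real \<Rightarrow> real"
    proof -
      have "(\<Prod>j\<in>A. exp (- k j * (y + w j)\<^sup>2)) = exp (- k s * (y + w s)\<^sup>2) * (\<Prod>j\<in>A - {s}. exp (- k j * (y + w j)\<^sup>2))"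
        using insert.hyps sA by (simp add: prod.remove)
      also have "(\<Prod>j\<in>A - {s}. exp (- k j * (y + w j)\<^sup>2)) = (\<Prod>j\<in>A - {s}. exp (- l j * (y + w j)\<^sup>2))"
        by (rule prod.cong) (auto simp: k_def)
      also have "exp (- k s * (y + w s)\<^sup>2) = exp (- l s * (y + w s)\<^sup>2) * exp (- (l b * q) * (y + w s)\<^sup>2)"
        by (simp add: k_def exp_add[symmetric] algebra_simps)
      finally show ?thesis using insert.hyps sA by (simp add: prod.remove mult_ac)
    qed
    have cm: "(\<lambda>z. fst z j) \<in> borel_measurable (path_filt s \<Otimes>\<^sub>M borel)" if "j \<in> A" for j
      by (rule measurable_compose[OF measurable_fst coord_measurable_filt]) (use As that in auto)
    have P1: "\<bar>\<Prod>j\<in>A. exp (- l j * (y + w j)\<^sup>2)\<bar> \<le> 1" for y and w :: "real \<Rightarrow> real"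
      using insert.prems(3) by (auto simp: abs_prod intro!: prod_le_1)
    have r1: "(\<integral>w. (\<Prod>j\<in>insert b A. exp (- l j * (y + w j)\<^sup>2)) \<partial>W)
        = sqrt q * (\<integral>w. (\<Prod>j\<in>A. exp (- k j * (y + w j)\<^sup>2)) \<partial>W)" for y
    proof -
      let ?F = "\<lambda>z. (\<Prod>j\<in>A. exp (- l j * (y + fst z j)\<^sup>2)) * exp (- l b * ((y + fst z s) + snd z)\<^sup>2)"
      have "(\<integral>w. (\<Prod>j\<in>insert b A. exp (- l j * (y + w j)\<^sup>2)) \<partial>W) = (\<integral>w. ?F (w, w b - w s) \<partial>W)"
        using insert.hyps bA by (simp add: mult.commute)
      also have "\<dots> = (\<integral>w. \<integral>u. ?F (w, u) \<partial>gauss (b - s) \<partial>W)"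
      proof (rule wiener_integral_incr[OF W sb, where K=1])
        show "?F \<in> borel_measurable (path_filt s \<Otimes>\<^sub>M borel)"
          using cm cm[OF sA] by measurable
        show "\<bar>?F z\<bar> \<le> 1" for z
          unfolding abs_mult using lb(1) by (intro mult_le_one P1) auto
      qed
      also have "\<dots> = (\<integral>w. sqrt q * ((\<Prod>j\<in>A. exp (- l j * (y + w j)\<^sup>2)) * exp (- (l b * q) * (y + w s)\<^sup>2)) \<partial>W)"
      proof (rule Bochner_Integration.integral_cong[OF refl])
        fix w :: "real \<Rightarrow> real"
        have "(\<integral>u. ?F (w, u) \<partial>gauss (b - s)) = (\<Prod>j\<in>A. exp (- l j * (y + w j)\<^sup>2)) * (\<integral>u. exp (- l b * ((y + w s) + u)\<^sup>2) \<partial>gauss (b - s))"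
          by simp
        then show "(\<integral>u. ?F (w, u) \<partial>gauss (b - s)) = sqrt q * ((\<Prod>j\<in>A. exp (- l j * (y + w j)\<^sup>2)) * exp (- (l b * q) * (y + w s)\<^sup>2))"
          unfolding integral_gauss_exp(1)[OF d lb(1), folded q_def] by (simp only: mult_ac)
      qed
      finally show ?thesis unfolding prodk by simp
    qed
    have r2: "(\<integral>w. (\<Prod>j\<in>insert b A. exp (- l j * (y + w j)\<^sup>2)) * (y + w b) \<partial>W)
        = sqrt q ^ 3 * (\<integral>w. (\<Prod>j\<in>A. exp (- k j * (y + w j)\<^sup>2)) * (y + w s) \<partial>W)" for y
    proof -
      let ?F = "\<lambda>z. (\<Prod>j\<in>A. exp (- l j * (y + fst z j)\<^sup>2)) *
          (exp (- l b * ((y + fst z s) + snd z)\<^sup>2) * ((y + fst z s) + snd z))"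
      have "(\<integral>w. (\<Prod>j\<in>insert b A. exp (- l j * (y + w j)\<^sup>2)) * (y + w b) \<partial>W) = (\<integral>w. ?F (w, w b - w s) \<partial>W)"
        using insert.hyps bA by (simp add: mult_ac)
      also have "\<dots> = (\<integral>w. \<integral>u. ?F (w, u) \<partial>gauss (b - s) \<partial>W)"
      proof (rule wiener_integral_incr[OF W sb, where K="1 * (1 + 1 / l b)"])
        show "?F \<in> borel_measurable (path_filt s \<Otimes>\<^sub>M borel)"
          using cm cm[OF sA] by measurable
        show "\<bar>?F z\<bar> \<le> 1 * (1 + 1 / l b)" for z
          unfolding abs_mult[of "prod _ _"] by (intro mult_mono P1 abs_times_exp_le lb) auto
      qed
      also have "\<dots> = (\<integral>w. sqrt q ^ 3 * (((\<Prod>j\<in>A. exp (- l j * (y + w j)\<^sup>2)) * exp (- (l b * q) * (y + w s)\<^sup>2)) * (y + w s)) \<partial>W)"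
      proof (rule Bochner_Integration.integral_cong[OF refl])
        fix w :: "real \<Rightarrow> real"
        have "(\<integral>u. ?F (w, u) \<partial>gauss (b - s)) = (\<Prod>j\<in>A. exp (- l j * (y + w j)\<^sup>2)) * (\<integral>u. (exp (- l b * ((y + w s) + u)\<^sup>2) * ((y + w s) + u)) \<partial>gauss (b - s))"
          by simp
        then show "(\<integral>u. ?F (w, u) \<partial>gauss (b - s)) = sqrt q ^ 3 * (((\<Prod>j\<in>A. exp (- l j * (y + w j)\<^sup>2)) * exp (- (l b * q) * (y + w s)\<^sup>2)) * (y + w s))"
          unfolding integral_gauss_exp(2)[OF d lb(1), folded q_def] by (simp only: mult_ac)
      qed
      finally show ?thesis unfolding prodk by simp
    qed
    obtain c L where cL: "\<And>y. (\<integral>w. (\<Prod>j\<in>A. exp (- k j * (y + w j)\<^sup>2)) \<partial>W) = c * exp (- L * y\<^sup>2)"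
      "\<And>y. (\<integral>w. (\<Prod>j\<in>A. exp (- k j * (y + w j)\<^sup>2)) * (y + w s) \<partial>W) = c ^ 3 * (y * exp (- L * y\<^sup>2))"
      using insert.IH[of k] k A0 insert.prems(1) unfolding s_def by auto
    \<comment> \<open>The first transform gains sqrt q and the second its cube, so the relation
      between c and c^3 persists.\<close>
    show ?thesis
      unfolding Mb r1 r2 cL
      by (intro exI[of _ "sqrt q * c"] exI[of _ L]) (simp add: power_mult_distrib mult_ac)
  qed
qed

section \<open>Separation of measures by mixed moments on the unit cube\<close>

lemma integrable_prod_bounded:
  fixes g :: "'a \<Rightarrow> real" and V :: "'j \<Rightarrow> 'a \<Rightarrow> real"
  assumes g: "integrable M g" and J: "finite J"
    and V: "\<And>j. j \<in> J \<Longrightarrow> V j \<in> borel_measurable M" "\<And>j x. j \<in> J \<Longrightarrow> V j x \<in> {0..1}"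
    and h: "\<And>j. j \<in> J \<Longrightarrow> continuous_on UNIV (h j)"
  shows "integrable M (\<lambda>x. g x * (\<Prod>j\<in>J. h j (V j x)))"
proof -
  have "\<exists>B. \<forall>v\<in>{0..1}. \<bar>h j v\<bar> \<le> B" if "j \<in> J" for j
    using compact_imp_bounded[OF compact_continuous_image[OF continuous_on_subset[OF h[OF that]] compact_Icc[of 0 1]]]
    unfolding bounded_iff by auto
  then obtain B where B: "\<And>j v. j \<in> J \<Longrightarrow> v \<in> {0..1} \<Longrightarrow> \<bar>h j v\<bar> \<le> B j" by metis
  have m: "(\<lambda>x. h j (V j x)) \<in> borel_measurable M" if "j \<in> J" for j
    by (rule measurable_compose[OF V(1)[OF that] borel_measurable_continuous_onI[OF h[OF that]]])
  show ?thesis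
  proof (rule Bochner_Integration.integrable_bound)
    show "integrable M (\<lambda>x. \<bar>g x\<bar> * (\<Prod>j\<in>J. B j))" using g by simp
    show "(\<lambda>x. g x * (\<Prod>j\<in>J. h j (V j x))) \<in> borel_measurable M"
      using m g by measurable
    have "\<bar>\<Prod>j\<in>J. h j (V j x)\<bar> \<le> (\<Prod>j\<in>J. B j)" for x
      unfolding abs_prod by (rule prod_mono) (use B V in auto)
    then have "\<bar>\<Prod>j\<in>J. h j (V j x)\<bar> \<le> \<bar>\<Prod>j\<in>J. B j\<bar>" for x
      by (rule order_trans[OF _ abs_ge_self])
    then show "AE x in M. norm (g x * (\<Prod>j\<in>J. h j (V j x))) \<le> norm (\<bar>g x\<bar> * (\<Prod>j\<in>J. B j))"
      by (intro AE_I2) (simp add: abs_mult mult_left_mono)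
  qed
qed

lemma prod_fun_upd:
  assumes J: "finite J" and aJ: "a \<in> J"
  shows "(\<Prod>j\<in>J. (h(a := f)) j (V j)) = f (V a) * (\<Prod>j\<in>J - {a}. h j (V j))"
proof -
  have "(\<Prod>j\<in>J - {a}. (h(a := f)) j (V j)) = (\<Prod>j\<in>J - {a}. h j (V j))"
    by (rule prod.cong) auto
  then show ?thesis using J aJ by (simp add: prod.remove)
qed

lemma integral_prod_polynomial:
  fixes g :: "'a \<Rightarrow> real" and V :: "'j \<Rightarrow> 'a \<Rightarrow> real"
  assumes g: "integrable M g" and J: "finite J" and aJ: "a \<in> J"
    and V: "\<And>j. j \<in> J \<Longrightarrow> V j \<in> borel_measurable M" "\<And>j x. j \<in> J \<Longrightarrow> V j x \<in> {0..1}"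
    and hc: "\<And>j. j \<in> J \<Longrightarrow> continuous_on UNIV (h j)"
  shows "(\<integral>x. g x * (\<Prod>j\<in>J. (h(a := (\<lambda>v. \<Sum>i\<le>N. c i * v ^ i))) j (V j x)) \<partial>M)
       = (\<Sum>i\<le>N. c i * (\<integral>x. g x * (\<Prod>j\<in>J. (h(a := (\<lambda>v. v ^ i))) j (V j x)) \<partial>M))"
proof -
  have int: "integrable M (\<lambda>x. g x * (\<Prod>j\<in>J. (h(a := (\<lambda>v. v ^ i))) j (V j x)))" for i
  proof (rule integrable_prod_bounded[OF g J V])
    show "continuous_on UNIV ((h(a := (\<lambda>v. v ^ i))) j)" if "j \<in> J" for j
      using hc[OF that] by (cases "j = a") (auto intro!: continuous_intros)
  qed auto
  have "(\<integral>x. g x * (\<Prod>j\<in>J. (h(a := (\<lambda>v. \<Sum>i\<le>N. c i * v ^ i))) j (V j x)) \<partial>M)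
     = (\<integral>x. (\<Sum>i\<le>N. c i * (g x * (\<Prod>j\<in>J. (h(a := (\<lambda>v. v ^ i))) j (V j x)))) \<partial>M)"
    unfolding prod_fun_upd[OF J aJ] by (simp add: sum_distrib_left sum_distrib_right mult_ac)
  then show ?thesis using int by simp
qed

text \<open>The error 1 / (n + 1) does two things: it gives pointwise convergence, and being at most
  1 it bounds every approximant by |h| + 1, which is the dominating function.\<close>

lemma tendsto_integral_prod:
  fixes g :: "'a \<Rightarrow> real" and V :: "'j \<Rightarrow> 'a \<Rightarrow> real"
  assumes g: "integrable M g" and J: "finite J" and aJ: "a \<in> J"
    and V: "\<And>j. j \<in> J \<Longrightarrow> V j \<in> borel_measurable M" "\<And>j x. j \<in> J \<Longrightarrow> V j x \<in> {0..1}"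
    and hc: "\<And>j. j \<in> J \<Longrightarrow> continuous_on UNIV (h j)"
    and pcont: "\<And>n. continuous_on UNIV (p n)"
    and p: "\<And>n v. v \<in> {0..1} \<Longrightarrow> \<bar>h a v - p n v\<bar> < 1 / real (Suc n)"
  shows "(\<lambda>n. \<integral>x. g x * (\<Prod>j\<in>J. (h(a := p n)) j (V j x)) \<partial>M) \<longlonglongrightarrow> (\<integral>x. g x * (\<Prod>j\<in>J. h j (V j x)) \<partial>M)"
proof (rule integral_dominated_convergence)
  have gi: "integrable M (\<lambda>x. g x * (\<Prod>j\<in>J. (h(a := f)) j (V j x)))" if "continuous_on UNIV f" for f
  proof (rule integrable_prod_bounded[OF g J V])
    show "continuous_on UNIV ((h(a := f)) j)" if "j \<in> J" for j
      using hc[OF that] \<open>continuous_on UNIV f\<close> by (cases "j = a") auto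
  qed auto
  show "(\<lambda>x. g x * (\<Prod>j\<in>J. h j (V j x))) \<in> borel_measurable M"
    using integrable_prod_bounded[OF g J V hc] by auto
  show "(\<lambda>x. g x * (\<Prod>j\<in>J. (h(a := p n)) j (V j x))) \<in> borel_measurable M" for n
    using gi[OF pcont[of n]] by auto
  let ?b = "\<lambda>x. \<bar>g x * (\<Prod>j\<in>J. (h(a := h a)) j (V j x))\<bar> + \<bar>g x * (\<Prod>j\<in>J. (h(a := (\<lambda>_. 1))) j (V j x))\<bar>"
  show "integrable M ?b"
    by (intro Bochner_Integration.integrable_add integrable_abs gi hc[OF aJ] continuous_intros)
  show "AE x in M. norm (g x * (\<Prod>j\<in>J. (h(a := p n)) j (V j x))) \<le> ?b x" for n
  proof (rule AE_I2)
    fix x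
    have "1 / real (Suc n) \<le> 1" by simp
    then have "\<bar>h a (V a x) - p n (V a x)\<bar> \<le> 1" using p[OF V(2)[OF aJ, of x], of n] by linarith
    then have "\<bar>p n (V a x)\<bar> \<le> \<bar>h a (V a x)\<bar> + 1" by linarith
    then have "\<bar>p n (V a x)\<bar> * (\<bar>g x\<bar> * \<bar>\<Prod>j\<in>J - {a}. h j (V j x)\<bar>)
      \<le> (\<bar>h a (V a x)\<bar> + 1) * (\<bar>g x\<bar> * \<bar>\<Prod>j\<in>J - {a}. h j (V j x)\<bar>)"
      by (intro mult_right_mono) auto
    then show "norm (g x * (\<Prod>j\<in>J. (h(a := p n)) j (V j x))) \<le> ?b x"
      unfolding prod_fun_upd[OF J aJ] by (simp add: abs_mult algebra_simps)
  qed
  show "AE x in M. (\<lambda>n. g x * (\<Prod>j\<in>J. (h(a := p n)) j (V j x))) \<longlonglongrightarrow> g x * (\<Prod>j\<in>J. h j (V j x))"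
  proof (rule AE_I2)
    fix x
    have "(\<lambda>n. p n (V a x)) \<longlonglongrightarrow> h a (V a x)"
    proof (rule LIMSEQ_I)
      fix r :: real assume "0 < r"
      then obtain n0 where n0: "1 / real (Suc n0) < r" using nat_approx_posE by blast
      have "norm (p n (V a x) - h a (V a x)) < r" if "n \<ge> n0" for n
      proof -
        have "1 / real (Suc n) \<le> 1 / real (Suc n0)" using that by (simp add: frac_le)
        then show ?thesis using p[OF V(2)[OF aJ, of x], of n] n0 by (simp add: abs_minus_commute)
      qed
      then show "\<exists>no. \<forall>n\<ge>no. norm (p n (V a x) - h a (V a x)) < r" by blast
    qed
    then have "(\<lambda>n. g x * (p n (V a x) * (\<Prod>j\<in>J - {a}. h j (V j x))))
        \<longlonglongrightarrow> g x * (h a (V a x) * (\<Prod>j\<in>J - {a}. h j (V j x)))"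
      by (intro tendsto_intros)
    moreover have "(\<Prod>j\<in>J. h j (V j x)) = h a (V a x) * (\<Prod>j\<in>J - {a}. h j (V j x))"
      using J aJ by (simp add: prod.remove)
    ultimately show "(\<lambda>n. g x * (\<Prod>j\<in>J. (h(a := p n)) j (V j x))) \<longlonglongrightarrow> g x * (\<Prod>j\<in>J. h j (V j x))"
      unfolding prod_fun_upd[OF J aJ] by simp
  qed
qed

text \<open>Weierstrass approximation in one coordinate at a time: monomials extend to polynomials
  by linearity and to continuous functions by uniform limits. Two spaces and two weights occur
  because the Bessel law is compared with a weighted Wiener measure; the weights may change
  sign.\<close>

lemma prod_moments_extend:
  fixes g1 :: "'a \<Rightarrow> real" and g2 :: "'b \<Rightarrow> real" and V1 :: "'j \<Rightarrow> 'a \<Rightarrow> real" and V2 :: "'j \<Rightarrow> 'b \<Rightarrow> real"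
  assumes g1: "integrable M1 g1" and g2: "integrable M2 g2" and J: "finite J"
    and V1: "\<And>j. j \<in> J \<Longrightarrow> V1 j \<in> borel_measurable M1" "\<And>j x. j \<in> J \<Longrightarrow> V1 j x \<in> {0..1}"
    and V2: "\<And>j. j \<in> J \<Longrightarrow> V2 j \<in> borel_measurable M2" "\<And>j x. j \<in> J \<Longrightarrow> V2 j x \<in> {0..1}"
    and mom: "\<And>m. (\<integral>x. g1 x * (\<Prod>j\<in>J. V1 j x ^ m j) \<partial>M1) = (\<integral>x. g2 x * (\<Prod>j\<in>J. V2 j x ^ m j) \<partial>M2)"
    and h: "\<And>j. continuous_on UNIV (h j)"
  shows "(\<integral>x. g1 x * (\<Prod>j\<in>J. h j (V1 j x)) \<partial>M1) = (\<integral>x. g2 x * (\<Prod>j\<in>J. h j (V2 j x)) \<partial>M2)"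
proof -
  \<comment> \<open>\<open>A\<close> is the set of coordinates already upgraded from monomials to
    continuous functions.\<close>
  have "finite A \<Longrightarrow> A \<subseteq> J \<Longrightarrow> (\<And>j. j \<in> A \<Longrightarrow> continuous_on UNIV (h j)) \<Longrightarrow>
      (\<And>j. j \<in> J - A \<Longrightarrow> \<exists>m::nat. h j = (\<lambda>v. v ^ m)) \<Longrightarrow>
    (\<integral>x. g1 x * (\<Prod>j\<in>J. h j (V1 j x)) \<partial>M1) = (\<integral>x. g2 x * (\<Prod>j\<in>J. h j (V2 j x)) \<partial>M2)" for A h
  proof (induction A arbitrary: h rule: finite_induct)
    case empty
    then obtain m where "\<And>j. j \<in> J \<Longrightarrow> h j = (\<lambda>v. v ^ m j)" by (metis Diff_empty)
    then show ?case using mom[of m] by simp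
  next
    case (insert a A)
    have aJ: "a \<in> J" using insert.prems by auto
    have hc: "continuous_on UNIV (h j)" if "j \<in> J" for j
    proof (cases "j \<in> insert a A")
      case True then show ?thesis by (rule insert.prems(2))
    next
      case False
      then have "\<exists>m::nat. h j = (\<lambda>v. v ^ m)" using insert.prems(3)[of j] that by blast
      then show ?thesis by (auto intro!: continuous_intros)
    qed
    have "\<exists>p. real_polynomial_function p \<and> (\<forall>v\<in>{0..1}. \<bar>h a v - p v\<bar> < 1 / real (Suc n))" for n
      using Stone_Weierstrass_real_polynomial_function[OF compact_Icc[of 0 1]
          continuous_on_subset[OF hc[OF aJ] subset_UNIV], of "1 / real (Suc n)"]
      by (metis of_nat_0_less_iff zero_less_Suc zero_less_divide_1_iff)
    then obtain p where p: "\<And>n. real_polynomial_function (p n)"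
      "\<And>n v. v \<in> {0..1} \<Longrightarrow> \<bar>h a v - p n v\<bar> < 1 / real (Suc n)" by metis
    have "\<exists>c N. p n = (\<lambda>v. \<Sum>i\<le>N. c i * v ^ i)" for n
      using real_polynomial_function_imp_sum[OF p(1)[of n]] by auto
    then obtain c N where pc: "\<And>n. p n = (\<lambda>v. \<Sum>i\<le>N n. c n i * v ^ i)" by metis
    let ?h = "\<lambda>f. h(a := f)"
    have "(\<integral>x. g1 x * (\<Prod>j\<in>J. (?h (\<lambda>v. v ^ i)) j (V1 j x)) \<partial>M1)
       = (\<integral>x. g2 x * (\<Prod>j\<in>J. (?h (\<lambda>v. v ^ i)) j (V2 j x)) \<partial>M2)" for i
    proof (rule insert.IH)
      show "A \<subseteq> J" using insert.prems by auto
      show "continuous_on UNIV ((?h (\<lambda>v. v ^ i)) j)" if "j \<in> A" for j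
        using hc[of j] that insert.prems(1) insert.hyps by auto
      show "\<exists>m::nat. (?h (\<lambda>v. v ^ i)) j = (\<lambda>v. v ^ m)" if "j \<in> J - A" for j
        using insert.prems(3)[of j] that by (cases "j = a") auto
    qed
    note mon = this
    have "(\<integral>x. g1 x * (\<Prod>j\<in>J. (?h (p n)) j (V1 j x)) \<partial>M1)
       = (\<integral>x. g2 x * (\<Prod>j\<in>J. (?h (p n)) j (V2 j x)) \<partial>M2)" for n
      using integral_prod_polynomial[where V=V1 and h=h and c="c n" and N="N n", OF g1 J aJ V1 hc]
        integral_prod_polynomial[where V=V2 and h=h and c="c n" and N="N n", OF g2 J aJ V2 hc]
      unfolding pc mon by (simp only:)
    moreover have pcont: "continuous_on UNIV (p n)" for n unfolding pc by (intro continuous_intros)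
    ultimately show ?case
      using LIMSEQ_unique[OF tendsto_integral_prod[where V=V1 and h=h and p=p, OF g1 J aJ V1 hc pcont p(2)]]
        tendsto_integral_prod[where V=V2 and h=h and p=p, OF g2 J aJ V2 hc pcont p(2)] by simp
  qed
  from this[of J h] show ?thesis using J h by auto
qed

section \<open>The Bessel process started away from zero\<close>

abbreviation triple :: "'a measure \<Rightarrow> ('a \<times> 'a \<times> 'a) measure" where
  "triple W \<equiv> W \<Otimes>\<^sub>M (W \<Otimes>\<^sub>M W)"

text \<open>The norm of three-dimensional Brownian motion started at (e, 0, 0). The driving triple
  itself starts at 0, so e can tend to 0 with the noise held fixed.\<close>

definition bes :: "real \<Rightarrow> (real \<Rightarrow> real) \<times> (real \<Rightarrow> real) \<times> (real \<Rightarrow> real) \<Rightarrow> real \<Rightarrow> real" where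
  "bes e = (\<lambda>(a, b, c). \<lambda>u\<in>{0..}. sqrt ((e + a u)\<^sup>2 + (b u)\<^sup>2 + (c u)\<^sup>2))"

lemma bessel3_law_eq: "bessel3_law W = distr (triple W) path_sigma (bes 0)"
  unfolding bessel3_law_def bes_def by simp

lemma bes_in_paths:
  assumes "a \<in> paths" "b \<in> paths" "c \<in> paths" shows "bes e (a, b, c) \<in> paths"
  unfolding bes_def prod.case
  by (rule restrict_in_paths) (intro continuous_intros paths_continuous assms)

lemma bes_nonneg: "0 \<le> u \<Longrightarrow> 0 \<le> bes e z u"
  by (cases z) (simp add: bes_def)

lemma measurable_triple: "sets W = sets path_sigma \<Longrightarrow> measurable (triple W) N = measurable (triple path_sigma) N"
  by (intro measurable_cong_sets sets_pair_measure_cong refl)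

lemma space_triple: "sets W = sets path_sigma \<Longrightarrow> space (triple W) = paths \<times> paths \<times> paths"
  by (simp add: space_pair_measure space_eq_paths)

lemma bes_measurable_path_sigma: "bes e \<in> measurable (triple path_sigma) path_sigma"
proof (rule measurable_path_sigmaI)
  show "bes e z \<in> paths" if "z \<in> space (triple path_sigma)" for z
    using that by (cases z) (auto simp: space_triple intro: bes_in_paths)
  fix s :: real assume s: "0 \<le> s"
  note [measurable] = coord_measurable_path_sigma[OF s]
  have "(\<lambda>z. sqrt ((e + fst z s)\<^sup>2 + (fst (snd z) s)\<^sup>2 + (snd (snd z) s)\<^sup>2)) \<in> borel_measurable (triple path_sigma)"
  proof -
    have [measurable]: "(\<lambda>z. fst z s) \<in> borel_measurable (triple path_sigma)"
      "(\<lambda>z. fst (snd z) s) \<in> borel_measurable (triple path_sigma)"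
      "(\<lambda>z. snd (snd z) s) \<in> borel_measurable (triple path_sigma)"
      by (rule measurable_compose[OF _ coord_measurable_path_sigma[OF s]]; measurable)+
    show ?thesis by measurable
  qed
  then show "(\<lambda>z. bes e z s) \<in> borel_measurable (triple path_sigma)"
    using s by (simp add: bes_def split_beta')
qed

lemma bes_measurable: "sets W = sets path_sigma \<Longrightarrow> bes e \<in> measurable (triple W) path_sigma"
  by (subst measurable_triple, assumption) (rule bes_measurable_path_sigma)

lemma integral_pair_times:
  fixes f :: "'a \<Rightarrow> real" and g :: "'b \<Rightarrow> real"
  assumes M: "prob_space M" and N: "prob_space N"
    and f: "f \<in> borel_measurable M" "\<And>x. \<bar>f x\<bar> \<le> B" and g: "g \<in> borel_measurable N" "\<And>x. \<bar>g x\<bar> \<le> C"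
  shows "(\<integral>z. f (fst z) * g (snd z) \<partial>(M \<Otimes>\<^sub>M N)) = (\<integral>x. f x \<partial>M) * (\<integral>x. g x \<partial>N)"
proof -
  interpret M: prob_space M by fact
  interpret N: prob_space N by fact
  interpret pair_sigma_finite M N ..
  interpret MN: prob_space "M \<Otimes>\<^sub>M N" by (rule prob_space_pair) unfold_locales
  have "\<bar>f (fst z) * g (snd z)\<bar> \<le> B * C" for z
    unfolding abs_mult by (intro mult_mono f g) (use order_trans[OF abs_ge_zero f(2)] in auto)
  then have "integrable (M \<Otimes>\<^sub>M N) (\<lambda>z. f (fst z) * g (snd z))"
    by (intro MN.integrable_const_bound[where B="B * C"] borel_measurable_times
        measurable_compose[OF measurable_fst f(1)] measurable_compose[OF measurable_snd g(1)]) auto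
  from integral_fst'[OF this] show ?thesis by simp
qed

text \<open>The extra factor raises the exponent at \<open>t\<close> to at least one whatever moment
  is tested; this is the positivity at the last time that \<open>wiener_exp_chain\<close>
  demands.\<close>

lemma prod_exp_power:
  assumes J: "finite J" "t \<in> J"
  shows "exp (- (v t)\<^sup>2) * (\<Prod>j\<in>J. exp (- (v j)\<^sup>2) ^ m j) =
    (\<Prod>j\<in>J. exp (- (real (m j) + (if j = t then 1 else 0)) * (v j :: real)\<^sup>2))"
proof -
  have e: "exp (- (v j)\<^sup>2) ^ m j = exp (- real (m j) * (v j)\<^sup>2)" for j
    by (simp add: exp_of_nat_mult[symmetric])
  have "(\<Prod>j\<in>J. exp (- (real (m j) + (if j = t then 1 else 0)) * (v j :: real)\<^sup>2))
      = (\<Prod>j\<in>J. (if j = t then exp (- (v t)\<^sup>2) else 1) * exp (- real (m j) * (v j)\<^sup>2))"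
    by (rule prod.cong[OF refl]) (simp add: exp_add[symmetric] algebra_simps)
  also have "\<dots> = exp (- (v t)\<^sup>2) * (\<Prod>j\<in>J. exp (- real (m j) * (v j)\<^sup>2))"
    using J by (simp add: prod.distrib prod.delta)
  finally show ?thesis unfolding e by simp
qed

lemma wiener_integral_uminus:
  fixes f :: "_ \<Rightarrow> real"
  assumes W: "wiener_law 0 W" and f: "f \<in> borel_measurable path_sigma"
  shows "(\<integral>w. f w \<partial>W) = (\<integral>w. f (sub_path 0 w) \<partial>W)"
proof -
  have "(\<integral>w. f w \<partial>W) = (\<integral>w. f w \<partial>distr W path_sigma (sub_path 0))"
    by (simp only: wiener_law_uminus[OF W])
  then show ?thesis
    using integral_distr[OF _ f, of "sub_path 0" W] sub_path_measurable by (simp add: wiener_measurable[OF W])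
qed

text \<open>On mixed moments of exp(- r^2) the left side is a product of three transforms with
  starting points e, 0, 0, that is c^3 exp(- L e^2). The right side is the endpoint-weighted
  transform divided by e and has the same value. The weight e - w t is still signed here; paths
  exceeding e are removed afterwards by reflection.\<close>

lemma bes_cylinder_integral:
  assumes W: "wiener_law 0 W" and e: "0 < e" and J: "finite J" "J \<subseteq> {0..t}" "t \<in> J" "0 \<in> J"
    and h: "\<And>j. continuous_on UNIV (h j)"
  shows "(\<integral>z. exp (- (bes e z t)\<^sup>2) * (\<Prod>j\<in>J. h j (exp (- (bes e z j)\<^sup>2))) \<partial>triple W) =
    (\<integral>w. exp (- (e - w t)\<^sup>2) * (e - w t) / e * (\<Prod>j\<in>J. h j (exp (- (e - w j)\<^sup>2))) \<partial>W)"
proof (rule prod_moments_extend[where ?V1.0="\<lambda>j z. exp (- (bes e z j)\<^sup>2)" and ?V2.0="\<lambda>j w. exp (- (e - w j)\<^sup>2)",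
      OF _ _ J(1) _ _ _ _ _ h])
  interpret W: prob_space W using wiener_prob[OF W] .
  interpret WW: prob_space "W \<Otimes>\<^sub>M W" by (rule prob_space_pair) unfold_locales
  interpret T: prob_space "triple W" by (rule prob_space_pair) unfold_locales
  have j0: "0 \<le> j" if "j \<in> J" for j using that J(2) by auto
  have c[measurable]: "(\<lambda>w. w j) \<in> borel_measurable W" if "j \<in> J" for j
    using coord_measurable_path_sigma[OF j0[OF that]] by (simp add: wiener_measurable[OF W])
  have bm: "(\<lambda>z. bes e z j) \<in> borel_measurable (triple W)" if "j \<in> J" for j
    by (rule measurable_compose[OF bes_measurable[OF wiener_sets[OF W]] coord_measurable_path_sigma[OF j0[OF that]]])
  note ct = c[OF J(3)] and bt = bm[OF J(3)]
  show "integrable (triple W) (\<lambda>z. exp (- (bes e z t)\<^sup>2))"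
    by (rule T.integrable_const_bound[where B=1]) (use bt in auto)
  show "integrable W (\<lambda>w. exp (- (e - w t)\<^sup>2) * (e - w t) / e)"
  proof (rule W.integrable_const_bound[where B="2 / e"])
    have "\<bar>exp (- (e - w t)\<^sup>2) * (e - w t)\<bar> \<le> 2" for w :: "real \<Rightarrow> real"
      using abs_times_exp_le[of 1 "e - w t"] by simp
    then show "AE w in W. norm (exp (- (e - w t)\<^sup>2) * (e - w t) / e) \<le> 2 / e"
      using e by (auto simp: divide_right_mono)
  qed (use ct in measurable)
  show "(\<lambda>z. exp (- (bes e z j)\<^sup>2)) \<in> borel_measurable (triple W)" if "j \<in> J" for j
    using bm[OF that] by measurable
  show "(\<lambda>w. exp (- (e - w j)\<^sup>2)) \<in> borel_measurable W" if "j \<in> J" for j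
    using c[OF that] by measurable
  show "exp (- (bes e z j)\<^sup>2) \<in> {0..1}" "exp (- (e - w j)\<^sup>2) \<in> {0..1}" for j z and w :: "real \<Rightarrow> real" by auto
  fix m :: "real \<Rightarrow> nat"
  define l where "l = (\<lambda>j. real (m j) + (if j = t then 1 else 0))"
  have Mt: "Max J = t" using J by (intro Max_eqI) auto
  have l: "0 \<le> l j" "0 < l (Max J)" for j unfolding Mt by (auto simp: l_def)
  have J0: "J \<subseteq> {0..}" using J(2) by auto
  obtain c' L where cL: "\<And>y. (\<integral>w. (\<Prod>j\<in>J. exp (- l j * (y + w j)\<^sup>2)) \<partial>W) = c' * exp (- L * y\<^sup>2)"
      "\<And>y. (\<integral>w. (\<Prod>j\<in>J. exp (- l j * (y + w j)\<^sup>2)) * (y + w t) \<partial>W) = c' ^ 3 * (y * exp (- L * y\<^sup>2))"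
    using wiener_exp_chain[where l=l, OF W J(1) J0 J(4) l] unfolding Mt by blast
  let ?g = "\<lambda>y w. (\<Prod>j\<in>J. exp (- l j * (y + w j)\<^sup>2)) :: real"
  have gm: "?g y \<in> borel_measurable W" for y using c by measurable
  have gb: "\<bar>?g y w\<bar> \<le> 1" for y w
    using l(1) by (auto simp: abs_prod intro!: prod_le_1)
  have "(\<integral>z. exp (- (bes e z t)\<^sup>2) * (\<Prod>j\<in>J. exp (- (bes e z j)\<^sup>2) ^ m j) \<partial>triple W)
      = (\<integral>z. ?g e (fst z) * (?g 0 (fst (snd z)) * ?g 0 (snd (snd z))) \<partial>triple W)"
  proof (rule Bochner_Integration.integral_cong[OF refl])
    fix z :: "(real \<Rightarrow> real) \<times> (real \<Rightarrow> real) \<times> (real \<Rightarrow> real)"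
    obtain a b c where z: "z = (a, b, c)" by (cases z)
    have "exp (- l j * (bes e z j)\<^sup>2) = exp (- l j * (e + a j)\<^sup>2) * (exp (- l j * (0 + b j)\<^sup>2) * exp (- l j * (0 + c j)\<^sup>2))"
      if "j \<in> J" for j
    proof -
      have "(bes e z j)\<^sup>2 = (e + a j)\<^sup>2 + ((0 + b j)\<^sup>2 + (0 + c j)\<^sup>2)"
        using j0[OF that] by (simp add: z bes_def)
      then show ?thesis by (simp only: distrib_left exp_add)
    qed
    then show "exp (- (bes e z t)\<^sup>2) * (\<Prod>j\<in>J. exp (- (bes e z j)\<^sup>2) ^ m j)
        = ?g e (fst z) * (?g 0 (fst (snd z)) * ?g 0 (snd (snd z)))"
      unfolding prod_exp_power[OF J(1,3), folded l_def] z fst_conv snd_conv prod.distrib[symmetric]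
      by (intro prod.cong refl) (simp add: l_def)
  qed
  also have "\<dots> = (\<integral>a. ?g e a \<partial>W) * (\<integral>z. ?g 0 (fst z) * ?g 0 (snd z) \<partial>(W \<Otimes>\<^sub>M W))"
  proof (rule integral_pair_times[where B=1 and C=1])
    show "(\<lambda>z. ?g 0 (fst z) * ?g 0 (snd z)) \<in> borel_measurable (W \<Otimes>\<^sub>M W)"
      by (intro borel_measurable_times measurable_compose[OF measurable_fst gm] measurable_compose[OF measurable_snd gm])
    show "\<bar>?g 0 (fst z) * ?g 0 (snd z)\<bar> \<le> 1" for z unfolding abs_mult by (intro mult_le_one gb) auto
  qed (use gm gb in \<open>auto intro: W.prob_space_axioms WW.prob_space_axioms\<close>)
  also have "(\<integral>z. ?g 0 (fst z) * ?g 0 (snd z) \<partial>(W \<Otimes>\<^sub>M W)) = (\<integral>a. ?g 0 a \<partial>W) * (\<integral>a. ?g 0 a \<partial>W)"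
    by (rule integral_pair_times[where B=1 and C=1, OF W.prob_space_axioms W.prob_space_axioms gm gb gm gb])
  also have "(\<integral>a. ?g e a \<partial>W) * ((\<integral>a. ?g 0 a \<partial>W) * (\<integral>a. ?g 0 a \<partial>W)) = c' ^ 3 * exp (- L * e\<^sup>2)"
    unfolding cL(1) by (simp add: power3_eq_cube)
  also have "\<dots> = (\<integral>w. ?g e w * (e + w t) \<partial>W) / e"
    unfolding cL(2) using e by simp
  \<comment> \<open>Symmetry of Wiener measure turns e + w into e - w, so that positivity of the
    transformed path means that w stays below the level e.\<close>
  also have "(\<integral>w. ?g e w * (e + w t) \<partial>W) = (\<integral>w. ?g e (sub_path 0 w) * (e + sub_path 0 w t) \<partial>W)"
    using gm[of e] ct by (intro wiener_integral_uminus[OF W]) (simp add: wiener_measurable[OF W])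
  also have "\<dots> / e = (\<integral>w. ?g e (sub_path 0 w) * (e + sub_path 0 w t) / e \<partial>W)" by simp
  also have "\<dots> = (\<integral>w. exp (- (e - w t)\<^sup>2) * (e - w t) / e * (\<Prod>j\<in>J. exp (- (e - w j)\<^sup>2) ^ m j) \<partial>W)"
  proof (rule Bochner_Integration.integral_cong[OF refl])
    fix w
    have "?g e (sub_path 0 w) = (\<Prod>j\<in>J. exp (- l j * (e - w j)\<^sup>2))"
      by (intro prod.cong refl) (simp add: sub_path_def j0)
    also have "\<dots> = exp (- (e - w t)\<^sup>2) * (\<Prod>j\<in>J. exp (- (e - w j)\<^sup>2) ^ m j)"
      unfolding l_def by (rule prod_exp_power[OF J(1,3), symmetric])
    finally have "?g e (sub_path 0 w) = exp (- (e - w t)\<^sup>2) * (\<Prod>j\<in>J. exp (- (e - w j)\<^sup>2) ^ m j)" .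
    moreover have "sub_path 0 w t = - w t" using j0[OF J(3)] by (simp add: sub_path_def)
    ultimately show "?g e (sub_path 0 w) * (e + sub_path 0 w t) / e
        = exp (- (e - w t)\<^sup>2) * (e - w t) / e * (\<Prod>j\<in>J. exp (- (e - w j)\<^sup>2) ^ m j)" by simp
  qed
  finally show "(\<integral>z. exp (- (bes e z t)\<^sup>2) * (\<Prod>j\<in>J. exp (- (bes e z j)\<^sup>2) ^ m j) \<partial>triple W)
     = (\<integral>w. exp (- (e - w t)\<^sup>2) * (e - w t) / e * (\<Prod>j\<in>J. exp (- (e - w j)\<^sup>2) ^ m j) \<partial>W)" .
qed

section \<open>Dyadic grids and the first grid crossing of a level\<close>

definition grid :: "real \<Rightarrow> nat \<Rightarrow> nat \<Rightarrow> real" where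
  "grid t n k = t * (real k / 2 ^ n)"

definition crossed :: "real \<Rightarrow> real \<Rightarrow> nat \<Rightarrow> (real \<Rightarrow> real) \<Rightarrow> bool" where
  "crossed z t n w \<longleftrightarrow> (\<exists>k\<le>2 ^ n. z < w (grid t n k))"

text \<open>Meaningful only together with \<open>crossed\<close>: otherwise the index is unspecified
  or beyond the grid, and nothing but nonnegativity of the time is used.\<close>

definition cross_time :: "real \<Rightarrow> real \<Rightarrow> nat \<Rightarrow> (real \<Rightarrow> real) \<Rightarrow> real" where
  "cross_time z t n w = grid t n (LEAST k. z < w (grid t n k))"

definition first_cross :: "real \<Rightarrow> real \<Rightarrow> nat \<Rightarrow> nat \<Rightarrow> (real \<Rightarrow> real) \<Rightarrow> bool" where
  "first_cross z t n k w \<longleftrightarrow> z < w (grid t n k) \<and> (\<forall>i<k. w (grid t n i) \<le> z)"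

lemma grid_bounds: "0 \<le> t \<Longrightarrow> k \<le> 2 ^ n \<Longrightarrow> 0 \<le> grid t n k \<and> grid t n k \<le> t"
proof -
  assume t: "0 \<le> t" and "k \<le> 2 ^ n"
  then have "real k \<le> 2 ^ n" by (metis of_nat_le_iff of_nat_numeral of_nat_power)
  then have "real k / 2 ^ n \<le> 1" by simp
  then have "t * (real k / 2 ^ n) \<le> t * 1" using t by (intro mult_left_mono)
  then show ?thesis unfolding grid_def using t by simp
qed

lemma grid_nonneg: "0 \<le> t \<Longrightarrow> 0 \<le> grid t n k"
  unfolding grid_def by simp

lemma grid_mono: "0 \<le> t \<Longrightarrow> i \<le> k \<Longrightarrow> grid t n i \<le> grid t n k"
  unfolding grid_def by (intro mult_left_mono divide_right_mono) auto

lemma sum_first_index: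
  fixes f :: "nat \<Rightarrow> 'a::comm_monoid_add"
  shows "(\<Sum>k\<le>N. if p k \<and> (\<forall>i<k. \<not> p i) then f k else 0) = (if \<exists>k\<le>N. p k then f (LEAST k. p k) else 0)"
proof (cases "\<exists>k\<le>N. p k")
  case True
  define m where "m = (LEAST k. p k)"
  have m: "p m" "\<And>i. i < m \<Longrightarrow> \<not> p i" using True unfolding m_def by (auto intro: LeastI dest: not_less_Least)
  have "m \<le> N" using True unfolding m_def by (meson Least_le order_trans)
  have eq: "p k \<and> (\<forall>i<k. \<not> p i) \<longleftrightarrow> k = m" for k
    using m by (metis linorder_neqE_nat)
  show ?thesis unfolding eq using True \<open>m \<le> N\<close> by (simp add: m_def[symmetric])
next
  case False
  then show ?thesis by (auto intro: sum.neutral)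
qed

text \<open>A functional at the random grid crossing becomes a finite sum over deterministic times,
  to each of which the Markov property at a fixed time applies.\<close>

lemma sum_first_cross:
  "(\<Sum>k\<le>2 ^ n. if first_cross z t n k w then f (grid t n k) else 0)
    = (if crossed z t n w then f (cross_time z t n w) else (0::'a::comm_monoid_add))"
  using sum_first_index[where N="2 ^ n" and p="\<lambda>k. z < w (grid t n k)" and f="\<lambda>k. f (grid t n k)"]
  unfolding first_cross_def crossed_def cross_time_def by (simp add: not_less)

lemma cross_time_bounds:
  assumes "0 \<le> t" "crossed z t n w"
  shows "cross_time z t n w \<in> {0..t}" "z < w (cross_time z t n w)"
proof -
  obtain k where k: "k \<le> 2 ^ n" "z < w (grid t n k)" using assms(2) unfolding crossed_def by auto
  show "z < w (cross_time z t n w)" unfolding cross_time_def using LeastI[of "\<lambda>k. z < w (grid t n k)", OF k(2)] .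
  have "(LEAST k. z < w (grid t n k)) \<le> 2 ^ n" using Least_le[of "\<lambda>k. z < w (grid t n k)", OF k(2)] k(1) by simp
  then show "cross_time z t n w \<in> {0..t}" unfolding cross_time_def using grid_bounds[OF assms(1)] by auto
qed

text \<open>s is the infimum of the times at which the path is strictly above z, possibly later than
  its first visit to z. These times form a relatively open set, so fine grids contain some of them
  arbitrarily close to s, while no grid crossing can precede s.\<close>

lemma cross_time_tendsto:
  assumes w: "w \<in> paths" and w0: "w 0 \<le> z" and ex: "\<exists>u\<in>{0..t}. z < w u"
  obtains s where "s \<in> {0..t}" "w s = z" "\<And>u. u \<in> {0..s} \<Longrightarrow> w u \<le> z"
    "\<And>n. crossed z t n w \<Longrightarrow> s \<le> cross_time z t n w"
    "\<forall>\<^sub>F n in sequentially. crossed z t n w" "(\<lambda>n. cross_time z t n w) \<longlonglongrightarrow> s"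
    "\<And>d. 0 < d \<Longrightarrow> \<exists>u\<in>{0..t}. z < w u \<and> u < s + d"
proof -
  define S where "S = {u \<in> {0..t}. z < w u}"
  define s where "s = Inf S"
  have ne: "S \<noteq> {}" using ex unfolding S_def by auto
  have bb: "bdd_below S" unfolding S_def by (rule bdd_belowI[of _ 0]) auto
  have s0: "0 \<le> s" unfolding s_def by (rule cInf_greatest[OF ne]) (auto simp: S_def)
  have slow: "s \<le> u" if "u \<in> S" for u unfolding s_def by (rule cInf_lower[OF that bb])
  have st: "s \<le> t"
  proof -
    obtain u where "u \<in> S" using ne by auto
    then show ?thesis using slow[of u] by (simp add: S_def)
  qed
  have near: "\<exists>u\<in>S. u < s + d" if "0 < d" for d
    using cInf_lessD[OF ne, of "s + d"] that unfolding s_def by auto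
  have below: "w u \<le> z" if "0 \<le> u" "u < s" for u
  proof (rule ccontr)
    assume "\<not> w u \<le> z"
    then have "u \<in> S" using that st by (simp add: S_def)
    then show False using slow[of u] that by simp
  qed
  have le: "w s \<le> z"
  proof (cases "s = 0")
    case True then show ?thesis using w0 by simp
  next
    case False
    then have sp: "0 < s" using s0 by simp
    \<comment> \<open>An approach to s from the left that never leaves the nonnegative
      times.\<close>
    have "(\<lambda>n. s - s * (1 / real (Suc n))) \<longlonglongrightarrow> s - s * 0"
      by (intro tendsto_intros LIMSEQ_Suc[OF lim_1_over_n])
    moreover have "0 \<le> s - s * (1 / real (Suc n))" for n
      using mult_left_le[of "1 / real (Suc n)" s] s0 by simp
    ultimately have "(\<lambda>n. w (s - s * (1 / real (Suc n)))) \<longlonglongrightarrow> w s"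
      by (intro paths_tendsto[OF w _ _ s0]) simp_all
    then show ?thesis
    proof (rule LIMSEQ_le_const2, intro exI[of _ 0] allI impI)
      fix n
      have "0 < s * (1 / real (Suc n))" "s * (1 / real (Suc n)) \<le> s"
        using sp mult_left_le[of "1 / real (Suc n)" s] by simp_all
      then show "w (s - s * (1 / real (Suc n))) \<le> z" by (intro below) auto
    qed
  qed
  have "\<exists>u. u \<in> S \<and> u < s + 1 / real (Suc n)" for n
    using near[of "1 / real (Suc n)"] by auto
  then obtain u where u: "\<And>n. u n \<in> S" "\<And>n. u n < s + 1 / real (Suc n)" by metis
  have "u \<longlonglongrightarrow> s"
  proof (rule real_tendsto_sandwich[where f="\<lambda>_. s" and h="\<lambda>n. s + 1 / real (Suc n)"])
    show "(\<lambda>n. s + 1 / real (Suc n)) \<longlonglongrightarrow> s"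
      using tendsto_add[OF tendsto_const[of s] LIMSEQ_Suc[OF lim_1_over_n]] by simp
    show "\<forall>\<^sub>F n in sequentially. s \<le> u n" by (intro always_eventually allI slow u(1))
    show "\<forall>\<^sub>F n in sequentially. u n \<le> s + 1 / real (Suc n)" 
      by (intro always_eventually allI less_imp_le u(2))
  qed auto
  then have "(\<lambda>n. w (u n)) \<longlonglongrightarrow> w s"
    by (rule paths_tendsto[OF w]) (use u(1) s0 in \<open>auto simp: S_def\<close>)
  then have "z \<le> w s" by (rule LIMSEQ_le_const) (use u(1) in \<open>auto simp: S_def less_imp_le\<close>)
  with le have ws: "w s = z" by simp
  have t0: "0 < t"
  proof (rule ccontr)
    assume "\<not> 0 < t"
    then obtain "t = 0" using s0 st by auto
    then show False using ex w0 by auto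
  qed
  have T: "cross_time z t n w \<in> S" if "crossed z t n w" for n
    using cross_time_bounds[OF _ that] t0 unfolding S_def by auto
  have ev: "\<forall>\<^sub>F n in sequentially. crossed z t n w \<and> cross_time z t n w < s + d" if d: "0 < d" for d
  proof -
    obtain u where u: "u \<in> S" "u < s + d" using near[OF d] by auto
    have u01: "0 \<le> u" "u \<le> t" "z < w u" using u(1) unfolding S_def by auto
    \<comment> \<open>The last grid point not exceeding u; by continuity the path is above z there
      once the grid is fine enough.\<close>
    let ?v = "\<lambda>n. grid t n (nat \<lfloor>u / t * 2 ^ n\<rfloor>)"
    have v: "?v n \<le> u" "u - t / 2 ^ n \<le> ?v n" "nat \<lfloor>u / t * 2 ^ n\<rfloor> \<le> 2 ^ n" for n
    proof -
      have r: "real (nat \<lfloor>u / t * 2 ^ n\<rfloor>) = of_int \<lfloor>u / t * 2 ^ n\<rfloor>" using u01 t0 by simp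
      have f: "of_int \<lfloor>u / t * 2 ^ n\<rfloor> \<le> u / t * 2 ^ n" "u / t * 2 ^ n - 1 \<le> of_int \<lfloor>u / t * 2 ^ n\<rfloor>" by linarith+
      have "?v n \<le> t * ((u / t * 2 ^ n) / 2 ^ n)"
        unfolding grid_def r using f(1) t0 by (intro mult_left_mono divide_right_mono) auto
      also have "\<dots> = u" using t0 by simp
      finally show "?v n \<le> u" .
      have "u - t / 2 ^ n = t * ((u / t * 2 ^ n - 1) / 2 ^ n)" using t0 by (simp add: field_simps)
      also have "\<dots> \<le> ?v n" unfolding grid_def r using f(2) t0 by (intro mult_left_mono divide_right_mono) auto
      finally show "u - t / 2 ^ n \<le> ?v n" .
      have "u / t * 2 ^ n \<le> 1 * 2 ^ n" using u01 t0 by (intro mult_right_mono) auto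
      then have "of_int \<lfloor>u / t * 2 ^ n\<rfloor> \<le> (2::real) ^ n" using f(1) by linarith
      then have "real (nat \<lfloor>u / t * 2 ^ n\<rfloor>) \<le> real (2 ^ n)" unfolding r by (simp only: of_nat_power of_nat_numeral)
      then show "nat \<lfloor>u / t * 2 ^ n\<rfloor> \<le> 2 ^ n" by (simp only: of_nat_le_iff)
    qed
    have "?v \<longlonglongrightarrow> u"
    proof (rule real_tendsto_sandwich[where f="\<lambda>n. u - t / 2 ^ n" and h="\<lambda>_. u"])
      have "(\<lambda>n. u - t * (1 / 2) ^ n) \<longlonglongrightarrow> u - t * 0"
        by (intro tendsto_intros LIMSEQ_power_zero) auto
      then show "(\<lambda>n. u - t / 2 ^ n) \<longlonglongrightarrow> u" by (simp add: power_divide)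
    qed (use v in auto)
    then have "(\<lambda>n. w (?v n)) \<longlonglongrightarrow> w u"
      by (rule paths_tendsto[OF w]) (use u01 t0 grid_nonneg in auto)
    then have "\<forall>\<^sub>F n in sequentially. z < w (?v n)" by (rule order_tendstoD(1)) (rule u01)
    then show ?thesis
    proof eventually_elim
      case (elim n)
      have "crossed z t n w" using elim v(3)[of n] unfolding crossed_def by blast
      moreover have "cross_time z t n w \<le> ?v n"
        unfolding cross_time_def using t0 Least_le[of "\<lambda>k. z < w (grid t n k)", OF elim]
        by (intro grid_mono) auto
      ultimately show ?case using v(1)[of n] u(2) by simp
    qed
  qed
  have lim: "(\<lambda>n. cross_time z t n w) \<longlonglongrightarrow> s"
  proof (rule LIMSEQ_I)
    fix d :: real assume "0 < d"
    from ev[OF this] have "\<forall>\<^sub>F n in sequentially. norm (cross_time z t n w - s) < d"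
    proof eventually_elim
      case (elim n) then show ?case using slow[OF T[of n]] by auto
    qed
    then show "\<exists>no. \<forall>n\<ge>no. norm (cross_time z t n w - s) < d" unfolding eventually_sequentially .
  qed
  show ?thesis
  proof (rule that[of s])
    show "s \<in> {0..t}" using s0 st by simp
    show "w u \<le> z" if "u \<in> {0..s}" for u using below[of u] le that by (cases "u = s") auto
    show "s \<le> cross_time z t n w" if "crossed z t n w" for n using slow[OF T[OF that]] .
    show "\<forall>\<^sub>F n in sequentially. crossed z t n w" using ev[of 1] by (auto elim: eventually_mono)
    show "\<exists>u\<in>{0..t}. z < w u \<and> u < s + d" if "0 < d" for d using near[OF that] unfolding S_def by auto
  qed (fact ws lim)+
qed

section \<open>The reflection principle\<close>

lemma weak_markov_integral:
  fixes F :: "_ \<Rightarrow> real"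
  assumes P: "wiener_law x P" and W: "wiener_law 0 W" and s: "0 \<le> s"
    and F: "F \<in> borel_measurable (path_sigma \<Otimes>\<^sub>M path_sigma)" and bdd: "\<And>z. \<bar>F z\<bar> \<le> K"
  shows "(\<integral>w. F (stop_path s w, shift_path s w) \<partial>P) = (\<integral>w. \<integral>v. F (stop_path s w, v) \<partial>W \<partial>P)"
proof -
  interpret P: prob_space P using wiener_prob[OF P] .
  interpret W: prob_space W using wiener_prob[OF W] .
  have m1: "stop_path s \<in> measurable P path_sigma"
    using stop_path_measurable'[OF s] by (simp add: wiener_measurable[OF P])
  have m2: "shift_path s \<in> measurable P path_sigma"
    using shift_path_measurable[OF s] by (simp add: wiener_measurable[OF P])
  interpret S: prob_space "distr P path_sigma (stop_path s)" by (rule P.prob_space_distr[OF m1])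
  interpret pair_sigma_finite "distr P path_sigma (stop_path s)" W ..
  interpret SW: prob_space "distr P path_sigma (stop_path s) \<Otimes>\<^sub>M W"
    by (rule prob_space_pair) unfold_locales
  have F': "F \<in> borel_measurable (path_sigma \<Otimes>\<^sub>M W)"
    using F wiener_sets[OF W] by (simp cong: measurable_cong_sets sets_pair_measure_cong)
  then have F'': "F \<in> borel_measurable (distr P path_sigma (stop_path s) \<Otimes>\<^sub>M W)"
    by (simp cong: measurable_cong_sets sets_pair_measure_cong)
  have "(\<integral>w. F (stop_path s w, shift_path s w) \<partial>P)
      = (\<integral>z. F z \<partial>distr P (path_sigma \<Otimes>\<^sub>M path_sigma) (\<lambda>w. (stop_path s w, shift_path s w)))"
    by (rule integral_distr[OF measurable_Pair[OF m1 m2] F, symmetric])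
  also have "\<dots> = (\<integral>w. \<integral>v. F (w, v) \<partial>W \<partial>distr P path_sigma (stop_path s))"
    unfolding weak_markov[OF P W s, symmetric]
    by (rule integral_fst'[symmetric]) (rule SW.integrable_const_bound[where B=K], use bdd F'' in auto)
  also have "\<dots> = (\<integral>w. \<integral>v. F (stop_path s w, v) \<partial>W \<partial>P)"
    by (rule integral_distr[OF m1]) (use F' in measurable)
  finally show ?thesis .
qed

lemma glue_stop: "0 \<le> s \<Longrightarrow> glue s (stop_path s w) v = glue s w v"
  unfolding glue_def stop_path_def by (auto simp: fun_eq_iff)

text \<open>Whether the k-th grid point is the first one above z is decided by the past, so this
  indicator stays with the past in the Markov property.\<close>

lemma first_cross_stop:
  assumes "0 \<le> t" shows "first_cross z t n k (stop_path (grid t n k) w) = first_cross z t n k w"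
proof -
  have "stop_path (grid t n k) w (grid t n i) = w (grid t n i)" if "i \<le> k" for i
    using grid_nonneg[OF assms, of n i] grid_mono[OF assms that, of n] by (simp add: stop_path_def)
  then show ?thesis unfolding first_cross_def by simp
qed

lemma first_cross_measurable:
  assumes t: "0 \<le> t" shows "Measurable.pred path_sigma (first_cross z t n k)"
proof -
  have [measurable]: "(\<lambda>w. w (grid t n i)) \<in> borel_measurable path_sigma" for i
    by (rule coord_measurable_path_sigma[OF grid_nonneg[OF t]])
  show ?thesis unfolding first_cross_def by measurable
qed

lemma crossed_measurable:
  assumes t: "0 \<le> t" shows "Measurable.pred path_sigma (crossed z t n)"
proof -
  have [measurable]: "(\<lambda>w. w (grid t n i)) \<in> borel_measurable path_sigma" for i
    by (rule coord_measurable_path_sigma[OF grid_nonneg[OF t]])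
  show ?thesis unfolding crossed_def by measurable
qed

lemma cross_time_measurable:
  assumes t: "0 \<le> t" shows "cross_time z t n \<in> borel_measurable path_sigma"
proof -
  have [measurable]: "(\<lambda>w. w (grid t n i)) \<in> borel_measurable path_sigma" for i
    by (rule coord_measurable_path_sigma[OF grid_nonneg[OF t]])
  have [measurable]: "(\<lambda>w. LEAST k. z < w (grid t n k)) \<in> measurable path_sigma (count_space UNIV)"
    by measurable
  have "grid t n \<in> measurable (count_space UNIV) borel" by simp
  then show ?thesis unfolding cross_time_def by measurable
qed

lemma cross_time_nonneg: "0 \<le> t \<Longrightarrow> 0 \<le> cross_time z t n w"
  unfolding cross_time_def by (rule grid_nonneg)

lemma crossed_imp_ex: "0 \<le> t \<Longrightarrow> crossed z t n w \<Longrightarrow> \<exists>u\<in>{0..t}. z < w u"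
  using cross_time_bounds by blast

definition reflect :: "real \<Rightarrow> (real \<Rightarrow> real) \<Rightarrow> real \<Rightarrow> real" where
  "reflect s w = glue s w (sub_path 0 (shift_path s w))"

text \<open>The form with min and max needs no case distinction at s, so measurability and limits in
  s follow from evaluation of a continuous path.\<close>

lemma reflect_eval: "0 \<le> s \<Longrightarrow> 0 \<le> u \<Longrightarrow> reflect s w u = w (min u s) + w s - w (max u s)"
  by (cases "u \<le> s") (simp_all add: reflect_def glue_def sub_path_def shift_path_def)

lemma reflect_in_paths: "0 \<le> s \<Longrightarrow> w \<in> paths \<Longrightarrow> reflect s w \<in> paths"
  unfolding reflect_def by (intro glue_in_paths sub_path_in_paths shift_path_in_paths)

lemma reflect_measurable:
  assumes f: "f \<in> borel_measurable path_sigma" "\<And>w. 0 \<le> f w"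
  shows "(\<lambda>w. reflect (f w) w) \<in> measurable path_sigma path_sigma"
proof (rule measurable_path_sigmaI)
  note f(1)[measurable]
  have id: "(\<lambda>w. w) \<in> measurable path_sigma path_sigma" by simp
  show "reflect (f w) w \<in> paths" if "w \<in> space path_sigma" for w
    using that f(2) by (simp add: reflect_in_paths)
  fix u :: real assume u: "0 \<le> u"
  have "(\<lambda>w. w (min u (f w))) \<in> borel_measurable path_sigma"
    by (rule measurable_path_eval[OF id]) (use f(2) u in simp_all)
  moreover have "(\<lambda>w. w (f w)) \<in> borel_measurable path_sigma"
    by (rule measurable_path_eval[OF id]) (use f in simp_all)
  moreover have "(\<lambda>w. w (max u (f w))) \<in> borel_measurable path_sigma"
    by (rule measurable_path_eval[OF id]) (use u in \<open>auto simp: le_max_iff_disj\<close>)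
  ultimately show "(\<lambda>w. reflect (f w) w u) \<in> borel_measurable path_sigma"
    using f(2) u by (simp add: reflect_eval)
qed

lemma integral_if_sum_first_cross:
  fixes f :: "real \<Rightarrow> (real \<Rightarrow> real) \<Rightarrow> real"
  assumes W: "wiener_law x W" and t: "0 \<le> t"
    and f: "\<And>k. f (grid t n k) \<in> borel_measurable path_sigma" "\<And>s w. \<bar>f s w\<bar> \<le> K"
  shows "(\<integral>w. (if crossed z t n w then f (cross_time z t n w) w else 0) \<partial>W) =
    (\<Sum>k\<le>2 ^ n. \<integral>w. (if first_cross z t n k w then f (grid t n k) w else 0) \<partial>W)"
proof -
  interpret prob_space W using wiener_prob[OF W] .
  have "integrable W (\<lambda>w. if first_cross z t n k w then f (grid t n k) w else 0)" for k
  proof (rule integrable_const_bound[where B=K])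
    have "(\<lambda>w. if first_cross z t n k w then f (grid t n k) w else 0) \<in> borel_measurable path_sigma"
      using first_cross_measurable[OF t] f(1) by measurable
    then show "random_variable borel (\<lambda>w. if first_cross z t n k w then f (grid t n k) w else 0)"
      by (simp add: wiener_measurable[OF W])
    have "0 \<le> K" using f(2)[of 0 undefined] by (meson abs_ge_zero order_trans)
    then show "AE w in W. norm (if first_cross z t n k w then f (grid t n k) w else 0) \<le> K"
      using f(2) by auto
  qed
  then have "(\<Sum>k\<le>2 ^ n. \<integral>w. (if first_cross z t n k w then f (grid t n k) w else 0) \<partial>W)
      = (\<integral>w. (\<Sum>k\<le>2 ^ n. if first_cross z t n k w then f (grid t n k) w else 0) \<partial>W)"
    by (rule Bochner_Integration.integral_sum[symmetric])
  then show ?thesis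
    using sum_first_cross[where z=z and t=t and n=n and f="\<lambda>s. f s _"] by simp
qed

text \<open>Given that the first crossing is at a certain grid time, the later increments are
  independent of the past and symmetric, so reversing their sign leaves the integral
  unchanged.\<close>

lemma reflect_cross_integral:
  fixes G :: "_ \<Rightarrow> real"
  assumes W: "wiener_law 0 W" and t: "0 \<le> t" and G: "G \<in> borel_measurable path_sigma" "\<And>w. \<bar>G w\<bar> \<le> K"
  shows "(\<integral>w. (if crossed e t n w then G w else 0) \<partial>W) =
    (\<integral>w. (if crossed e t n w then G (reflect (cross_time e t n w) w) else 0) \<partial>W)"
proof -
  have "(\<integral>w. (if first_cross e t n k w then G w else 0) \<partial>W) =
      (\<integral>w. (if first_cross e t n k w then G (reflect (grid t n k) w) else 0) \<partial>W)" for k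
  proof -
    define s where "s = grid t n k"
    have s: "0 \<le> s" unfolding s_def by (rule grid_nonneg[OF t])
    have fc: "first_cross e t n k (stop_path s w) = first_cross e t n k w" for w
      unfolding s_def by (rule first_cross_stop[OF t])
    let ?F = "\<lambda>z. if first_cross e t n k (fst z) then G (glue s (fst z) (snd z)) else 0"
    let ?F' = "\<lambda>z. if first_cross e t n k (fst z) then G (glue s (fst z) (sub_path 0 (snd z))) else 0"
    have K: "0 \<le> K" using G(2)[of undefined] by (meson abs_ge_zero order_trans)
    have pm: "Measurable.pred (path_sigma \<Otimes>\<^sub>M path_sigma) (\<lambda>z. first_cross e t n k (fst z))"
      by (rule measurable_compose[OF measurable_fst first_cross_measurable[OF t]])
    have g1: "(\<lambda>z. G (glue s (fst z) (snd z))) \<in> borel_measurable (path_sigma \<Otimes>\<^sub>M path_sigma)"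
      by (rule measurable_compose[OF glue_measurable G(1)]) (use s in auto)
    have g2: "(\<lambda>z. G (glue s (fst z) (sub_path 0 (snd z)))) \<in> borel_measurable (path_sigma \<Otimes>\<^sub>M path_sigma)"
      by (rule measurable_compose[OF glue_measurable G(1)])
        (use s measurable_compose[OF measurable_snd sub_path_measurable] in auto)
    have F: "?F \<in> borel_measurable (path_sigma \<Otimes>\<^sub>M path_sigma)" using pm g1 by measurable
    have F': "?F' \<in> borel_measurable (path_sigma \<Otimes>\<^sub>M path_sigma)" using pm g2 by measurable
    have b: "\<bar>?F z\<bar> \<le> K" "\<bar>?F' z\<bar> \<le> K" for z using G(2) K by auto
    have "(\<integral>w. (if first_cross e t n k w then G w else 0) \<partial>W) = (\<integral>w. ?F (stop_path s w, shift_path s w) \<partial>W)"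
      by (rule Bochner_Integration.integral_cong)
        (auto simp: fc glue_stop_shift[OF s] wiener_space[OF W])
    also have "\<dots> = (\<integral>w. \<integral>v. ?F (stop_path s w, v) \<partial>W \<partial>W)"
      by (rule weak_markov_integral[OF W W s F b(1)])
    also have "\<dots> = (\<integral>w. \<integral>v. ?F' (stop_path s w, v) \<partial>W \<partial>W)"
    proof (rule Bochner_Integration.integral_cong[OF refl])
      fix w assume "w \<in> space W"
      then have "stop_path s w \<in> space path_sigma" using stop_path_in_paths[OF s] wiener_space[OF W] by simp
      note F1 = measurable_Pair2[OF F this]
      show "(\<integral>v. ?F (stop_path s w, v) \<partial>W) = (\<integral>v. ?F' (stop_path s w, v) \<partial>W)"
        using wiener_integral_uminus[OF W F1] unfolding fst_conv snd_conv .
    qed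
    also have "\<dots> = (\<integral>w. ?F' (stop_path s w, shift_path s w) \<partial>W)"
      by (rule weak_markov_integral[OF W W s F' b(2), symmetric])
    also have "\<dots> = (\<integral>w. (if first_cross e t n k w then G (reflect s w) else 0) \<partial>W)"
      unfolding fc fst_conv snd_conv glue_stop[OF s] reflect_def ..
    finally show ?thesis unfolding s_def .
  qed
  moreover have "(\<lambda>w. G (reflect (grid t n k) w)) \<in> borel_measurable path_sigma" for k
    by (rule measurable_compose[OF reflect_measurable G(1)]) (use grid_nonneg[OF t] in auto)
  ultimately show ?thesis
    using integral_if_sum_first_cross[OF W t, where f="\<lambda>_. G" and K=K]
      integral_if_sum_first_cross[OF W t, where f="\<lambda>s w. G (reflect s w)" and K=K] G by simp
qed

text \<open>Reflecting at the first grid time above the level leaves Wiener measure invariant; letting the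
  grid become dense replaces this time by the hitting time of the level itself.\<close>

lemma reflection_integral_zero:
  fixes G :: "_ \<Rightarrow> real"
  assumes W: "wiener_law 0 W" and t: "0 \<le> t" and e: "0 \<le> e"
    and G: "G \<in> borel_measurable path_sigma" "\<And>w. \<bar>G w\<bar> \<le> K"
    and cont: "\<And>v w. (\<And>u. 0 \<le> u \<Longrightarrow> (\<lambda>n. v n u) \<longlonglongrightarrow> w u) \<Longrightarrow> (\<lambda>n. G (v n)) \<longlonglongrightarrow> G w"
    and anti: "\<And>s w. s \<in> {0..t} \<Longrightarrow> w s = e \<Longrightarrow> G (reflect s w) = - G w"
  shows "(\<integral>w. (if \<exists>u\<in>{0..t}. e < w u then G w else 0) \<partial>W) = 0"
proof -
  interpret prob_space W using wiener_prob[OF W] .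
  let ?A = "\<lambda>w. \<exists>u\<in>{0..t}. e < w u"
  have K: "0 \<le> K" using G(2)[of undefined] by (meson abs_ge_zero order_trans)
  have "(\<lambda>w. w) \<in> measurable path_sigma path_sigma" by simp
  from measurable_path_le_on[OF this, of "\<lambda>_. e" "\<lambda>_. 0" "\<lambda>_. t"]
  have "Measurable.pred path_sigma (\<lambda>w. \<forall>u\<in>{0..t}. w u \<le> e)" using t by simp
  then have "Measurable.pred path_sigma (\<lambda>w. \<not> (\<forall>u\<in>{0..t}. w u \<le> e))" by measurable
  then have Am: "Measurable.pred path_sigma ?A" by (simp add: not_le)
  have m1: "(\<lambda>w. if crossed e t n w then G w else 0) \<in> borel_measurable W" for n
  proof -
    have "(\<lambda>w. if crossed e t n w then G w else 0) \<in> borel_measurable path_sigma"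
      using crossed_measurable[OF t] G(1) by measurable
    then show ?thesis by (simp add: wiener_measurable[OF W])
  qed
  have m2: "(\<lambda>w. if crossed e t n w then G (reflect (cross_time e t n w) w) else 0) \<in> borel_measurable W" for n
  proof -
    have [measurable]: "(\<lambda>w. G (reflect (cross_time e t n w) w)) \<in> borel_measurable path_sigma"
      by (rule measurable_compose[OF reflect_measurable G(1)])
        (use cross_time_measurable[OF t] cross_time_nonneg[OF t] in auto)
    have "(\<lambda>w. if crossed e t n w then G (reflect (cross_time e t n w) w) else 0) \<in> borel_measurable path_sigma"
      using crossed_measurable[OF t] by measurable
    then show ?thesis by (simp add: wiener_measurable[OF W])
  qed
  have m3: "(\<lambda>w. if ?A w then G w else 0) \<in> borel_measurable W"
  proof -
    have "(\<lambda>w. if ?A w then G w else 0) \<in> borel_measurable path_sigma" using Am G(1) by measurable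
    then show ?thesis by (simp add: wiener_measurable[OF W])
  qed
  have l1: "(\<lambda>n. \<integral>w. (if crossed e t n w then G w else 0) \<partial>W) \<longlonglongrightarrow> (\<integral>w. (if ?A w then G w else 0) \<partial>W)"
  proof (rule integral_dominated_convergence[OF m3 m1, where w="\<lambda>_. K"])
    show "AE w in W. (\<lambda>n. if crossed e t n w then G w else 0) \<longlonglongrightarrow> (if ?A w then G w else 0)"
      using wiener_start[OF W] AE_space
    proof eventually_elim
      case (elim w)
      show ?case
      proof (cases "?A w")
        case True
        then obtain s where "\<forall>\<^sub>F n in sequentially. crossed e t n w"
          using cross_time_tendsto[of w e t] elim e wiener_space[OF W] by auto
        then have "\<forall>\<^sub>F n in sequentially. (if crossed e t n w then G w else 0) = G w"
          by eventually_elim simp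
        then show ?thesis using True by (simp add: tendsto_eventually)
      next
        case False
        then have "\<not> crossed e t n w" for n using crossed_imp_ex[OF t] by blast
        then show ?thesis using False by simp
      qed
    qed
    show "AE w in W. norm (if crossed e t n w then G w else 0) \<le> K" for n using G(2) K by auto
  qed simp
  \<comment> \<open>In the limit the reflection takes place at the passage time s, where the path
    sits exactly at e; this is where \<open>anti\<close> applies.\<close>
  have l2: "(\<lambda>n. \<integral>w. (if crossed e t n w then G (reflect (cross_time e t n w) w) else 0) \<partial>W)
      \<longlonglongrightarrow> (\<integral>w. - (if ?A w then G w else 0) \<partial>W)"
  proof (rule integral_dominated_convergence[OF borel_measurable_uminus[OF m3] m2, where w="\<lambda>_. K"])
    show "AE w in W. (\<lambda>n. if crossed e t n w then G (reflect (cross_time e t n w) w) else 0)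
        \<longlonglongrightarrow> - (if ?A w then G w else 0)"
      using wiener_start[OF W] AE_space
    proof eventually_elim
      case (elim w)
      then have w: "w \<in> paths" using wiener_space[OF W] by simp
      show ?case
      proof (cases "?A w")
        case True
        have "w 0 \<le> e" using elim e by simp
        from cross_time_tendsto[OF w this True]
        obtain s where s: "s \<in> {0..t}" "w s = e" "\<forall>\<^sub>F n in sequentially. crossed e t n w"
          "(\<lambda>n. cross_time e t n w) \<longlonglongrightarrow> s"
          by metis
        have "(\<lambda>n. reflect (cross_time e t n w) w u) \<longlonglongrightarrow> reflect s w u" if u: "0 \<le> u" for u
        proof -
          have s0: "0 \<le> s" using s by simp
          note c0 = cross_time_nonneg[OF t, of e _ w]
          have "(\<lambda>n. w (min u (cross_time e t n w))) \<longlonglongrightarrow> w (min u s)"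
            by (rule paths_tendsto[OF w]) (use s c0 u in \<open>auto intro!: tendsto_intros\<close>)
          moreover have "(\<lambda>n. w (cross_time e t n w)) \<longlonglongrightarrow> w s"
            by (rule paths_tendsto[OF w s(4) c0 s0])
          moreover have "(\<lambda>n. w (max u (cross_time e t n w))) \<longlonglongrightarrow> w (max u s)"
            by (rule paths_tendsto[OF w]) (use s c0 u in \<open>auto intro!: tendsto_intros simp: le_max_iff_disj\<close>)
          ultimately show ?thesis
            unfolding reflect_eval[OF c0 u] reflect_eval[OF s0 u] by (intro tendsto_intros)
        qed
        then have "(\<lambda>n. G (reflect (cross_time e t n w) w)) \<longlonglongrightarrow> G (reflect s w)" by (rule cont)
        then have "(\<lambda>n. G (reflect (cross_time e t n w) w)) \<longlonglongrightarrow> - G w" using anti[where s=s and w=w, OF s(1,2)] by simp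
        moreover have "\<forall>\<^sub>F n in sequentially. G (reflect (cross_time e t n w) w) =
            (if crossed e t n w then G (reflect (cross_time e t n w) w) else 0)"
          using s(3) by eventually_elim simp
        ultimately show ?thesis using True by (simp add: Lim_transform_eventually)
      next
        case False
        then have "\<not> crossed e t n w" for n using crossed_imp_ex[OF t] by blast
        then show ?thesis using False by simp
      qed
    qed
    show "AE w in W. norm (if crossed e t n w then G (reflect (cross_time e t n w) w) else 0) \<le> K" for n
      using G(2) K by auto
  qed simp
  \<comment> \<open>One sequence of integrals converges both to the integral and to its
    negative.\<close>
  have "(\<integral>w. (if ?A w then G w else 0) \<partial>W) = (\<integral>w. - (if ?A w then G w else 0) \<partial>W)"
    by (rule LIMSEQ_unique[OF l1]) (simp only: reflect_cross_integral[OF W t G] l2)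
  then show ?thesis by simp
qed

text \<open>Reflection at level e reverses the sign of e - w after the passage: the squares in the
  test functions do not change, the endpoint weight does. Paths exceeding e therefore cancel, and a
  nonnegative weight on the killed paths remains.\<close>

lemma bes_cylinder_killed:
  assumes W: "wiener_law 0 W" and e: "0 < e" and J: "finite J" "J \<subseteq> {0..t}" "t \<in> J" "0 \<in> J"
    and h: "\<And>j. continuous_on UNIV (h j)" and h01: "\<And>j v. h j v \<in> {0..1}"
  shows "(\<integral>z. exp (- (bes e z t)\<^sup>2) * (\<Prod>j\<in>J. h j (exp (- (bes e z j)\<^sup>2))) \<partial>triple W) =
    (\<integral>w. (if \<forall>u\<in>{0..t}. w u \<le> e
       then exp (- (e - w t)\<^sup>2) * (e - w t) / e * (\<Prod>j\<in>J. h j (exp (- (e - w j)\<^sup>2))) else 0) \<partial>W)"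
proof -
  interpret prob_space W using wiener_prob[OF W] .
  have t: "0 \<le> t" using J by auto
  define G where "G = (\<lambda>w. exp (- (e - w t)\<^sup>2) * (e - w t) / e * (\<Prod>j\<in>J. h j (exp (- (e - w j)\<^sup>2))))"
  have j0: "0 \<le> j" if "j \<in> J" for j using that J(2) by auto
  have cm: "(\<lambda>w. w j) \<in> borel_measurable path_sigma" if "j \<in> J" for j
    by (rule coord_measurable_path_sigma[OF j0[OF that]])
  have hm[measurable]: "h j \<in> borel_measurable borel" for j by (rule borel_measurable_continuous_onI[OF h])
  have Gm: "G \<in> borel_measurable path_sigma" unfolding G_def using cm cm[OF J(3)] by measurable
  have Gb: "\<bar>G w\<bar> \<le> 2 / e" for w
  proof -
    have "\<bar>exp (- (e - w t)\<^sup>2) * (e - w t)\<bar> \<le> 2" using abs_times_exp_le[of 1 "e - w t"] by simp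
    moreover have "\<bar>\<Prod>j\<in>J. h j (exp (- (e - w j)\<^sup>2))\<bar> \<le> 1"
      using h01 by (auto simp: abs_prod intro!: prod_le_1)
    ultimately have "\<bar>exp (- (e - w t)\<^sup>2) * (e - w t)\<bar> * \<bar>\<Prod>j\<in>J. h j (exp (- (e - w j)\<^sup>2))\<bar> \<le> 2 * 1"
      by (intro mult_mono) auto
    then have "\<bar>exp (- (e - w t)\<^sup>2) * (e - w t)\<bar> * \<bar>\<Prod>j\<in>J. h j (exp (- (e - w j)\<^sup>2))\<bar> / e \<le> 2 / e"
      using e by (intro divide_right_mono) auto
    then show ?thesis unfolding G_def using e by (simp add: abs_mult)
  qed
  have zero: "(\<integral>w. (if \<exists>u\<in>{0..t}. e < w u then G w else 0) \<partial>W) = 0"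
  proof (rule reflection_integral_zero[OF W t _ Gm Gb])
    fix v :: "nat \<Rightarrow> real \<Rightarrow> real" and w assume lim: "\<And>u. 0 \<le> u \<Longrightarrow> (\<lambda>n. v n u) \<longlonglongrightarrow> w u"
    \<comment> \<open>Finitely many coordinates enter, so pointwise convergence of paths is
      enough.\<close>
    have "(\<lambda>n. h j (exp (- (e - v n j)\<^sup>2))) \<longlonglongrightarrow> h j (exp (- (e - w j)\<^sup>2))" if "j \<in> J" for j
    proof -
      have "isCont (h j) (exp (- (e - w j)\<^sup>2))" using h[of j] by (simp add: continuous_on_eq_continuous_at)
      then show ?thesis by (rule isCont_tendsto_compose) (intro tendsto_intros lim j0 that)
    qed
    then show "(\<lambda>n. G (v n)) \<longlonglongrightarrow> G w"
      unfolding G_def using e by (intro tendsto_intros lim t) auto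
  next
    fix s w assume s: "s \<in> {0..t}" "w s = e"
    have r: "reflect s w u = (if u \<le> s then w u else 2 * e - w u)" if "0 \<le> u" for u
      using s that by (simp add: reflect_eval)
    have sq: "(e - reflect s w u)\<^sup>2 = (e - w u)\<^sup>2" if "0 \<le> u" for u
    proof (cases "u \<le> s")
      case False
      then have "e - reflect s w u = - (e - w u)" using r[OF that] by simp
      then show ?thesis by (simp only: power2_minus)
    qed (use r[OF that] in simp)
    \<comment> \<open>If t = s the endpoint weight is 0, so the sign change holds there too.\<close>
    have neg: "e - reflect s w t = - (e - w t)" using r[OF t] s by (cases "t = s") auto
    have "(\<Prod>j\<in>J. h j (exp (- (e - reflect s w j)\<^sup>2))) = (\<Prod>j\<in>J. h j (exp (- (e - w j)\<^sup>2)))"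
      by (intro prod.cong refl) (simp only: sq j0)
    then show "G (reflect s w) = - G w"
      by (simp only: G_def neg power2_minus mult_minus_right mult_minus_left divide_minus_left)
  qed (use e in simp)
  have id: "(\<lambda>w. w) \<in> measurable path_sigma path_sigma" by simp
  from measurable_path_le_on[OF this, of "\<lambda>_. e" "\<lambda>_. 0" "\<lambda>_. t"]
  have Am: "Measurable.pred path_sigma (\<lambda>w. \<forall>u\<in>{0..t}. w u \<le> e)" using t by simp
  have i1: "integrable W (\<lambda>w. if \<forall>u\<in>{0..t}. w u \<le> e then G w else 0)"
  proof (rule integrable_const_bound[where B="2 / e"])
    have "(\<lambda>w. if \<forall>u\<in>{0..t}. w u \<le> e then G w else 0) \<in> borel_measurable path_sigma"
      using Am Gm by measurable
    then show "random_variable borel (\<lambda>w. if \<forall>u\<in>{0..t}. w u \<le> e then G w else 0)"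
      by (simp add: wiener_measurable[OF W])
  qed (use Gb e in auto)
  have i2: "integrable W (\<lambda>w. if \<exists>u\<in>{0..t}. e < w u then G w else 0)"
  proof (rule integrable_const_bound[where B="2 / e"])
    have "(\<lambda>w. if \<not> (\<forall>u\<in>{0..t}. w u \<le> e) then G w else 0) \<in> borel_measurable path_sigma"
      using Am Gm by measurable
    then show "random_variable borel (\<lambda>w. if \<exists>u\<in>{0..t}. e < w u then G w else 0)"
      by (simp add: wiener_measurable[OF W] not_le)
  qed (use Gb e in auto)
  have "(\<integral>w. G w \<partial>W) = (\<integral>w. (if \<forall>u\<in>{0..t}. w u \<le> e then G w else 0) + (if \<exists>u\<in>{0..t}. e < w u then G w else 0) \<partial>W)"
    by (rule Bochner_Integration.integral_cong) (auto simp: not_le[symmetric])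
  also have "\<dots> = (\<integral>w. (if \<forall>u\<in>{0..t}. w u \<le> e then G w else 0) \<partial>W)"
    using Bochner_Integration.integral_add[OF i1 i2] zero by simp
  finally show ?thesis
    using bes_cylinder_integral[OF W e J h] unfolding G_def by simp
qed

text \<open>The substitution v = exp(- r^2), r = sqrt(- ln v), turns a test function of the radius
  into one of a variable in (0, 1], where the moment method works. Bounded support makes the
  extension by 0 to v <= 0 continuous.\<close>

lemma continuous_on_log_profile:
  fixes f :: "real \<Rightarrow> real"
  assumes f: "continuous_on UNIV f" and K: "\<And>u. K < \<bar>u\<bar> \<Longrightarrow> f u = 0"
  shows "continuous_on UNIV (\<lambda>v. if v \<le> 0 then 0 else f (sqrt (- ln (min v 1))))"
proof -
  let ?h = "\<lambda>v. if v \<le> 0 then 0 else f (sqrt (- ln (min v 1)))"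
  \<comment> \<open>For v below this bound, sqrt(- ln v) exceeds the absolute value of K; the added
    1 also keeps the bound below 1 when K = 0, so that \<open>min v 1\<close> is v.\<close>
  let ?b = "exp (- (K\<^sup>2 + 1))"
  have "continuous_on {0<..} (\<lambda>v::real. f (sqrt (- ln (min v 1))))"
    by (rule continuous_on_compose2[OF f]) (auto intro!: continuous_intros)
  then have c1: "continuous_on {0<..} ?h"
    by (rule continuous_on_cong[THEN iffD1, rotated 2]) auto
  have "?h v = 0" if "v < ?b" for v
  proof (cases "v \<le> 0")
    case False
    have "?b < exp 0" by (subst exp_less_cancel_iff) (use zero_le_power2[of K] in linarith)
    then have b1: "?b < 1" by simp
    have "ln v < ln ?b" using that False by (subst ln_less_cancel_iff) auto
    moreover have "min v 1 = v" using that b1 by linarith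
    ultimately have "K\<^sup>2 + 1 < - ln (min v 1)" by simp
    then have "sqrt (K\<^sup>2) < sqrt (- ln (min v 1))" by (intro real_sqrt_less_mono) linarith
    then have "K < \<bar>sqrt (- ln (min v 1))\<bar>" unfolding real_sqrt_abs by linarith
    from K[OF this] show ?thesis by (simp only: if_cancel)
  qed simp
  then have c2: "continuous_on {..<?b} ?h"
    by (intro continuous_on_cong[THEN iffD1, OF refl _ continuous_on_const[of _ 0]]) auto
  have "continuous_on ({0<..} \<union> {..<?b}) ?h"
    by (rule continuous_on_open_Un[OF _ _ c1 c2]) auto
  moreover have "{0<..} \<union> {..<?b} = UNIV"
    using exp_gt_zero[of "- (K\<^sup>2 + 1)"] by (auto simp: not_less intro: le_less_trans)
  ultimately show ?thesis by simp
qed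

lemma triple_prob: "prob_space W \<Longrightarrow> prob_space (triple W)"
  by (intro prob_space_pair)

lemma bes_measurable_filt:
  "sets W = sets path_sigma \<Longrightarrow> bes e \<in> measurable (triple W) (path_filt t)"
proof -
  assume W: "sets W = sets path_sigma"
  have "(\<lambda>w. w) \<in> measurable path_sigma (path_filt t)"
    by (rule measurable_path_filtI) (auto intro: coord_measurable_path_sigma)
  from measurable_compose[OF bes_measurable[OF W] this] show ?thesis by simp
qed

text \<open>This is the h-transform with h(y) = y: up to time t the Bessel process from e is
  Brownian motion from e, killed below 0 and weighted by endpoint over e. The laws are compared
  after damping both by exp(- r^2) at time t, which makes the weight bounded; the damping is undone
  at the end.\<close>

theorem bes_absolutely_continuous:
  assumes W: "wiener_law 0 W" and e: "0 < e" and t: "0 \<le> t" and F: "F \<in> borel_measurable (path_filt t)"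
  shows "(\<integral>\<^sup>+z. F (bes e z) \<partial>triple W) =
    (\<integral>\<^sup>+w. F (sub_path e w) * (if \<forall>u\<in>{0..t}. w u \<le> e then ennreal ((e - w t) / e) else 0) \<partial>W)"
proof -
  interpret W: prob_space W using wiener_prob[OF W] .
  interpret T: prob_space "triple W" by (rule triple_prob) unfold_locales
  note setsW = wiener_sets[OF W]
  define g where "g = (\<lambda>w. if \<forall>u\<in>{0..t}. w u \<le> e then exp (- (e - w t)\<^sup>2) * (e - w t) / e else 0 :: real)"
  define N1 where "N1 = distr (density (triple W) (\<lambda>z. ennreal (exp (- (bes e z t)\<^sup>2)))) (path_filt t) (bes e)"
  define N2 where "N2 = distr (density W (\<lambda>w. ennreal (g w))) (path_filt t) (sub_path e)"
  have ct[measurable]: "(\<lambda>w. w t) \<in> borel_measurable path_sigma" by (rule coord_measurable_path_sigma[OF t])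
  have bm: "bes e \<in> measurable (triple W) (path_filt t)" by (rule bes_measurable_filt[OF setsW])
  have bt: "(\<lambda>z. bes e z j) \<in> borel_measurable (triple W)" if "0 \<le> j" for j
    by (rule measurable_compose[OF bes_measurable[OF setsW] coord_measurable_path_sigma[OF that]])
  note [measurable] = bt[OF t]
  have sm: "sub_path e \<in> measurable W (path_filt t)"
  proof -
    have "(\<lambda>w. w) \<in> measurable path_sigma (path_filt t)"
      by (rule measurable_path_filtI) (auto intro: coord_measurable_path_sigma)
    from measurable_compose[OF sub_path_measurable this] show ?thesis by (simp add: wiener_measurable[OF W])
  qed
  have id: "(\<lambda>w. w) \<in> measurable path_sigma path_sigma" by simp
  from measurable_path_le_on[OF this, of "\<lambda>_. e" "\<lambda>_. 0" "\<lambda>_. t"]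
  have [measurable]: "Measurable.pred path_sigma (\<lambda>w. \<forall>u\<in>{0..t}. w u \<le> e)" using t by simp
  have "g \<in> borel_measurable path_sigma" unfolding g_def by measurable
  then have gm[measurable]: "g \<in> borel_measurable W" by (simp add: wiener_measurable[OF W])
  have g0: "0 \<le> g w" for w unfolding g_def using e t by auto
  have gb: "g w \<le> 2 / e" for w
  proof -
    have "\<bar>exp (- (e - w t)\<^sup>2) * (e - w t)\<bar> \<le> 2" using abs_times_exp_le[of 1 "e - w t"] by simp
    then have "exp (- (e - w t)\<^sup>2) * (e - w t) / e \<le> 2 / e" using e by (intro divide_right_mono) auto
    then show ?thesis unfolding g_def using e by auto
  qed
  have nn1: "(\<integral>\<^sup>+w. H w \<partial>N1) = (\<integral>\<^sup>+z. ennreal (exp (- (bes e z t)\<^sup>2)) * H (bes e z) \<partial>triple W)"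
    if H: "H \<in> borel_measurable (path_filt t)" for H
    unfolding N1_def using bm H measurable_compose[OF bm H]
    by (subst nn_integral_distr) (simp_all add: nn_integral_density)
  have nn2: "(\<integral>\<^sup>+w. H w \<partial>N2) = (\<integral>\<^sup>+w. ennreal (g w) * H (sub_path e w) \<partial>W)"
    if H: "H \<in> borel_measurable (path_filt t)" for H
    unfolding N2_def using sm H measurable_compose[OF sm H]
    by (subst nn_integral_distr) (simp_all add: nn_integral_density)
  have "N1 = N2"
  proof (rule coord_algebra_eqI[where I="{0..t}" and t=t])
    show "t \<in> {0..t}" using t by simp
    show "sets N1 = sets (coord_algebra {0..t})" "sets N2 = sets (coord_algebra {0..t})"
      unfolding N1_def N2_def by (simp_all add: path_filt_def)
    show "finite_measure N1"
    proof (rule finite_measureI)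
      have "emeasure N1 (space N1) = (\<integral>\<^sup>+w. 1 \<partial>N1)" by simp
      also have "\<dots> = (\<integral>\<^sup>+z. ennreal (exp (- (bes e z t)\<^sup>2)) * 1 \<partial>triple W)" by (rule nn1) simp
      also have "\<dots> \<le> (\<integral>\<^sup>+z. 1 \<partial>triple W)" by (intro nn_integral_mono) simp
      also have "\<dots> < \<infinity>" by (simp add: T.emeasure_space_1)
      finally show "emeasure N1 (space N1) \<noteq> \<infinity>" by simp
    qed
    fix J and f :: "real \<Rightarrow> real \<Rightarrow> real"
    assume J: "finite J" "J \<subseteq> {0..t}" "t \<in> J" and f: "\<And>j. continuous_on UNIV (f j)" "\<And>j u. f j u \<in> {0..1}"
      and fK: "\<And>j. \<exists>K. \<forall>u. K < \<bar>u\<bar> \<longrightarrow> f j u = 0"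
    have j0: "0 \<le> j" "j \<le> t" if "j \<in> J" for j using that J(2) by auto
    \<comment> \<open>The value 1 outside \<open>J\<close> lets time 0, which
      \<open>bes_cylinder_killed\<close> wants in the index set, be inserted without changing the
      product.\<close>
    define h where "h = (\<lambda>j v. if j \<in> J then if v \<le> 0 then 0 else f j (sqrt (- ln (min v 1))) else 1)"
    have hc: "continuous_on UNIV (h j)" for j
    proof (cases "j \<in> J")
      case True
      obtain K where "\<And>u. K < \<bar>u\<bar> \<Longrightarrow> f j u = 0" using fK[of j] by auto
      from continuous_on_log_profile[OF f(1) this] show ?thesis using True unfolding h_def by simp
    qed (simp add: h_def)
    have h01: "h j v \<in> {0..1}" for j v using f(2) unfolding h_def by auto
    have hf: "h j (exp (- r\<^sup>2)) = f j r" if "j \<in> J" "0 \<le> r" for j r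
      using that by (simp add: h_def min_def)
    have hp: "(\<Prod>j\<in>insert 0 J. h j (exp (- (r j)\<^sup>2))) = (\<Prod>j\<in>J. f j (r j))"
      if "\<And>j. j \<in> J \<Longrightarrow> 0 \<le> r j" for r
    proof -
      have "(\<Prod>j\<in>insert 0 J. h j (exp (- (r j)\<^sup>2))) = (\<Prod>j\<in>J. h j (exp (- (r j)\<^sup>2)))"
        using J(1) by (rule prod.mono_neutral_right[OF finite_insert[THEN iffD2]]) (auto simp: h_def)
      also have "\<dots> = (\<Prod>j\<in>J. f j (r j))" by (rule prod.cong[OF refl]) (simp add: hf that)
      finally show ?thesis .
    qed
    have fm[measurable]: "f j \<in> borel_measurable borel" for j by (rule borel_measurable_continuous_onI[OF f(1)])
    have p01: "(\<Prod>j\<in>J. f j (r j)) \<in> {0..1}" for r using f(2) by (auto intro!: prod_nonneg prod_le_1)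
    have Hm: "(\<lambda>w. (\<Prod>j\<in>J. f j (w j))) \<in> borel_measurable (path_filt t)"
      using coord_measurable_filt[OF j0] by (intro borel_measurable_prod measurable_compose[OF _ fm])
    have "(\<integral>\<^sup>+w. ennreal (\<Prod>j\<in>J. f j (w j)) \<partial>N1)
        = (\<integral>\<^sup>+z. ennreal (exp (- (bes e z t)\<^sup>2) * (\<Prod>j\<in>J. f j (bes e z j))) \<partial>triple W)"
      using p01 Hm by (subst nn1) (simp_all add: ennreal_mult)
    also have "\<dots> = ennreal (\<integral>z. exp (- (bes e z t)\<^sup>2) * (\<Prod>j\<in>J. f j (bes e z j)) \<partial>triple W)"
    proof (rule nn_integral_eq_integral)
      show "integrable (triple W) (\<lambda>z. exp (- (bes e z t)\<^sup>2) * (\<Prod>j\<in>J. f j (bes e z j)))"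
      proof (rule T.integrable_const_bound[where B="1 * 1"])
        have "\<bar>exp (- (bes e z t)\<^sup>2) * (\<Prod>j\<in>J. f j (bes e z j))\<bar> \<le> 1 * 1" for z
          unfolding abs_mult using p01[of "bes e z"] by (intro mult_mono) auto
        then show "AE z in triple W. norm (exp (- (bes e z t)\<^sup>2) * (\<Prod>j\<in>J. f j (bes e z j))) \<le> 1 * 1" by simp
        show "(\<lambda>z. exp (- (bes e z t)\<^sup>2) * (\<Prod>j\<in>J. f j (bes e z j))) \<in> borel_measurable (triple W)"
          using measurable_compose[OF bm Hm] by measurable
      qed
    qed (use p01 in auto)
    also have "(\<integral>z. exp (- (bes e z t)\<^sup>2) * (\<Prod>j\<in>J. f j (bes e z j)) \<partial>triple W)
        = (\<integral>z. exp (- (bes e z t)\<^sup>2) * (\<Prod>j\<in>insert 0 J. h j (exp (- (bes e z j)\<^sup>2))) \<partial>triple W)"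
      by (rule Bochner_Integration.integral_cong[OF refl]) (simp only: hp[OF bes_nonneg[OF j0(1)]])
    also have "\<dots> = (\<integral>w. (if \<forall>u\<in>{0..t}. w u \<le> e
       then exp (- (e - w t)\<^sup>2) * (e - w t) / e * (\<Prod>j\<in>insert 0 J. h j (exp (- (e - w j)\<^sup>2))) else 0) \<partial>W)"
      by (rule bes_cylinder_killed[OF W e]) (use J t hc h01 in auto)
    also have "\<dots> = (\<integral>w. g w * (\<Prod>j\<in>J. f j (sub_path e w j)) \<partial>W)"
    proof (rule Bochner_Integration.integral_cong[OF refl])
      fix w
      show "(if \<forall>u\<in>{0..t}. w u \<le> e
       then exp (- (e - w t)\<^sup>2) * (e - w t) / e * (\<Prod>j\<in>insert 0 J. h j (exp (- (e - w j)\<^sup>2))) else 0)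
         = g w * (\<Prod>j\<in>J. f j (sub_path e w j))"
      proof (cases "\<forall>u\<in>{0..t}. w u \<le> e")
        case True
        then have "(\<Prod>j\<in>insert 0 J. h j (exp (- (e - w j)\<^sup>2))) = (\<Prod>j\<in>J. f j (e - w j))"
          using j0 by (intro hp) auto
        also have "\<dots> = (\<Prod>j\<in>J. f j (sub_path e w j))"
          using j0 by (intro prod.cong refl) (simp add: sub_path_def)
        finally show ?thesis using True by (simp add: g_def)
      next
        case False
        then show ?thesis by (simp only: g_def False if_False mult_zero_left)
      qed
    qed
    also have "ennreal \<dots> = (\<integral>\<^sup>+w. ennreal (g w * (\<Prod>j\<in>J. f j (sub_path e w j))) \<partial>W)"
    proof (rule nn_integral_eq_integral[symmetric])
      show "integrable W (\<lambda>w. g w * (\<Prod>j\<in>J. f j (sub_path e w j)))"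
      proof (rule W.integrable_const_bound[where B="2 / e * 1"])
        have "\<bar>g w * (\<Prod>j\<in>J. f j (sub_path e w j))\<bar> \<le> 2 / e * 1" for w
          unfolding abs_mult using p01[of "sub_path e w"] g0[of w] gb[of w] e by (intro mult_mono) auto
        then show "AE w in W. norm (g w * (\<Prod>j\<in>J. f j (sub_path e w j))) \<le> 2 / e * 1" by simp
        show "(\<lambda>w. g w * (\<Prod>j\<in>J. f j (sub_path e w j))) \<in> borel_measurable W"
          using measurable_compose[OF sm Hm] by measurable
      qed
    qed (use p01 g0 in auto)
    also have "\<dots> = (\<integral>\<^sup>+w. ennreal (\<Prod>j\<in>J. f j (w j)) \<partial>N2)"
      using p01 g0 Hm by (subst nn2) (simp_all add: ennreal_mult)
    finally show "(\<integral>\<^sup>+w. ennreal (\<Prod>j\<in>J. f j (w j)) \<partial>N1) = (\<integral>\<^sup>+w. ennreal (\<Prod>j\<in>J. f j (w j)) \<partial>N2)" .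
  qed
  note N12 = this
  have ctf: "(\<lambda>w. w t) \<in> borel_measurable (path_filt t)" using t by (intro coord_measurable_filt) auto
  \<comment> \<open>The inverse of the damping factor is put into the functional itself.\<close>
  have Em: "(\<lambda>w. ennreal (exp ((w t)\<^sup>2)) * F w) \<in> borel_measurable (path_filt t)"
    using ctf F by measurable
  have ee: "ennreal (exp (- r\<^sup>2)) * (ennreal (exp (r\<^sup>2)) * y) = y" for r y
    by (simp add: mult.assoc[symmetric] ennreal_mult[symmetric] exp_add[symmetric])
  have "(\<integral>\<^sup>+z. F (bes e z) \<partial>triple W) = (\<integral>\<^sup>+w. ennreal (exp ((w t)\<^sup>2)) * F w \<partial>N1)"
    unfolding nn1[OF Em] ee ..
  also have "\<dots> = (\<integral>\<^sup>+w. ennreal (g w) * (ennreal (exp ((sub_path e w t)\<^sup>2)) * F (sub_path e w)) \<partial>W)"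
    unfolding N12 by (rule nn2[OF Em])
  also have "\<dots> = (\<integral>\<^sup>+w. F (sub_path e w) * (if \<forall>u\<in>{0..t}. w u \<le> e then ennreal ((e - w t) / e) else 0) \<partial>W)"
  proof (rule nn_integral_cong)
    fix w
    show "ennreal (g w) * (ennreal (exp ((sub_path e w t)\<^sup>2)) * F (sub_path e w))
      = F (sub_path e w) * (if \<forall>u\<in>{0..t}. w u \<le> e then ennreal ((e - w t) / e) else 0)"
    proof (cases "\<forall>u\<in>{0..t}. w u \<le> e")
      case True
      then have "ennreal (g w) = ennreal ((e - w t) / e) * ennreal (exp (- (sub_path e w t)\<^sup>2))"
        using e t by (simp add: g_def sub_path_def ennreal_mult[symmetric] mult.commute)
      then have "ennreal (g w) * (ennreal (exp ((sub_path e w t)\<^sup>2)) * F (sub_path e w))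
          = ennreal ((e - w t) / e) * (ennreal (exp (- (sub_path e w t)\<^sup>2)) * (ennreal (exp ((sub_path e w t)\<^sup>2)) * F (sub_path e w)))"
        by (simp only: mult.assoc)
      also have "\<dots> = F (sub_path e w) * ennreal ((e - w t) / e)"
        unfolding ee by (rule mult.commute)
      finally show ?thesis unfolding if_P[OF True] .
    next
      case False
      then show ?thesis by (simp only: g_def False if_False ennreal_0 mult_zero_left mult_zero_right)
    qed
  qed
  finally show ?thesis .
qed

section \<open>Decomposition at the first passage above a level\<close>

text \<open>Since \<open>glue\<close> recentres, the path after s is w s + e minus the Bessel
  process from e, provided that the driving triple starts at 0 and e >= 0. It leaves from w s and
  never exceeds w s + e.\<close>

abbreviation concat_bes :: "real \<Rightarrow> real \<Rightarrow> (real \<Rightarrow> real) \<Rightarrow> (real \<Rightarrow> real) \<times> (real \<Rightarrow> real) \<times> (real \<Rightarrow> real) \<Rightarrow> real \<Rightarrow> real" where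
  "concat_bes e s w v \<equiv> glue s w (sub_path 0 (bes e v))"

lemma glue_sub_sub: "glue s w (sub_path 0 (sub_path e v)) = glue s w v"
  by (simp add: glue_def sub_path_def fun_eq_iff)

lemma glue_measurable_filt:
  assumes s: "0 \<le> s" "s \<le> t" and w: "w \<in> paths"
  shows "(\<lambda>y. glue s w (sub_path 0 y)) \<in> measurable (path_filt (t - s)) (path_filt t)"
proof (rule measurable_path_filtI)
  show "glue s w (sub_path 0 y) \<in> paths" if "y \<in> space (path_filt (t - s))" for y
    using that s w by (simp add: glue_in_paths sub_path_in_paths)
  fix u assume u: "0 \<le> u" "u \<le> t"
  have "(\<lambda>y. y (max 0 (u - s))) \<in> borel_measurable (path_filt (t - s))"
    by (rule coord_measurable_filt) (use s u in auto)
  moreover have "(\<lambda>y. y 0) \<in> borel_measurable (path_filt (t - s))"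
    by (rule coord_measurable_filt) (use s in auto)
  ultimately show "(\<lambda>y. glue s w (sub_path 0 y) u) \<in> borel_measurable (path_filt (t - s))"
    using u by (simp add: glue_def sub_path_def)
qed

lemma concat_bes_measurable:
  assumes "s \<in> borel_measurable M" "\<And>x. x \<in> space M \<Longrightarrow> 0 \<le> s x"
    and f: "f \<in> measurable M path_sigma" and g: "g \<in> measurable M (triple path_sigma)"
  shows "(\<lambda>x. concat_bes e (s x) (f x) (g x)) \<in> measurable M path_sigma"
  by (rule glue_measurable[OF assms(1,2) f])
    (use measurable_compose[OF g measurable_compose[OF bes_measurable_path_sigma sub_path_measurable]] in auto)

text \<open>At each grid time, with the past frozen, the Brownian future staying within e above its
  current position and weighted by its final distance to that bar is exchanged for a Bessel
  continuation. The cap z + 1 on the crossing position bounds the weight uniformly in n and is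
  eventually satisfied, because the overshoot vanishes in the limit.\<close>

lemma grid_passage_identity:
  assumes P: "wiener_law x P" and W: "wiener_law 0 W" and e: "0 < e" and t: "0 \<le> t"
    and F: "F \<in> borel_measurable (path_filt t)"
  shows "(\<integral>\<^sup>+w. (if crossed z t n w then
        (if w (cross_time z t n w) \<le> z + 1 \<and> (\<forall>u\<in>{cross_time z t n w..t}. w u \<le> w (cross_time z t n w) + e)
         then F w * ennreal ((w (cross_time z t n w) + e - w t) / e) else 0) else 0) \<partial>P) =
    (\<integral>\<^sup>+w. (if crossed z t n w then
        (if w (cross_time z t n w) \<le> z + 1
         then \<integral>\<^sup>+v. F (concat_bes e (cross_time z t n w) w v) \<partial>triple W else 0) else 0) \<partial>P)" (is ?A)
    and "(\<lambda>w. if crossed z t n w then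
        (if w (cross_time z t n w) \<le> z + 1 \<and> (\<forall>u\<in>{cross_time z t n w..t}. w u \<le> w (cross_time z t n w) + e)
         then F w * ennreal ((w (cross_time z t n w) + e - w t) / e) else 0) else 0)
      \<in> borel_measurable P" (is ?B)
    and "(\<lambda>w. if crossed z t n w then
        (if w (cross_time z t n w) \<le> z + 1
         then \<integral>\<^sup>+v. F (concat_bes e (cross_time z t n w) w v) \<partial>triple W else 0) else 0)
      \<in> borel_measurable P" (is ?C)
proof -
  interpret W: prob_space W using wiener_prob[OF W] .
  interpret T: prob_space "triple W" by (rule triple_prob) unfold_locales
  note setsW = wiener_sets[OF W]
  have F': "F \<in> borel_measurable path_sigma" by (rule measurable_path_filt_path_sigma[OF F])
  let ?f = "\<lambda>s w. if w s \<le> z + 1 \<and> (\<forall>u\<in>{s..t}. w u \<le> w s + e) then F w * ennreal ((w s + e - w t) / e) else 0"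
  let ?g = "\<lambda>s w. if w s \<le> z + 1 then \<integral>\<^sup>+v. F (concat_bes e s w v) \<partial>triple W else 0"
  have key: "(\<lambda>w. if first_cross z t n k w then ?f (grid t n k) w else 0) \<in> borel_measurable path_sigma \<and>
    (\<lambda>w. if first_cross z t n k w then ?g (grid t n k) w else 0) \<in> borel_measurable path_sigma \<and>
    (\<integral>\<^sup>+w. (if first_cross z t n k w then ?f (grid t n k) w else 0) \<partial>P) =
    (\<integral>\<^sup>+w. (if first_cross z t n k w then ?g (grid t n k) w else 0) \<partial>P)" if k: "k \<le> 2 ^ n" for k
  proof -
    define s where "s = grid t n k"
    have s: "0 \<le> s" "s \<le> t" unfolding s_def using grid_bounds[OF t k] by auto
    have fc: "first_cross z t n k (stop_path s w) = first_cross z t n k w" for w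
      unfolding s_def by (rule first_cross_stop[OF t])
    let ?A = "\<lambda>w. first_cross z t n k w \<and> w s \<le> z + 1"
    \<comment> \<open>The density of the Bessel process from e over the remaining time t -
      s.\<close>
    let ?B = "\<lambda>v. if \<forall>u\<in>{0..t - s}. v u \<le> e then ennreal ((e - v (t - s)) / e) else 0"
    let ?F = "\<lambda>y. if ?A (fst y) then F (glue s (fst y) (snd y)) * ?B (snd y) else 0"
    note [measurable] = coord_measurable_path_sigma[OF s(1)] first_cross_measurable[OF t, of z n k]
    have ts[measurable]: "(\<lambda>w. w (t - s)) \<in> borel_measurable path_sigma"
      by (rule coord_measurable_path_sigma) (use s in simp)
    have id: "(\<lambda>w. w) \<in> measurable path_sigma path_sigma" by simp
    from measurable_path_le_on[OF this, of "\<lambda>_. e" "\<lambda>_. 0" "\<lambda>_. t - s"]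
    have [measurable]: "Measurable.pred path_sigma (\<lambda>w. \<forall>u\<in>{0..t - s}. w u \<le> e)" using s by simp
    have Bm[measurable]: "?B \<in> borel_measurable path_sigma" by measurable
    have Am[measurable]: "Measurable.pred path_sigma ?A" by measurable
    have "(\<lambda>y. glue s (fst y) (snd y)) \<in> measurable (path_sigma \<Otimes>\<^sub>M path_sigma) path_sigma"
      by (rule glue_measurable) (use s in auto)
    note [measurable] = measurable_compose[OF this F'] measurable_compose[OF measurable_fst Am]
      measurable_compose[OF measurable_snd Bm]
    have Fm: "?F \<in> borel_measurable (path_sigma \<Otimes>\<^sub>M path_sigma)" by measurable
    have f_eq: "(if first_cross z t n k w then ?f s w else 0) = ?F (stop_path s w, shift_path s w)"
      if w: "w \<in> paths" for w
    proof -
      have a: "?A (stop_path s w) \<longleftrightarrow> ?A w" using fc s by (simp add: stop_path_def)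
      have g: "glue s (stop_path s w) (shift_path s w) = w" by (rule glue_stop_shift[OF s(1) w])
      have c: "(\<forall>u\<in>{s..t}. w u \<le> w s + e) \<longleftrightarrow> (\<forall>u\<in>{0..t - s}. shift_path s w u \<le> e)"
      proof
        assume *: "\<forall>u\<in>{s..t}. w u \<le> w s + e"
        show "\<forall>u\<in>{0..t - s}. shift_path s w u \<le> e"
        proof
          fix u assume "u \<in> {0..t - s}"
          then show "shift_path s w u \<le> e" using *[rule_format, of "s + u"] by (simp add: shift_path_def)
        qed
      next
        assume *: "\<forall>u\<in>{0..t - s}. shift_path s w u \<le> e"
        show "\<forall>u\<in>{s..t}. w u \<le> w s + e"
        proof
          fix u assume "u \<in> {s..t}"
          then show "w u \<le> w s + e" using *[rule_format, of "u - s"] by (simp add: shift_path_def)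
        qed
      qed
      have v: "e - shift_path s w (t - s) = w s + e - w t" using s by (simp add: shift_path_def)
      show ?thesis unfolding fst_conv snd_conv a g c v by (cases "?A w") auto
    qed
    have g_eq: "(if first_cross z t n k w then ?g s w else 0) = (\<integral>\<^sup>+v. ?F (stop_path s w, v) \<partial>W)"
      if w: "w \<in> paths" for w
    proof -
      have a: "?A (stop_path s w) \<longleftrightarrow> ?A w" using fc s by (simp add: stop_path_def)
      \<comment> \<open>For this functional \<open>glue_sub_sub\<close> turns the concatenation back
        into gluing the Brownian future: the two signs cancel and the constant e disappears by
        recentring.\<close>
      have H: "(\<lambda>y. F (glue s w (sub_path 0 y))) \<in> borel_measurable (path_filt (t - s))"
        by (rule measurable_compose[OF glue_measurable_filt[OF s w] F])
      have "(\<integral>\<^sup>+v. F (concat_bes e s w v) \<partial>triple W) = (\<integral>\<^sup>+v. F (glue s w v) * ?B v \<partial>W)"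
        using bes_absolutely_continuous[OF W e _ H] s unfolding glue_sub_sub by simp
      then show ?thesis
        unfolding fst_conv snd_conv a glue_stop[OF s(1)] by (cases "?A w") auto
    qed
    have mp: "(\<lambda>w. (stop_path s w, shift_path s w)) \<in> measurable path_sigma (path_sigma \<Otimes>\<^sub>M path_sigma)"
      by (intro measurable_Pair stop_path_measurable' shift_path_measurable s)
    have 1: "(\<lambda>w. if first_cross z t n k w then ?f s w else 0) \<in> borel_measurable path_sigma"
      using measurable_compose[OF mp Fm] by (subst measurable_cong[OF f_eq]) simp_all
    have Fm': "?F \<in> borel_measurable (path_sigma \<Otimes>\<^sub>M W)"
      using Fm setsW by (simp cong: measurable_cong_sets sets_pair_measure_cong)
    have 2: "(\<lambda>w. if first_cross z t n k w then ?g s w else 0) \<in> borel_measurable path_sigma"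
      using measurable_compose[OF stop_path_measurable'[OF s(1)] W.borel_measurable_nn_integral_fst[OF Fm']]
      by (subst measurable_cong[OF g_eq]) simp_all
    have "(\<integral>\<^sup>+w. (if first_cross z t n k w then ?f s w else 0) \<partial>P) = (\<integral>\<^sup>+w. ?F (stop_path s w, shift_path s w) \<partial>P)"
      by (rule nn_integral_cong) (simp only: f_eq wiener_space[OF P])
    also have "\<dots> = (\<integral>\<^sup>+w. \<integral>\<^sup>+v. ?F (stop_path s w, v) \<partial>W \<partial>P)"
      by (rule weak_markov_nn_integral[OF P W s(1) Fm])
    also have "\<dots> = (\<integral>\<^sup>+w. (if first_cross z t n k w then ?g s w else 0) \<partial>P)"
      by (rule nn_integral_cong) (simp only: g_eq wiener_space[OF P])
    finally show ?thesis using 1 2 unfolding s_def by blast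
  qed
  have sum_swap: "(\<integral>\<^sup>+w. (if crossed z t n w then f (cross_time z t n w) w else (0::ennreal)) \<partial>P) =
      (\<Sum>k\<le>2 ^ n. \<integral>\<^sup>+w. (if first_cross z t n k w then f (grid t n k) w else 0) \<partial>P)" (is ?eq)
    and sum_meas: "(\<lambda>w. if crossed z t n w then f (cross_time z t n w) w else (0::ennreal)) \<in> borel_measurable P"
    if m: "\<And>k. k \<le> 2 ^ n \<Longrightarrow> (\<lambda>w. if first_cross z t n k w then f (grid t n k) w else 0) \<in> borel_measurable path_sigma" for f
  proof -
    note m' = m[folded wiener_measurable[OF P]]
    have eq: "(if crossed z t n w then f (cross_time z t n w) w else 0)
        = (\<Sum>k\<le>2 ^ n. if first_cross z t n k w then f (grid t n k) w else 0)" for w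
      by (rule sum_first_cross[symmetric])
    show ?eq unfolding eq by (rule nn_integral_sum) (simp add: m')
    show "(\<lambda>w. if crossed z t n w then f (cross_time z t n w) w else (0::ennreal)) \<in> borel_measurable P"
      unfolding eq using m' by (intro borel_measurable_sum) simp
  qed
  have seq: "(\<Sum>k\<le>2 ^ n. \<integral>\<^sup>+w. (if first_cross z t n k w then ?f (grid t n k) w else 0) \<partial>P)
      = (\<Sum>k\<le>2 ^ n. \<integral>\<^sup>+w. (if first_cross z t n k w then ?g (grid t n k) w else 0) \<partial>P)"
    using key by (intro sum.cong refl) simp
  show ?A
    using sum_swap[of ?f, OF key[THEN conjunct1]] seq sum_swap[of ?g, OF key[THEN conjunct2, THEN conjunct1]]
    by (simp only:)
  show ?B using sum_meas[of ?f, OF key[THEN conjunct1]] .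
  show ?C using sum_meas[of ?g, OF key[THEN conjunct2, THEN conjunct1]] .
qed

section \<open>Hitting times and regular levels\<close>

lemma hit_time_eqI:
  assumes "0 \<le> s" "w s = z" "\<And>u. 0 \<le> u \<Longrightarrow> u < s \<Longrightarrow> w u \<noteq> z"
  shows "hit_time z w = ennreal s"
  unfolding hit_time_def
proof (rule antisym)
  show "(INF u\<in>{u. 0 \<le> u \<and> w u = z}. ennreal u) \<le> ennreal s"
    by (rule INF_lower) (use assms in auto)
  show "ennreal s \<le> (INF u\<in>{u. 0 \<le> u \<and> w u = z}. ennreal u)"
    by (rule INF_greatest) (use assms in \<open>force intro: ennreal_leI\<close>)
qed

lemma hit_time_attained:
  assumes w: "w \<in> paths" and fin: "hit_time z w < \<infinity>"
  obtains s where "0 \<le> s" "w s = z" "\<And>u. 0 \<le> u \<Longrightarrow> u < s \<Longrightarrow> w u \<noteq> z" "hit_time z w = ennreal s"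
proof -
  let ?H = "{u. 0 \<le> u \<and> w u = z}"
  have ne: "?H \<noteq> {}" using fin unfolding hit_time_def by (cases "?H = {}") auto
  have "closed ({0..} \<inter> w -` {z})"
    by (rule continuous_closed_preimage[OF paths_continuous[OF w]]) auto
  moreover have "{0..} \<inter> w -` {z} = ?H" by auto
  ultimately have cl: "closed ?H" by simp
  have bb: "bdd_below ?H" by (rule bdd_belowI[of _ 0]) auto
  have "Inf ?H \<in> ?H" by (rule closed_contains_Inf[OF ne bb cl])
  then have s: "0 \<le> Inf ?H" "w (Inf ?H) = z" by auto
  have lt: "w u \<noteq> z" if "0 \<le> u" "u < Inf ?H" for u
    using cInf_lower[OF _ bb, of u] that by auto
  show ?thesis by (rule that[OF s lt hit_time_eqI[where w=w, OF s lt]])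
qed

text \<open>Intermediate value theorem: a level has been visited iff it lies between the minimum and
  the maximum so far. This form is jointly measurable in level and path, as needed for a random
  level.\<close>

lemma hit_time_le_iff:
  assumes w: "w \<in> paths" and r: "0 \<le> r"
  shows "hit_time z w \<le> ennreal r \<longleftrightarrow> z \<le> isup 0 r w \<and> - z \<le> isup 0 r (sub_path 0 w)"
proof
  assume le: "hit_time z w \<le> ennreal r"
  then have "hit_time z w < \<infinity>" by (rule le_less_trans) simp
  from hit_time_attained[OF w this]
  obtain s where s: "0 \<le> s" "w s = z" "hit_time z w = ennreal s" by metis
  then have sr: "s \<in> {0..r}" using le r by simp
  show "z \<le> isup 0 r w \<and> - z \<le> isup 0 r (sub_path 0 w)"
    using isup_ge[OF w order_refl sr] isup_ge[OF sub_path_in_paths[OF w, of 0] order_refl sr] s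
    by (simp add: sub_path_def)
next
  assume le: "z \<le> isup 0 r w \<and> - z \<le> isup 0 r (sub_path 0 w)"
  obtain p where p: "p \<in> {0..r}" "w p = isup 0 r w" using isup_attained[OF w order_refl r] .
  obtain q where q: "q \<in> {0..r}" "sub_path 0 w q = isup 0 r (sub_path 0 w)"
    using isup_attained[OF sub_path_in_paths[OF w] order_refl r] .
  have "connected (w ` {0..r})"
    by (rule connected_continuous_image[OF paths_continuous_subset[OF w]]) auto
  then have "z \<in> w ` {0..r}"
  proof (rule connectedD_interval[of _ "w q" "w p"])
    show "w q \<in> w ` {0..r}" by (rule imageI[OF q(1)])
    show "w p \<in> w ` {0..r}" by (rule imageI[OF p(1)])
    have "sub_path 0 w q = - w q" using q by (simp add: sub_path_def)
    then show "w q \<le> z" "z \<le> w p" using p q le by simp_all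
  qed
  then obtain u where u: "u \<in> {0..r}" "w u = z" by auto
  have "hit_time z w \<le> ennreal u" unfolding hit_time_def by (rule INF_lower) (use u in auto)
  also have "\<dots> \<le> ennreal r" using u by (intro ennreal_leI) auto
  finally show "hit_time z w \<le> ennreal r" .
qed

lemma hit_time_measurable:
  assumes f: "f \<in> measurable M path_sigma" and g[measurable]: "g \<in> borel_measurable M"
  shows "(\<lambda>x. hit_time (g x) (f x)) \<in> borel_measurable M"
proof (rule borel_measurableI_le)
  fix y :: ennreal
  show "{x \<in> space M. hit_time (g x) (f x) \<le> y} \<in> sets M"
  proof (cases y)
    case (real r)
    have [measurable]: "(\<lambda>x. isup 0 r (f x)) \<in> borel_measurable M"
      by (rule isup_measurable[OF f]) (use real in auto)
    have [measurable]: "(\<lambda>x. isup 0 r (sub_path 0 (f x))) \<in> borel_measurable M"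
      by (rule isup_measurable[OF measurable_compose[OF f sub_path_measurable]]) (use real in auto)
    have "{x \<in> space M. hit_time (g x) (f x) \<le> y}
        = {x \<in> space M. g x \<le> isup 0 r (f x) \<and> - g x \<le> isup 0 r (sub_path 0 (f x))}"
      unfolding real using hit_time_le_iff[OF _ real(1)] measurable_space[OF f] by auto
    then show ?thesis by simp
  qed simp
qed

lemma hit_real_measurable:
  "f \<in> measurable M path_sigma \<Longrightarrow> g \<in> borel_measurable M \<Longrightarrow>
    (\<lambda>x. enn2real (hit_time (g x) (f x))) \<in> borel_measurable M"
  using hit_time_measurable by measurable

text \<open>The level \<open>z\<close> is regular for the path if it is not a local maximum value; then the first
  hitting time of \<open>z\<close> is the first time the path exceeds \<open>z\<close>.  All but countably many levels are
  regular.\<close>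

definition regular_level :: "real \<Rightarrow> (real \<Rightarrow> real) \<Rightarrow> bool" where
  "regular_level z w \<longleftrightarrow> (\<forall>q\<in>\<rat> \<inter> {0..}. run_sup q w \<noteq> z)"

lemma less_run_sup_iff:
  "w \<in> paths \<Longrightarrow> 0 \<le> t \<Longrightarrow> z < run_sup t w \<longleftrightarrow> (\<exists>u\<in>{0..t}. z < w u)"
  unfolding run_sup_eq_isup using isup_le_iff[of w 0 t z] by (auto simp: not_le[symmetric])

text \<open>An earlier visit at u would make z the maximum over [0, q] for a rational q between u
  and s. Rational end times keep the set of exceptional events countable.\<close>

lemma regular_hit_time:
  assumes w: "w \<in> paths" and reg: "regular_level z w"
    and s: "0 \<le> s" "w s = z" "\<And>u. u \<in> {0..s} \<Longrightarrow> w u \<le> z"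
  shows "hit_time z w = ennreal s"
proof (rule hit_time_eqI[where w=w, OF s(1,2)])
  fix u assume u: "0 \<le> u" "u < s"
  show "w u \<noteq> z"
  proof
    assume wu: "w u = z"
    obtain q where q: "q \<in> \<rat>" "u < q" "q < s" using Rats_dense_in_real[OF u(2)] by auto
    have "run_sup q w = z"
      unfolding run_sup_eq_isup by (rule isup_eqI[OF w order_refl, of u]) (use u q wu s in auto)
    then show False using reg q u unfolding regular_level_def by auto
  qed
qed

text \<open>For a fixed outcome only one level is bad, which is Lebesgue null; Fubini exchanges the
  order. Bad levels are thus discarded without any knowledge of the law of \<open>f\<close>.\<close>

lemma AE_lborel_neq:
  assumes P: "prob_space P" and f[measurable]: "f \<in> borel_measurable P"
  shows "AE z in lborel. AE w in P. f w \<noteq> (z::real)"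
proof -
  interpret P: prob_space P by fact
  interpret pair_sigma_finite lborel P ..
  show ?thesis
  proof (subst AE_commute)
    show "{y \<in> space (lborel \<Otimes>\<^sub>M P). f (snd y) \<noteq> fst y} \<in> sets (lborel \<Otimes>\<^sub>M P)" by measurable
    have "AE z in lborel. f w \<noteq> z" for w using AE_lborel_singleton[of "f w"] by (auto elim: eventually_mono)
    then show "AE w in P. AE z in lborel. f w \<noteq> z" by simp
  qed
qed

lemma run_sup_measurable: "0 \<le> t \<Longrightarrow> run_sup t \<in> borel_measurable path_sigma"
  unfolding run_sup_eq_isup by (rule isup_measurable[where f="\<lambda>w. w"]) auto

lemma AE_regular_level:
  assumes P: "wiener_law x P" shows "AE z in lborel. AE w in P. regular_level z w"
proof -
  have cnt: "countable (\<rat> \<inter> {0..} :: real set)" by (intro countable_Int1 countable_rat)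
  have "AE z in lborel. \<forall>q\<in>\<rat> \<inter> {0..}. AE w in P. run_sup q w \<noteq> z"
    using cnt by (subst AE_ball_countable)
      (auto intro!: AE_lborel_neq wiener_prob[OF P] simp: wiener_measurable[OF P] run_sup_measurable)
  then show ?thesis
    unfolding regular_level_def using cnt by (simp add: AE_ball_countable)
qed

lemma glue_tendsto:
  assumes w: "w \<in> paths" and v: "v \<in> paths" and T: "T \<longlonglongrightarrow> s" "\<And>n. 0 \<le> T n" and u: "0 \<le> u"
  shows "(\<lambda>n. glue (T n) w v u) \<longlonglongrightarrow> glue s w v u"
proof -
  have s: "0 \<le> s" using T by (intro LIMSEQ_le_const) auto
  have "(\<lambda>n. w (min u (T n))) \<longlonglongrightarrow> w (min u s)"
    by (rule paths_tendsto[OF w]) (use s T u in \<open>auto intro!: tendsto_intros\<close>)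
  moreover have "(\<lambda>n. v (max 0 (u - T n))) \<longlonglongrightarrow> v (max 0 (u - s))"
    by (rule paths_tendsto[OF v]) (use T in \<open>auto intro!: tendsto_intros\<close>)
  ultimately show ?thesis using u unfolding glue_def by (auto intro!: tendsto_intros)
qed

text \<open>The bounded support of the factor at time t controls the weight (z + e - w t) / e, and
  continuity in finitely many coordinates makes the functional continuous under pointwise limits of
  paths.\<close>

locale cylinder_test =
  fixes t :: real and J :: "real set" and f :: "real \<Rightarrow> real \<Rightarrow> real" and K :: real
  assumes J: "finite J" "J \<subseteq> {0..t}" "t \<in> J"
    and f: "\<And>j. continuous_on UNIV (f j)" "\<And>j u. f j u \<in> {0..1}"
    and K: "\<And>u. K < \<bar>u\<bar> \<Longrightarrow> f t u = 0"
begin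

definition r :: "(real \<Rightarrow> real) \<Rightarrow> real" where "r w = (\<Prod>j\<in>J. f j (w j))"

lemma t: "0 \<le> t" using J by auto

lemma r01: "0 \<le> r w" "r w \<le> 1"
  unfolding r_def using f(2) by (auto intro!: prod_nonneg prod_le_1)

lemma r_zero: "K < \<bar>w t\<bar> \<Longrightarrow> r w = 0"
  unfolding r_def using J K by (intro prod_zero) auto

lemma r_filt: "r \<in> borel_measurable (path_filt t)"
  unfolding r_def
proof (rule borel_measurable_prod)
  fix j assume "j \<in> J"
  then show "(\<lambda>w. f j (w j)) \<in> borel_measurable (path_filt t)"
    using J(2) by (intro measurable_compose[OF coord_measurable_filt borel_measurable_continuous_onI[OF f(1)]]) auto
qed

lemma r_sigma [measurable]: "r \<in> borel_measurable path_sigma"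
  by (rule measurable_path_filt_path_sigma[OF r_filt])

lemma r_tendsto:
  assumes "\<And>u. 0 \<le> u \<Longrightarrow> (\<lambda>n. v n u) \<longlonglongrightarrow> w u" shows "(\<lambda>n. r (v n)) \<longlonglongrightarrow> r w"
  unfolding r_def
proof (rule tendsto_prod)
  fix j assume "j \<in> J"
  then have "(\<lambda>n. v n j) \<longlonglongrightarrow> w j" using assms J(2) by auto
  moreover have "isCont (f j) (w j)" using f(1)[of j] by (simp add: continuous_on_eq_continuous_at)
  ultimately show "(\<lambda>n. f j (v n j)) \<longlonglongrightarrow> f j (w j)" by (rule isCont_tendsto_compose[rotated])
qed

lemma nn_integral_r_tendsto:
  assumes W: "wiener_law 0 W" and m: "\<And>n. Y n \<in> measurable (triple W) path_sigma"
    and lim: "\<And>v u. v \<in> space (triple W) \<Longrightarrow> 0 \<le> u \<Longrightarrow> (\<lambda>n. Y n v u) \<longlonglongrightarrow> Z v u"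
    and Z: "Z \<in> measurable (triple W) path_sigma"
  shows "(\<lambda>n. \<integral>\<^sup>+v. ennreal (r (Y n v)) \<partial>triple W) \<longlonglongrightarrow> (\<integral>\<^sup>+v. ennreal (r (Z v)) \<partial>triple W)"
proof (rule nn_integral_dominated_convergence[where w="\<lambda>_. 1"])
  interpret T: prob_space "triple W" by (rule triple_prob[OF wiener_prob[OF W]])
  show "(\<lambda>v. ennreal (r (Y n v))) \<in> borel_measurable (triple W)" for n
    using measurable_compose[OF m r_sigma] by simp
  show "(\<lambda>v. ennreal (r (Z v))) \<in> borel_measurable (triple W)"
    using measurable_compose[OF Z r_sigma] by simp
  show "AE v in triple W. ennreal (r (Y n v)) \<le> 1" for n
    using r01 by (intro AE_I2) (simp add: ennreal_le_1)
  show "AE v in triple W. (\<lambda>n. ennreal (r (Y n v))) \<longlonglongrightarrow> ennreal (r (Z v))"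
    by (intro AE_I2 tendsto_ennrealI r_tendsto lim)
  show "(\<integral>\<^sup>+v. 1 \<partial>triple W) < \<infinity>" by (simp add: T.emeasure_space_1)
qed simp

definition post :: "real \<Rightarrow> (real \<Rightarrow> real) measure \<Rightarrow> real \<Rightarrow> (real \<Rightarrow> real) \<Rightarrow> ennreal" where
  "post e W s w = (\<integral>\<^sup>+v. ennreal (r (concat_bes e s w v)) \<partial>triple W)"

lemma post_le_1: "wiener_law 0 W \<Longrightarrow> post e W s w \<le> 1"
proof -
  assume W: "wiener_law 0 W"
  interpret T: prob_space "triple W" by (rule triple_prob[OF wiener_prob[OF W]])
  have "post e W s w \<le> (\<integral>\<^sup>+v. 1 \<partial>triple W)"
    unfolding post_def using r01 by (intro nn_integral_mono) (simp add: ennreal_le_1)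
  then show ?thesis by (simp add: T.emeasure_space_1)
qed

lemma post_measurable:
  assumes W: "wiener_law 0 W" and s: "s \<in> borel_measurable M" "\<And>x. x \<in> space M \<Longrightarrow> 0 \<le> s x"
    and g: "g \<in> measurable M path_sigma"
  shows "(\<lambda>x. post e W (s x) (g x)) \<in> borel_measurable M"
proof -
  interpret T: prob_space "triple W" by (rule triple_prob[OF wiener_prob[OF W]])
  have sets3: "sets (M \<Otimes>\<^sub>M triple W) = sets (M \<Otimes>\<^sub>M triple path_sigma)"
    using wiener_sets[OF W] by (intro sets_pair_measure_cong refl)
  have "(\<lambda>y. concat_bes e (s (fst y)) (g (fst y)) (snd y)) \<in> measurable (M \<Otimes>\<^sub>M triple path_sigma) path_sigma"
    by (rule concat_bes_measurable)
      (use s g in \<open>auto intro: measurable_compose[OF measurable_fst] simp: space_pair_measure\<close>)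
  from measurable_compose[OF this r_sigma]
  have "(\<lambda>y. r (concat_bes e (s (fst y)) (g (fst y)) (snd y))) \<in> borel_measurable (M \<Otimes>\<^sub>M triple W)"
    by (simp add: measurable_cong_sets[OF sets3 refl])
  then have "(\<lambda>y. ennreal (r (concat_bes e (s (fst y)) (g (fst y)) (snd y)))) \<in> borel_measurable (M \<Otimes>\<^sub>M triple W)"
    by simp
  from T.borel_measurable_nn_integral_fst[OF this] show ?thesis unfolding post_def by simp
qed

lemma concat_bes_measurable_snd:
  assumes W: "wiener_law 0 W" and s: "0 \<le> s" and w: "w \<in> paths"
  shows "concat_bes e s w \<in> measurable (triple W) path_sigma"
proof -
  have "(\<lambda>v. concat_bes e s w v) \<in> measurable (triple path_sigma) path_sigma"
    by (rule concat_bes_measurable) (use s w in auto)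
  then show ?thesis by (simp add: measurable_triple[OF wiener_sets[OF W]])
qed

text \<open>For each outcome of the driving noise the glued path depends continuously on the gluing
  time, and the test functional is bounded by 1.\<close>

lemma post_tendsto_time:
  assumes W: "wiener_law 0 W" and w: "w \<in> paths" and T: "T \<longlonglongrightarrow> s" "\<And>n. 0 \<le> T n"
  shows "(\<lambda>n. post e W (T n) w) \<longlonglongrightarrow> post e W s w"
  unfolding post_def
proof (rule nn_integral_r_tendsto[OF W])
  have s: "0 \<le> s" using T by (intro LIMSEQ_le_const) auto
  show "concat_bes e (T n) w \<in> measurable (triple W) path_sigma" for n
    by (rule concat_bes_measurable_snd[OF W T(2) w])
  show "concat_bes e s w \<in> measurable (triple W) path_sigma"
    by (rule concat_bes_measurable_snd[OF W s w])
  fix v and u :: real assume v: "v \<in> space (triple W)" and u: "0 \<le> u"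
  have "sub_path 0 (bes e v) \<in> paths"
    using v by (cases v) (auto simp: space_triple[OF wiener_sets[OF W]] intro: sub_path_in_paths bes_in_paths)
  from glue_tendsto[OF w this T u] show "(\<lambda>n. concat_bes e (T n) w v u) \<longlonglongrightarrow> concat_bes e s w v u" .
qed

text \<open>The Bessel processes with different starting points are built from the same noise, so
  letting the starting point tend to 0 is a pointwise limit.\<close>

lemma post_tendsto_eps:
  assumes W: "wiener_law 0 W" and w: "w \<in> paths" and s: "0 \<le> s" and e: "e \<longlonglongrightarrow> 0"
  shows "(\<lambda>n. post (e n) W s w) \<longlonglongrightarrow> post 0 W s w"
  unfolding post_def
proof (rule nn_integral_r_tendsto[OF W])
  show "concat_bes (e n) s w \<in> measurable (triple W) path_sigma" for n
    by (rule concat_bes_measurable_snd[OF W s w])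
  show "concat_bes 0 s w \<in> measurable (triple W) path_sigma"
    by (rule concat_bes_measurable_snd[OF W s w])
  fix v :: "(real \<Rightarrow> real) \<times> (real \<Rightarrow> real) \<times> (real \<Rightarrow> real)" and u :: real assume u: "0 \<le> u"
  have "(\<lambda>n. bes (e n) v u) \<longlonglongrightarrow> bes 0 v u" if "0 \<le> u" for u
    using that unfolding bes_def by (cases v) (auto intro!: tendsto_eq_intros e)
  then show "(\<lambda>n. concat_bes (e n) s w v u) \<longlonglongrightarrow> concat_bes 0 s w v u"
    using u unfolding glue_def sub_path_def by (auto intro!: tendsto_intros)
qed

text \<open>As the grid becomes dense, the crossing time tends to the passage time, which at a
  regular level is the hitting time, and the constraint after the crossing turns into S_t <= z + e.
  The tie S_t = z + e, where the approximating constraint need not converge, is excluded almost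
  surely.\<close>

lemma passage_identity_level:
  assumes P: "wiener_law x P" and W: "wiener_law 0 W" and e: "0 < e" and xz: "x \<le> z"
    and reg: "AE w in P. regular_level z w" and ne: "AE w in P. run_sup t w \<noteq> z + e"
  shows "(\<integral>\<^sup>+w. (if z < run_sup t w \<and> run_sup t w \<le> z + e then ennreal (r w) * ennreal ((z + e - w t) / e) else 0) \<partial>P)
    = (\<integral>\<^sup>+w. (if z < run_sup t w then post e W (enn2real (hit_time z w)) w else 0) \<partial>P)"
proof -
  interpret P: prob_space P using wiener_prob[OF P] .
  have F: "(\<lambda>w. ennreal (r w)) \<in> borel_measurable (path_filt t)" using r_filt by simp
  let ?T = "\<lambda>n w. cross_time z t n w"
  let ?L = "\<lambda>n w. if crossed z t n w then
        (if w (?T n w) \<le> z + 1 \<and> (\<forall>u\<in>{?T n w..t}. w u \<le> w (?T n w) + e)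
         then ennreal (r w) * ennreal ((w (?T n w) + e - w t) / e) else 0) else 0"
  let ?R = "\<lambda>n w. if crossed z t n w then (if w (?T n w) \<le> z + 1 then post e W (?T n w) w else 0) else 0"
  let ?l = "\<lambda>w. if z < run_sup t w \<and> run_sup t w \<le> z + e then ennreal (r w) * ennreal ((z + e - w t) / e) else 0"
  let ?r = "\<lambda>w. if z < run_sup t w then post e W (enn2real (hit_time z w)) w else 0"
  note grid = grid_passage_identity[OF P W e t F, of z, folded post_def]
  note [measurable] = run_sup_measurable[OF t] coord_measurable_path_sigma[OF t]
  have id: "(\<lambda>w. w) \<in> measurable path_sigma path_sigma" by simp
  have lm: "?l \<in> borel_measurable P"
    unfolding wiener_measurable[OF P] by measurable
  have [measurable]: "(\<lambda>w. post e W (enn2real (hit_time z w)) w) \<in> borel_measurable path_sigma"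
    by (rule post_measurable[OF W hit_real_measurable[OF id] _ id]) auto
  have rm: "?r \<in> borel_measurable P"
    unfolding wiener_measurable[OF P] by measurable
  \<comment> \<open>Where the test functional does not vanish, - w t is at most |K|; with the cap z
    + 1 this bounds the weight for all n at once.\<close>
  define C where "C = ennreal ((\<bar>z\<bar> + 1 + e + \<bar>K\<bar>) / e)"
  have lb: "?L n w \<le> C" for n w
  proof (cases "crossed z t n w \<and> w (?T n w) \<le> z + 1 \<and> \<not> K < \<bar>w t\<bar>")
    case True
    then have "w (?T n w) + e - w t \<le> \<bar>z\<bar> + 1 + e + \<bar>K\<bar>" by linarith
    then have "(w (?T n w) + e - w t) / e \<le> (\<bar>z\<bar> + 1 + e + \<bar>K\<bar>) / e" using e by (intro divide_right_mono) auto
    then have "ennreal ((w (?T n w) + e - w t) / e) \<le> C" unfolding C_def by (rule ennreal_leI)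
    moreover have "ennreal (r w) \<le> 1" using r01 by (simp add: ennreal_le_1)
    ultimately have "ennreal (r w) * ennreal ((w (?T n w) + e - w t) / e) \<le> 1 * C" by (intro mult_mono) auto
    then show ?thesis by simp
  next
    case False
    then show ?thesis using r_zero[of w] by auto
  qed
  have AE: "AE w in P. w \<in> paths \<and> w 0 \<le> z \<and> regular_level z w \<and> run_sup t w \<noteq> z + e"
    using wiener_start[OF P] reg ne AE_space
    by eventually_elim (use xz wiener_space[OF P] in auto)
  have lim: "(\<lambda>n. ?L n w) \<longlonglongrightarrow> ?l w \<and> (\<lambda>n. ?R n w) \<longlonglongrightarrow> ?r w"
    if w: "w \<in> paths" and w0: "w 0 \<le> z" and rg: "regular_level z w" and nr: "run_sup t w \<noteq> z + e" for w
  proof (cases "z < run_sup t w")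
    case False
    then have "\<not> crossed z t n w" for n using crossed_imp_ex[OF t, of z n w] less_run_sup_iff[OF w t, of z] by blast
    then show ?thesis using False by simp
  next
    case True
    then have ex: "\<exists>u\<in>{0..t}. z < w u" using less_run_sup_iff[OF w t] by simp
    from cross_time_tendsto[OF w w0 ex]
    obtain s where s: "s \<in> {0..t}" "w s = z" "\<And>u. u \<in> {0..s} \<Longrightarrow> w u \<le> z"
      "\<And>n. crossed z t n w \<Longrightarrow> s \<le> ?T n w"
      "\<forall>\<^sub>F n in sequentially. crossed z t n w" "(\<lambda>n. ?T n w) \<longlonglongrightarrow> s" by metis
    have s0: "0 \<le> s" using s(1) by simp
    note c0 = cross_time_nonneg[OF t, of z _ w]
    have hit: "enn2real (hit_time z w) = s" using regular_hit_time[OF w rg s0 s(2,3)] s0 by simp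
    have wT: "(\<lambda>n. w (?T n w)) \<longlonglongrightarrow> z" using paths_tendsto[OF w s(6) c0 s0] s(2) by simp
    have ev1: "\<forall>\<^sub>F n in sequentially. w (?T n w) \<le> z + 1"
      using order_tendstoD(2)[OF wT, of "z + 1"] by (auto elim: eventually_mono)
    have "(\<lambda>n. post e W (?T n w) w) \<longlonglongrightarrow> post e W s w" by (rule post_tendsto_time[OF W w s(6) c0])
    moreover have "\<forall>\<^sub>F n in sequentially. post e W (?T n w) w = ?R n w"
      using s(5) ev1 by eventually_elim simp
    ultimately have R: "(\<lambda>n. ?R n w) \<longlonglongrightarrow> ?r w"
      using True hit by (simp add: Lim_transform_eventually)
    have Sle: "w u \<le> run_sup t w" if "u \<in> {0..t}" for u
      unfolding run_sup_eq_isup using isup_ge[OF w order_refl that] .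
    have L: "(\<lambda>n. ?L n w) \<longlonglongrightarrow> ?l w"
    proof (cases "run_sup t w < z + e")
      \<comment> \<open>The strict inequality leaves room: the grid constraint holds for all large
        n.\<close>
      case lt: True
      have "(\<lambda>n. ennreal (r w * ((w (?T n w) + e - w t) / e))) \<longlonglongrightarrow> ennreal (r w * ((z + e - w t) / e))"
        using e by (intro tendsto_ennrealI tendsto_intros wT) auto
      moreover have "?l w = ennreal (r w) * ennreal ((z + e - w t) / e)" using True lt by simp
      ultimately have "(\<lambda>n. ennreal (r w) * ennreal ((w (?T n w) + e - w t) / e)) \<longlonglongrightarrow> ?l w"
        by (simp only: ennreal_mult'[OF r01(1)])
      moreover have "\<forall>\<^sub>F n in sequentially. run_sup t w - e < w (?T n w)"
        by (rule order_tendstoD(1)[OF wT]) (use lt in simp)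
      then have "\<forall>\<^sub>F n in sequentially. ennreal (r w) * ennreal ((w (?T n w) + e - w t) / e) = ?L n w"
        using s(5) ev1
      proof eventually_elim
        case (elim n)
        have "\<forall>u\<in>{?T n w..t}. w u \<le> w (?T n w) + e"
        proof
          fix u assume "u \<in> {?T n w..t}"
          then show "w u \<le> w (?T n w) + e" using Sle[of u] c0[of n] elim by auto
        qed
        then show ?case using elim by simp
      qed
      ultimately show ?thesis by (rule Lim_transform_eventually)
    next
      case False
      then have gt: "z + e < run_sup t w" using nr by simp
      then obtain u where u: "u \<in> {0..t}" "z + e < w u" using less_run_sup_iff[OF w t] by auto
      \<comment> \<open>Up to s the path is at most z, so a time with value above z + e comes after
        s, hence eventually after the crossing time, and violates the grid constraint.\<close>
      have su: "s < u" using s(3)[of u] u e by (rule_tac ccontr) (auto simp: not_less)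
      have "\<forall>\<^sub>F n in sequentially. ?T n w < u" by (rule order_tendstoD(2)[OF s(6) su])
      moreover have "\<forall>\<^sub>F n in sequentially. w (?T n w) < w u - e"
        by (rule order_tendstoD(2)[OF wT]) (use u in simp)
      ultimately have "\<forall>\<^sub>F n in sequentially. ?L n w = 0"
      proof eventually_elim
        case (elim n)
        then have "\<not> (\<forall>u\<in>{?T n w..t}. w u \<le> w (?T n w) + e)" using u by (auto intro!: bexI[of _ u])
        then show ?case by (simp only: simp_thms if_False if_cancel)
      qed
      then show ?thesis using gt by (simp add: tendsto_eventually)
    qed
    show ?thesis using L R by blast
  qed
  have l: "(\<lambda>n. \<integral>\<^sup>+w. ?L n w \<partial>P) \<longlonglongrightarrow> (\<integral>\<^sup>+w. ?l w \<partial>P)"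
  proof (rule nn_integral_dominated_convergence[where w="\<lambda>_. C", OF grid(2) lm])
    show "AE w in P. ?L n w \<le> C" for n using lb by (intro AE_I2)
    show "(\<integral>\<^sup>+w. C \<partial>P) < \<infinity>" by (simp add: P.emeasure_space_1 C_def)
    show "AE w in P. (\<lambda>n. ?L n w) \<longlonglongrightarrow> ?l w"
      using AE by eventually_elim (use lim in blast)
  qed simp
  have r: "(\<lambda>n. \<integral>\<^sup>+w. ?R n w \<partial>P) \<longlonglongrightarrow> (\<integral>\<^sup>+w. ?r w \<partial>P)"
  proof (rule nn_integral_dominated_convergence[where w="\<lambda>_. 1", OF grid(3) rm])
    show "AE w in P. ?R n w \<le> 1" for n using post_le_1[OF W] by (intro AE_I2) simp
    show "(\<integral>\<^sup>+w. 1 \<partial>P) < \<infinity>" by (simp add: P.emeasure_space_1)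
    show "AE w in P. (\<lambda>n. ?R n w) \<longlonglongrightarrow> ?r w"
      using AE by eventually_elim (use lim in blast)
  qed simp
  show ?thesis by (rule LIMSEQ_unique[OF l]) (simp only: grid(1) r)
qed

end

section \<open>Integration over the level\<close>

lemma hit_pair_measurable:
  "(\<lambda>y. enn2real (hit_time (fst y) (snd y))) \<in> borel_measurable (borel \<Otimes>\<^sub>M path_sigma)"
  by (rule hit_real_measurable) auto

lemma nn_integral_Ico_const:
  fixes l u :: real
  assumes "l \<le> u" shows "(\<integral>\<^sup>+z. indicator {l..<u} z * c \<partial>lborel) = c * ennreal (u - l)"
  using assms by (subst nn_integral_multc) (simp_all add: mult.commute)

context cylinder_test
begin

definition total :: "real \<Rightarrow> (real \<Rightarrow> real) measure \<Rightarrow> (real \<Rightarrow> real) measure \<Rightarrow> real \<Rightarrow> ennreal" where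
  "total e P W z = (\<integral>\<^sup>+w. (if z < run_sup t w then post e W (enn2real (hit_time z w)) w else 0) \<partial>P)"

lemma total_integrand_measurable:
  assumes W: "wiener_law 0 W"
  shows "(\<lambda>y. if fst y < run_sup t (snd y) then post e W (enn2real (hit_time (fst y) (snd y))) (snd y) else 0)
    \<in> borel_measurable (borel \<Otimes>\<^sub>M path_sigma)"
proof -
  have [measurable]: "(\<lambda>y. post e W (enn2real (hit_time (fst y) (snd y))) (snd y)) \<in> borel_measurable (borel \<Otimes>\<^sub>M path_sigma)"
    by (rule post_measurable[OF W hit_pair_measurable]) auto
  note [measurable] = run_sup_measurable[OF t]
  show ?thesis by measurable
qed

lemma total_measurable:
  assumes P: "wiener_law x P" and W: "wiener_law 0 W"
  shows "total e P W \<in> borel_measurable borel"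
proof -
  interpret P: prob_space P using wiener_prob[OF P] .
  have "(\<lambda>y. if fst y < run_sup t (snd y) then post e W (enn2real (hit_time (fst y) (snd y))) (snd y) else 0)
      \<in> borel_measurable (borel \<Otimes>\<^sub>M P)"
    using total_integrand_measurable[OF W] wiener_sets[OF P]
    by (simp cong: measurable_cong_sets sets_pair_measure_cong)
  from P.borel_measurable_nn_integral_fst[OF this, unfolded fst_conv snd_conv]
  show ?thesis unfolding total_def .
qed

lemma total_le_1:
  assumes P: "wiener_law x P" and W: "wiener_law 0 W" shows "total e P W z \<le> 1"
proof -
  interpret P: prob_space P using wiener_prob[OF P] .
  have "total e P W z \<le> (\<integral>\<^sup>+w. 1 \<partial>P)"
    unfolding total_def using post_le_1[OF W] by (intro nn_integral_mono) auto
  then show ?thesis by (simp add: P.emeasure_space_1)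
qed

lemma total_tendsto:
  assumes P: "wiener_law x P" and W: "wiener_law 0 W" and e: "e \<longlonglongrightarrow> 0"
  shows "(\<lambda>n. total (e n) P W z) \<longlonglongrightarrow> total 0 P W z"
  unfolding total_def
proof (rule nn_integral_dominated_convergence[where w="\<lambda>_. 1"])
  interpret P: prob_space P using wiener_prob[OF P] .
  have m: "(\<lambda>w. if z < run_sup t w then post e W (enn2real (hit_time z w)) w else 0) \<in> borel_measurable P" for e
  proof -
    have "(\<lambda>w. (z, w)) \<in> measurable path_sigma (borel \<Otimes>\<^sub>M path_sigma)" by simp
    from measurable_compose[OF this total_integrand_measurable[OF W], unfolded fst_conv snd_conv]
    show ?thesis unfolding wiener_measurable[OF P] .
  qed
  show "(\<lambda>w. if z < run_sup t w then post (e n) W (enn2real (hit_time z w)) w else 0) \<in> borel_measurable P" for n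
    by (rule m)
  show "(\<lambda>w. if z < run_sup t w then post 0 W (enn2real (hit_time z w)) w else 0) \<in> borel_measurable P"
    by (rule m)
  show "AE w in P. (if z < run_sup t w then post (e n) W (enn2real (hit_time z w)) w else 0) \<le> 1" for n
    using post_le_1[OF W] by (intro AE_I2) auto
  show "(\<integral>\<^sup>+w. 1 \<partial>P) < \<infinity>" by (simp add: P.emeasure_space_1)
  show "AE w in P. (\<lambda>n. if z < run_sup t w then post (e n) W (enn2real (hit_time z w)) w else 0)
      \<longlonglongrightarrow> (if z < run_sup t w then post 0 W (enn2real (hit_time z w)) w else 0)"
    using AE_space
  proof eventually_elim
    case (elim w)
    then have w: "w \<in> paths" using wiener_space[OF P] by simp
    show ?case using post_tendsto_eps[OF W w _ e, of "enn2real (hit_time z w)"] by simp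
  qed
qed simp

text \<open>For supremum S, the levels with z < S <= z + e form a window of length e below S. On it
  the weight lies between (S - y) / e and (S + e - y) / e, so its integral tends to S - y as e tends
  to 0.\<close>

lemma nn_integral_passage_window:
  fixes S y e :: real
  assumes e: "0 < e" and y: "y \<le> S"
  shows "ennreal (S - y) \<le> (\<integral>\<^sup>+z. indicator {S - e..<S} z * ennreal ((z + e - y) / e) \<partial>lborel)"
    and "(\<integral>\<^sup>+z. indicator {S - e..<S} z * ennreal ((z + e - y) / e) \<partial>lborel) \<le> ennreal (S + e - y)"
proof -
  have c: "(\<integral>\<^sup>+z. indicator {S - e..<S} z * ennreal (c / e) \<partial>lborel) = ennreal c" if "0 \<le> c" for c
  proof -
    have "(\<integral>\<^sup>+z. indicator {S - e..<S} z * ennreal (c / e) \<partial>lborel) = ennreal (c / e) * ennreal e"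
      using nn_integral_Ico_const[of "S - e" S "ennreal (c / e)"] e by simp
    also have "\<dots> = ennreal c" using e that by (simp add: ennreal_mult[symmetric])
    finally show ?thesis .
  qed
  have "(\<integral>\<^sup>+z. indicator {S - e..<S} z * ennreal ((S - y) / e) \<partial>lborel)
      \<le> (\<integral>\<^sup>+z. indicator {S - e..<S} z * ennreal ((z + e - y) / e) \<partial>lborel)"
    using e by (intro nn_integral_mono) (auto simp: indicator_def intro!: ennreal_leI divide_right_mono)
  then show "ennreal (S - y) \<le> (\<integral>\<^sup>+z. indicator {S - e..<S} z * ennreal ((z + e - y) / e) \<partial>lborel)"
    using c[of "S - y"] y by simp
  have "(\<integral>\<^sup>+z. indicator {S - e..<S} z * ennreal ((z + e - y) / e) \<partial>lborel)
      \<le> (\<integral>\<^sup>+z. indicator {S - e..<S} z * ennreal ((S + e - y) / e) \<partial>lborel)"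
    using e by (intro nn_integral_mono) (auto simp: indicator_def intro!: ennreal_leI divide_right_mono)
  then show "(\<integral>\<^sup>+z. indicator {S - e..<S} z * ennreal ((z + e - y) / e) \<partial>lborel) \<le> ennreal (S + e - y)"
    using c[of "S + e - y"] y e by simp
qed

text \<open>Integration over z discards the null set of exceptional levels and cancels the divisor e
  against the length of the window of admissible levels; both sides then have a limit as e tends to
  0.\<close>

lemma passage_identity_interval:
  assumes P: "wiener_law x P" and W: "wiener_law 0 W" and xa: "x \<le> a"
  shows "(\<integral>\<^sup>+w. (if a < run_sup t w \<and> run_sup t w \<le> b then ennreal (r w) * ennreal (run_sup t w - w t) else 0) \<partial>P)
    = (\<integral>\<^sup>+z. indicator {a<..b} z * total 0 P W z \<partial>lborel)"
proof -
  interpret P: prob_space P using wiener_prob[OF P] .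
  interpret pair_sigma_finite P lborel ..
  note [measurable] = run_sup_measurable[OF t] coord_measurable_path_sigma[OF t]
  \<comment> \<open>Each value is at most 1, so one constant dominates for all n.\<close>
  define e where "e = (\<lambda>n. 1 / real (Suc n))"
  have e: "0 < e n" "e n \<le> 1" for n by (auto simp: e_def)
  have e_lim: "e \<longlonglongrightarrow> 0" unfolding e_def by (rule LIMSEQ_Suc[OF lim_1_over_n])
  define h where "h = (\<lambda>n w z. indicator {a<..b} z *
    (if z < run_sup t w \<and> run_sup t w \<le> z + e n then ennreal (r w) * ennreal ((z + e n - w t) / e n) else 0))"
  have hm: "(\<lambda>y. h n (fst y) (snd y)) \<in> borel_measurable (path_sigma \<Otimes>\<^sub>M borel)" for n
    unfolding h_def by measurable
  then have hm': "(\<lambda>y. h n (fst y) (snd y)) \<in> borel_measurable (P \<Otimes>\<^sub>M lborel)" for n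
    using wiener_sets[OF P] by (simp cong: measurable_cong_sets sets_pair_measure_cong)
  define B where "B = (\<lambda>n w. \<integral>\<^sup>+z. h n w z \<partial>lborel)"
  have Bm: "B n \<in> borel_measurable P" for n
    unfolding B_def using lborel.borel_measurable_nn_integral_fst[OF hm'[of n]] by simp
  let ?l = "\<lambda>w. if a < run_sup t w \<and> run_sup t w \<le> b then ennreal (r w) * ennreal (run_sup t w - w t) else 0"
  have id: "(\<integral>\<^sup>+w. B n w \<partial>P) = (\<integral>\<^sup>+z. indicator {a<..b} z * total (e n) P W z \<partial>lborel)" for n
  proof -
    have "(\<integral>\<^sup>+w. B n w \<partial>P) = (\<integral>\<^sup>+z. \<integral>\<^sup>+w. h n w z \<partial>P \<partial>lborel)"
      unfolding B_def using Fubini'[of "h n"] hm'[of n] by (simp add: split_beta')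
    also have "\<dots> = (\<integral>\<^sup>+z. indicator {a<..b} z * total (e n) P W z \<partial>lborel)"
    proof (rule nn_integral_cong_AE)
      \<comment> \<open>The tie S_t = z + e means that S_t - e takes the value z, which is null for
        almost every level.\<close>
      have "(\<lambda>w. run_sup t w - e n) \<in> borel_measurable P" unfolding wiener_measurable[OF P] by measurable
      from AE_lborel_neq[OF P.prob_space_axioms this] AE_regular_level[OF P]
      show "AE z in lborel. (\<integral>\<^sup>+w. h n w z \<partial>P) = indicator {a<..b} z * total (e n) P W z"
      proof eventually_elim
        case (elim z)
        show ?case
        proof (cases "z \<in> {a<..b}")
          case True
          then have xz: "x \<le> z" using xa by simp
          have "AE w in P. run_sup t w \<noteq> z + e n" using elim(1) by eventually_elim auto
          from passage_identity_level[OF P W e(1) xz elim(2) this]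
          show ?thesis using True unfolding h_def total_def by simp
        qed (simp add: h_def)
      qed
    qed
    finally show ?thesis .
  qed
  have lm: "?l \<in> borel_measurable P" unfolding wiener_measurable[OF P] by measurable
  define C where "C = ennreal (\<bar>b\<bar> + 1 + \<bar>K\<bar>)"
  have "(\<lambda>n. \<integral>\<^sup>+w. B n w \<partial>P) \<longlonglongrightarrow> (\<integral>\<^sup>+w. ?l w \<partial>P)"
  proof (rule nn_integral_dominated_convergence[where w="\<lambda>_. C", OF Bm lm])
    show "AE w in P. B n w \<le> C" for n
    proof (rule AE_I2)
      fix w
      \<comment> \<open>The integrand lives on a window of length e and is at most a constant
        divided by e; its integral is therefore bounded independently of n.\<close>
      have "h n w z \<le> indicator {run_sup t w - e n..<run_sup t w} z * ennreal ((\<bar>b\<bar> + 1 + \<bar>K\<bar>) / e n)" for z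
      proof (cases "z \<in> {a<..b} \<and> z < run_sup t w \<and> run_sup t w \<le> z + e n \<and> \<not> K < \<bar>w t\<bar>")
        case True
        then have "z + e n - w t \<le> \<bar>b\<bar> + 1 + \<bar>K\<bar>" using e(2)[of n] by auto
        then have "(z + e n - w t) / e n \<le> (\<bar>b\<bar> + 1 + \<bar>K\<bar>) / e n" using e(1)[of n] by (intro divide_right_mono) auto
        then have "ennreal ((z + e n - w t) / e n) \<le> ennreal ((\<bar>b\<bar> + 1 + \<bar>K\<bar>) / e n)" by (rule ennreal_leI)
        moreover have "ennreal (r w) \<le> 1" using r01 by (simp add: ennreal_le_1)
        ultimately have "ennreal (r w) * ennreal ((z + e n - w t) / e n) \<le> 1 * ennreal ((\<bar>b\<bar> + 1 + \<bar>K\<bar>) / e n)"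
          by (intro mult_mono) auto
        then show ?thesis using True unfolding h_def by simp
      next
        case False
        then show ?thesis using r_zero[of w] unfolding h_def by auto
      qed
      then have "B n w \<le> (\<integral>\<^sup>+z. indicator {run_sup t w - e n..<run_sup t w} z * ennreal ((\<bar>b\<bar> + 1 + \<bar>K\<bar>) / e n) \<partial>lborel)"
        unfolding B_def by (intro nn_integral_mono)
      also have "\<dots> = ennreal ((\<bar>b\<bar> + 1 + \<bar>K\<bar>) / e n) * ennreal (e n)"
        using nn_integral_Ico_const[of "run_sup t w - e n" "run_sup t w"] e(1)[of n] by simp
      also have "\<dots> = C" using e(1)[of n] by (simp add: C_def ennreal_mult[symmetric])
      finally show "B n w \<le> C" .
    qed
    show "(\<integral>\<^sup>+w. C \<partial>P) < \<infinity>" by (simp add: P.emeasure_space_1 C_def)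
    show "AE w in P. (\<lambda>n. B n w) \<longlonglongrightarrow> ?l w"
      using AE_space
    proof eventually_elim
      case (elim w)
      then have w: "w \<in> paths" using wiener_space[OF P] by simp
      define S where "S = run_sup t w"
      have Sw: "w t \<le> S" unfolding S_def run_sup_eq_isup using t by (intro isup_ge[OF w]) auto
      \<comment> \<open>For small e the window [S - e, S) lies beyond b if S > b and inside the
        interval if a < S <= b; for S <= a no level above a is admissible.\<close>
      consider "S \<le> a" | "b < S" | "a < S" "S \<le> b" by linarith
      then show ?case
      proof cases
        case 1
        have "h n w = (\<lambda>_. 0)" for n using 1 unfolding h_def S_def[symmetric] by auto
        then have "B n w = 0" for n unfolding B_def by simp
        then show ?thesis using 1 unfolding S_def by simp
      next
        case 2
        have "\<forall>\<^sub>F n in sequentially. e n < S - b" by (rule order_tendstoD(2)[OF e_lim]) (use 2 in simp)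
        then have "\<forall>\<^sub>F n in sequentially. B n w = 0"
        proof eventually_elim
          case (elim n)
          have "h n w = (\<lambda>_. 0)" using elim unfolding h_def S_def[symmetric] by auto
          then show ?case unfolding B_def by simp
        qed
        then show ?thesis using 2 unfolding S_def by (simp add: tendsto_eventually)
      next
        case 3
        let ?I = "\<lambda>n. \<integral>\<^sup>+z. indicator {S - e n..<S} z * ennreal ((z + e n - w t) / e n) \<partial>lborel"
        have "\<forall>\<^sub>F n in sequentially. e n < S - a" by (rule order_tendstoD(2)[OF e_lim]) (use 3 in simp)
        then have ev: "\<forall>\<^sub>F n in sequentially. B n w = ennreal (r w) * ?I n"
        proof eventually_elim
          case (elim n)
          have "h n w = (\<lambda>z. ennreal (r w) * (indicator {S - e n..<S} z * ennreal ((z + e n - w t) / e n)))"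
            unfolding h_def S_def[symmetric] using elim 3 by (auto simp: indicator_def fun_eq_iff)
          then show ?case unfolding B_def by (simp add: nn_integral_cmult)
        qed
        have "(\<lambda>n. ennreal (r w) * ?I n) \<longlonglongrightarrow> ennreal (r w) * ennreal (S - w t)"
        proof (rule tendsto_sandwich)
          show "\<forall>\<^sub>F n in sequentially. ennreal (r w) * ennreal (S - w t) \<le> ennreal (r w) * ?I n"
            by (intro always_eventually allI mult_left_mono nn_integral_passage_window(1)[OF e(1) Sw]) simp
          show "\<forall>\<^sub>F n in sequentially. ennreal (r w) * ?I n \<le> ennreal (r w * (S + e n - w t))"
            unfolding ennreal_mult'[OF r01(1)]
            by (intro always_eventually allI mult_left_mono nn_integral_passage_window(2)[OF e(1) Sw]) simp
          have "(\<lambda>n. ennreal (r w * (S + e n - w t))) \<longlonglongrightarrow> ennreal (r w * (S + 0 - w t))"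
            by (intro tendsto_ennrealI tendsto_intros e_lim)
          then show "(\<lambda>n. ennreal (r w * (S + e n - w t))) \<longlonglongrightarrow> ennreal (r w) * ennreal (S - w t)"
            by (simp add: ennreal_mult'[OF r01(1)])
        qed simp
        then have "(\<lambda>n. B n w) \<longlonglongrightarrow> ennreal (r w) * ennreal (S - w t)"
          by (rule Lim_transform_eventually) (use ev in \<open>auto elim: eventually_mono\<close>)
        then show ?thesis using 3 unfolding S_def by simp
      qed
    qed
  qed simp
  moreover have "(\<lambda>n. \<integral>\<^sup>+z. indicator {a<..b} z * total (e n) P W z \<partial>lborel)
      \<longlonglongrightarrow> (\<integral>\<^sup>+z. indicator {a<..b} z * total 0 P W z \<partial>lborel)"
  proof (rule nn_integral_dominated_convergence[where w="indicator {a<..b}"])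
    have "(\<lambda>z. indicator {a<..b} z * total d P W z) \<in> borel_measurable lborel" for d
      using total_measurable[OF P W, of d] by (intro borel_measurable_times_ennreal) simp_all
    then show "(\<lambda>z. indicator {a<..b} z * total (e n) P W z) \<in> borel_measurable lborel"
      "(\<lambda>z. indicator {a<..b} z * total 0 P W z) \<in> borel_measurable lborel" for n by blast+
    show "AE z in lborel. indicator {a<..b} z * total (e n) P W z \<le> indicator {a<..b} z" for n
      using total_le_1[OF P W, of "e n"] by (intro AE_I2) (simp add: indicator_def)
    show "(\<integral>\<^sup>+z. indicator {a<..b} z \<partial>lborel) < \<infinity>" by (cases "a \<le> b") auto
    show "AE z in lborel. (\<lambda>n. indicator {a<..b} z * total (e n) P W z) \<longlonglongrightarrow> indicator {a<..b} z * total 0 P W z"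
      using total_tendsto[OF P W e_lim] by (intro AE_I2) (simp add: indicator_def)
  qed simp
  ultimately show ?thesis unfolding id by (rule LIMSEQ_unique)
qed

text \<open>Read as set functions of the level, both sides are measures; agreement on half-open
  intervals gives agreement against every weight. The weight used later is phi divided by its tail
  mass beyond x.\<close>

lemma passage_identity:
  assumes P: "wiener_law x P" and W: "wiener_law 0 W" and g: "g \<in> borel_measurable borel"
  shows "(\<integral>\<^sup>+w. (if x < run_sup t w then ennreal (r w) * ennreal (run_sup t w - w t) else 0) * g (run_sup t w) \<partial>P)
    = (\<integral>\<^sup>+z. (if x < z then total 0 P W z else 0) * g z \<partial>lborel)"
proof -
  note [measurable] = run_sup_measurable[OF t] coord_measurable_path_sigma[OF t] g
  have [measurable]: "(\<lambda>z. if x < z then total 0 P W z else 0) \<in> borel_measurable borel"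
    by (rule measurable_If) (use total_measurable[OF P W] in simp_all)
  let ?d = "\<lambda>w. if x < run_sup t w then ennreal (r w) * ennreal (run_sup t w - w t) else 0"
  have dm: "?d \<in> borel_measurable P" unfolding wiener_measurable[OF P] by measurable
  have Sm: "run_sup t \<in> borel_measurable P" unfolding wiener_measurable[OF P] by measurable
  define N1 where "N1 = distr (density P ?d) borel (run_sup t)"
  define N2 where "N2 = density lborel (\<lambda>z. if x < z then total 0 P W z else 0)"
  have e1: "emeasure N1 A = (\<integral>\<^sup>+w. ?d w * indicator A (run_sup t w) \<partial>P)" if A: "A \<in> sets borel" for A
  proof -
    have "emeasure N1 A = (\<integral>\<^sup>+z. indicator A z \<partial>N1)" using A by (simp add: N1_def)
    also have "\<dots> = (\<integral>\<^sup>+w. indicator A (run_sup t w) \<partial>density P ?d)"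
      unfolding N1_def using Sm A by (subst nn_integral_distr) simp_all
    also have "\<dots> = (\<integral>\<^sup>+w. ?d w * indicator A (run_sup t w) \<partial>P)"
      using dm Sm A by (intro nn_integral_density) simp_all
    finally show ?thesis .
  qed
  have e2: "emeasure N2 A = (\<integral>\<^sup>+z. (if x < z then total 0 P W z else 0) * indicator A z \<partial>lborel)" if "A \<in> sets borel" for A
    unfolding N2_def using that by (subst emeasure_density) simp_all
  have Ioc: "emeasure N1 {a<..b} = emeasure N2 {a<..b}" for a b
  proof -
    \<comment> \<open>The restriction S_t > x raises the left endpoint to max a x, which meets the
      hypothesis x <= a of the interval identity.\<close>
    have "emeasure N1 {a<..b} = (\<integral>\<^sup>+w. (if max a x < run_sup t w \<and> run_sup t w \<le> b
        then ennreal (r w) * ennreal (run_sup t w - w t) else 0) \<partial>P)"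
      unfolding e1[OF greaterThanAtMost_borel] by (intro nn_integral_cong) (auto simp: indicator_def)
    also have "\<dots> = (\<integral>\<^sup>+z. indicator {max a x<..b} z * total 0 P W z \<partial>lborel)"
      by (rule passage_identity_interval[OF P W]) simp
    also have "\<dots> = emeasure N2 {a<..b}"
      unfolding e2[OF greaterThanAtMost_borel] by (intro nn_integral_cong) (auto simp: indicator_def)
    finally show ?thesis .
  qed
  have "N1 = N2"
  proof (rule measure_eqI_generator_eq[where E="range (\<lambda>(a, b). {a<..b::real})" and \<Omega>=UNIV
        and A="\<lambda>n::nat. {- real n<..real n}"])
    show "Int_stable (range (\<lambda>(a, b). {a<..b::real}))"
    proof (rule Int_stableI)
      fix A B assume "A \<in> range (\<lambda>(a, b). {a<..b::real})" "B \<in> range (\<lambda>(a, b). {a<..b::real})"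
      then obtain a b c d where "A = {a<..b}" "B = {c<..d}" by auto
      then have "A \<inter> B = (\<lambda>(a, b). {a<..b}) (max a c, min b d)" by auto
      then show "A \<inter> B \<in> range (\<lambda>(a, b). {a<..b::real})" by blast
    qed
    show "emeasure N1 X = emeasure N2 X" if "X \<in> range (\<lambda>(a, b). {a<..b::real})" for X
      using that Ioc by auto
    show "sets N1 = sigma_sets UNIV (range (\<lambda>(a, b). {a<..b::real}))"
      "sets N2 = sigma_sets UNIV (range (\<lambda>(a, b). {a<..b::real}))"
      unfolding N1_def N2_def by (simp_all add: borel_sigma_sets_Ioc)
    show "(\<Union>n::nat. {- real n<..real n}) = UNIV"
    proof -
      have "\<exists>n::nat. z \<in> {- real n<..real n}" for z
      proof -
        obtain n :: nat where "\<bar>z\<bar> < real n" using reals_Archimedean2 by blast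
        then show ?thesis by (intro exI[of _ n]) auto
      qed
      then show ?thesis by blast
    qed
    show "emeasure N1 {- real n<..real n} \<noteq> \<infinity>" for n :: nat
    proof -
      have "emeasure N1 {- real n<..real n} \<le> (\<integral>\<^sup>+z. indicator {- real n<..real n} z \<partial>lborel)"
        unfolding Ioc e2[OF greaterThanAtMost_borel] using total_le_1[OF P W, of 0]
        by (intro nn_integral_mono) (auto simp: indicator_def)
      also have "\<dots> < \<infinity>" by simp
      finally show ?thesis by simp
    qed
  qed auto
  have "(\<integral>\<^sup>+w. ?d w * g (run_sup t w) \<partial>P) = (\<integral>\<^sup>+z. g z \<partial>N1)"
    unfolding N1_def using Sm dm by (subst nn_integral_distr) (simp_all add: nn_integral_density)
  also have "\<dots> = (\<integral>\<^sup>+z. (if x < z then total 0 P W z else 0) * g z \<partial>lborel)"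
    unfolding \<open>N1 = N2\<close> N2_def by (intro nn_integral_density) simp_all
  finally show ?thesis .
qed

end

text \<open>The concatenated path as a function of its independent ingredients: level, Brownian path
  and driving triple. If the level is never hit, \<open>enn2real\<close> returns 0; for a level
  above the starting point this is a null event.\<close>

definition joined :: "real \<times> (real \<Rightarrow> real) \<times> (real \<Rightarrow> real) \<times> (real \<Rightarrow> real) \<times> (real \<Rightarrow> real) \<Rightarrow> real \<Rightarrow> real" where
  "joined = (\<lambda>(z, w, v). concat_bes 0 (enn2real (hit_time z w)) w v)"

lemma joined_measurable: "joined \<in> measurable (borel \<Otimes>\<^sub>M (path_sigma \<Otimes>\<^sub>M triple path_sigma)) path_sigma"
proof -
  let ?M = "borel \<Otimes>\<^sub>M (path_sigma \<Otimes>\<^sub>M triple path_sigma)"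
  have "(\<lambda>y. concat_bes 0 (enn2real (hit_time (fst y) (fst (snd y)))) (fst (snd y)) (snd (snd y))) \<in> measurable ?M path_sigma"
    by (intro concat_bes_measurable hit_real_measurable) auto
  then show ?thesis by (simp add: joined_def split_beta')
qed

section \<open>Unboundedness and uniqueness of the maximum\<close>

lemma nn_integral_triple_pair:
  assumes Z: "sigma_finite_measure Z" and P: "prob_space P" and T: "prob_space T"
    and F: "F \<in> borel_measurable (Z \<Otimes>\<^sub>M (P \<Otimes>\<^sub>M T))"
  shows "(\<integral>\<^sup>+y. F y \<partial>(Z \<Otimes>\<^sub>M (P \<Otimes>\<^sub>M T))) = (\<integral>\<^sup>+z. \<integral>\<^sup>+w. \<integral>\<^sup>+v. F (z, w, v) \<partial>T \<partial>P \<partial>Z)"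
proof -
  interpret P: prob_space P by fact
  interpret T: prob_space T by fact
  interpret PT: prob_space "P \<Otimes>\<^sub>M T" by (rule prob_space_pair) fact+
  have "(\<integral>\<^sup>+y. F y \<partial>(Z \<Otimes>\<^sub>M (P \<Otimes>\<^sub>M T))) = (\<integral>\<^sup>+z. \<integral>\<^sup>+y. F (z, y) \<partial>(P \<Otimes>\<^sub>M T) \<partial>Z)"
    by (rule PT.nn_integral_fst[OF F, symmetric])
  also have "\<dots> = (\<integral>\<^sup>+z. \<integral>\<^sup>+w. \<integral>\<^sup>+v. F (z, w, v) \<partial>T \<partial>P \<partial>Z)"
    by (intro nn_integral_cong T.nn_integral_fst[symmetric]) (rule measurable_Pair2[OF F])
  finally show ?thesis .
qed

lemma measurable_joined_space:
  assumes "sets P = sets path_sigma" "sets W = sets path_sigma" "sets Z = sets borel"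
  shows "measurable (Z \<Otimes>\<^sub>M (P \<Otimes>\<^sub>M triple W)) N = measurable (borel \<Otimes>\<^sub>M (path_sigma \<Otimes>\<^sub>M triple path_sigma)) N"
  using assms by (intro measurable_cong_sets sets_pair_measure_cong refl)

text \<open>Cylinder functionals determine a finite measure on the events before t, so the identity
  extends from them to all such events; integrability of the weight provides the finiteness.\<close>

lemma passage_law:
  assumes P: "wiener_law x P" and W: "wiener_law 0 W" and t: "0 \<le> t" and G: "G \<in> sets (path_filt t)"
    and g: "g \<in> borel_measurable borel" and fin: "(\<integral>\<^sup>+z. g z \<partial>lborel) < \<infinity>"
  shows "(\<integral>\<^sup>+w. indicator G w * ((if x < run_sup t w then ennreal (run_sup t w - w t) else 0) * g (run_sup t w)) \<partial>P)
    = (\<integral>\<^sup>+z. \<integral>\<^sup>+w. \<integral>\<^sup>+v. (if x < z \<and> z < run_sup t w then g z else 0) * indicator G (joined (z, w, v)) \<partial>triple W \<partial>P \<partial>lborel)"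
proof -
  interpret P: prob_space P using wiener_prob[OF P] .
  interpret T: prob_space "triple W" by (rule triple_prob[OF wiener_prob[OF W]])
  note sP = wiener_sets[OF P] and sW = wiener_sets[OF W]
  let ?O = "lborel \<Otimes>\<^sub>M (P \<Otimes>\<^sub>M triple W)"
  have mO: "measurable ?O N = measurable (borel \<Otimes>\<^sub>M (path_sigma \<Otimes>\<^sub>M triple path_sigma)) N" for N :: "'b measure"
    by (rule measurable_joined_space[OF sP sW]) simp
  note [measurable] = run_sup_measurable[OF t] coord_measurable_path_sigma[OF t] g
  let ?d1 = "\<lambda>w. (if x < run_sup t w then ennreal (run_sup t w - w t) else 0) * g (run_sup t w)"
  let ?d2 = "\<lambda>y. if x < fst y \<and> fst y < run_sup t (fst (snd y)) then g (fst y) else 0"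
  have d1: "?d1 \<in> borel_measurable P" unfolding wiener_measurable[OF P] by measurable
  have d2: "?d2 \<in> borel_measurable ?O" unfolding mO by measurable
  have idf: "(\<lambda>w. w) \<in> measurable path_sigma (path_filt t)"
    by (rule measurable_path_filtI) (auto intro: coord_measurable_path_sigma)
  have idP: "(\<lambda>w. w) \<in> measurable P (path_filt t)" unfolding wiener_measurable[OF P] by (rule idf)
  have jm: "joined \<in> measurable ?O (path_filt t)"
    unfolding mO using measurable_compose[OF joined_measurable idf] by simp
  define N1 where "N1 = distr (density P ?d1) (path_filt t) (\<lambda>w. w)"
  define N2 where "N2 = distr (density ?O ?d2) (path_filt t) joined"
  have n1: "(\<integral>\<^sup>+w. F w \<partial>N1) = (\<integral>\<^sup>+w. ?d1 w * F w \<partial>P)" if F: "F \<in> borel_measurable (path_filt t)" for F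
    unfolding N1_def using idP F measurable_compose[OF idP F] d1
    by (subst nn_integral_distr) (simp_all add: nn_integral_density)
  have n2: "(\<integral>\<^sup>+w. F w \<partial>N2) = (\<integral>\<^sup>+z. \<integral>\<^sup>+w. \<integral>\<^sup>+v. (if x < z \<and> z < run_sup t w then g z else 0) * F (joined (z, w, v)) \<partial>triple W \<partial>P \<partial>lborel)"
    if F: "F \<in> borel_measurable (path_filt t)" for F
  proof -
    have Fj: "(\<lambda>y. F (joined y)) \<in> borel_measurable ?O" by (rule measurable_compose[OF jm F])
    have "(\<integral>\<^sup>+w. F w \<partial>N2) = (\<integral>\<^sup>+y. ?d2 y * F (joined y) \<partial>?O)"
      unfolding N2_def using jm F Fj d2
      by (subst nn_integral_distr) (simp_all add: nn_integral_density)
    also have "\<dots> = (\<integral>\<^sup>+z. \<integral>\<^sup>+w. \<integral>\<^sup>+v. ?d2 (z, w, v) * F (joined (z, w, v)) \<partial>triple W \<partial>P \<partial>lborel)"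
      by (rule nn_integral_triple_pair[OF lborel.sigma_finite_measure_axioms P.prob_space_axioms T.prob_space_axioms])
        (intro borel_measurable_times_ennreal d2 Fj)
    finally show ?thesis unfolding fst_conv snd_conv .
  qed
  have "N2 = N1"
  proof (rule coord_algebra_eqI[where I="{0..t}" and t=t])
    show "t \<in> {0..t}" using t by simp
    show "sets N2 = sets (coord_algebra {0..t})" "sets N1 = sets (coord_algebra {0..t})"
      unfolding N1_def N2_def by (simp_all add: path_filt_def)
    show "finite_measure N2"
    proof (rule finite_measureI)
      have "emeasure N2 (space N2) = (\<integral>\<^sup>+w. 1 \<partial>N2)" by simp
      also have "\<dots> = (\<integral>\<^sup>+z. \<integral>\<^sup>+w. \<integral>\<^sup>+v. (if x < z \<and> z < run_sup t w then g z else 0) * 1 \<partial>triple W \<partial>P \<partial>lborel)"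
        by (rule n2) simp
      also have "\<dots> \<le> (\<integral>\<^sup>+z. \<integral>\<^sup>+w. \<integral>\<^sup>+v. g z \<partial>triple W \<partial>P \<partial>lborel)"
        by (intro nn_integral_mono) simp
      also have "\<dots> = (\<integral>\<^sup>+z. g z \<partial>lborel)" by (simp add: P.emeasure_space_1 T.emeasure_space_1)
      also have "\<dots> < \<infinity>" by fact
      finally show "emeasure N2 (space N2) \<noteq> \<infinity>" by simp
    qed
    fix J :: "real set" and f :: "real \<Rightarrow> real \<Rightarrow> real"
    assume J: "finite J" "J \<subseteq> {0..t}" "t \<in> J" and f: "\<And>j. continuous_on UNIV (f j)" "\<And>j u. f j u \<in> {0..1}"
      and fK: "\<And>j. \<exists>K. \<forall>u. K < \<bar>u\<bar> \<longrightarrow> f j u = 0"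
    obtain K where K: "\<And>u. K < \<bar>u\<bar> \<Longrightarrow> f t u = 0" using fK[of t] by auto
    interpret C: cylinder_test t J f K by unfold_locales (use J f K in auto)
    have rm: "(\<lambda>w. ennreal (C.r w)) \<in> borel_measurable (path_filt t)" using C.r_filt by simp
    have "(\<integral>\<^sup>+w. ennreal (C.r w) \<partial>N1) = (\<integral>\<^sup>+w. (if x < run_sup t w then ennreal (C.r w) * ennreal (run_sup t w - w t) else 0) * g (run_sup t w) \<partial>P)"
      unfolding n1[OF rm] by (intro nn_integral_cong) (simp add: mult_ac)
    also have "\<dots> = (\<integral>\<^sup>+z. (if x < z then C.total 0 P W z else 0) * g z \<partial>lborel)"
      by (rule C.passage_identity[OF P W g])
    also have "\<dots> = (\<integral>\<^sup>+w. ennreal (C.r w) \<partial>N2)"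
      unfolding n2[OF rm]
    proof (rule nn_integral_cong)
      fix z :: real
      have jz: "joined (z, w, v) = concat_bes 0 (enn2real (hit_time z w)) w v" for w v by (simp add: joined_def)
      have pm: "(\<lambda>v. ennreal (C.r (concat_bes 0 (enn2real (hit_time z w)) w v))) \<in> borel_measurable (triple W)"
        if "w \<in> paths" for w
        using measurable_compose[OF C.concat_bes_measurable_snd[OF W _ that] C.r_sigma] by simp
      have tm: "(\<lambda>w. if z < run_sup t w then C.post 0 W (enn2real (hit_time z w)) w else 0) \<in> borel_measurable P"
      proof -
        have "(\<lambda>w. (z, w)) \<in> measurable path_sigma (borel \<Otimes>\<^sub>M path_sigma)" by simp
        from measurable_compose[OF this C.total_integrand_measurable[OF W], unfolded fst_conv snd_conv]
        show ?thesis unfolding wiener_measurable[OF P] .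
      qed
      show "(if x < z then C.total 0 P W z else 0) * g z = (\<integral>\<^sup>+w. \<integral>\<^sup>+v. (if x < z \<and> z < run_sup t w then g z else 0) * ennreal (C.r (joined (z, w, v))) \<partial>triple W \<partial>P)"
      proof (cases "x < z")
        case True
        have "(\<integral>\<^sup>+w. \<integral>\<^sup>+v. (if x < z \<and> z < run_sup t w then g z else 0) * ennreal (C.r (joined (z, w, v))) \<partial>triple W \<partial>P)
          = (\<integral>\<^sup>+w. g z * (if z < run_sup t w then C.post 0 W (enn2real (hit_time z w)) w else 0) \<partial>P)"
        proof (rule nn_integral_cong)
          fix w assume "w \<in> space P"
          then have w: "w \<in> paths" using wiener_space[OF P] by simp
          show "(\<integral>\<^sup>+v. (if x < z \<and> z < run_sup t w then g z else 0) * ennreal (C.r (joined (z, w, v))) \<partial>triple W)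
            = g z * (if z < run_sup t w then C.post 0 W (enn2real (hit_time z w)) w else 0)"
            unfolding C.post_def jz using True pm[OF w] by (simp add: nn_integral_cmult)
        qed
        also have "\<dots> = g z * C.total 0 P W z" unfolding C.total_def by (rule nn_integral_cmult[OF tm])
        finally show ?thesis using True by (simp add: mult.commute)
      qed simp
    qed
    finally show "(\<integral>\<^sup>+w. ennreal (\<Prod>j\<in>J. f j (w j)) \<partial>N2) = (\<integral>\<^sup>+w. ennreal (\<Prod>j\<in>J. f j (w j)) \<partial>N1)"
      unfolding C.r_def by simp
  qed
  moreover have "indicator G \<in> borel_measurable (path_filt t)" using G by simp
  ultimately show ?thesis using n1[of "indicator G"] n2[of "indicator G"] by (simp add: mult.commute)
qed

section \<open>Brownian paths are unbounded above\<close>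

lemma emeasure_gauss_singleton: "emeasure (gauss d) {c} = 0"
proof -
  have "emeasure (gauss d) {c} = (\<integral>\<^sup>+u. ennreal (normal_density 0 (sqrt d) u) * indicator {c} u \<partial>lborel)"
    unfolding gauss_def by (subst emeasure_density) auto
  also have "\<dots> = 0"
    by (rule nn_integral_null_set) (simp add: null_sets_def)
  finally show ?thesis .
qed

text \<open>By symmetry the negative half-line has mass 1/2, and the density never exceeds 1 /
  sqrt(2 pi d). For large variance the bound is close to 1/2 whatever K is.\<close>

lemma emeasure_gauss_atMost_le:
  assumes d: "0 < d" and K: "0 \<le> K"
  shows "emeasure (gauss d) {..K} \<le> ennreal (1 / 2 + K / sqrt (2 * pi * d))"
proof -
  interpret prob_space "gauss d" by (rule prob_space_gauss[OF d])
  have "{u::real. - u \<in> {0..}} = {..0}" by auto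
  then have s: "prob {..0} = prob {0..}"
    using emeasure_gauss_uminus[of "{0..}" d] by (simp add: measure_def)
  have "prob UNIV = prob ({..<0} \<union> {0..})" by (rule arg_cong[where f=prob]) auto
  also have "\<dots> = prob {..<0} + prob {0..}" by (rule finite_measure_Union) auto
  also have "prob {..0} = prob ({..<0} \<union> {0})" by (rule arg_cong[where f=prob]) auto
  then have "prob {..0} = prob {..<0} + prob {0}" by (subst (asm) finite_measure_Union) auto
  then have "prob {..<0} = prob {..0}" by (simp add: measure_def emeasure_gauss_singleton)
  finally have half: "prob {..0} = 1 / 2" using s prob_space by simp
  have dens: "normal_density 0 (sqrt d) u \<le> 1 / sqrt (2 * pi * d)" for u
  proof -
    have "normal_density 0 (sqrt d) u = 1 / sqrt (2 * pi * d) * exp (- u\<^sup>2 / (2 * d))"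
      using d by (simp add: normal_density_def)
    also have "\<dots> \<le> 1 / sqrt (2 * pi * d) * 1" using d by (intro mult_left_mono) auto
    finally show ?thesis by simp
  qed
  have "emeasure (gauss d) {0<..K} = (\<integral>\<^sup>+u. ennreal (normal_density 0 (sqrt d) u) * indicator {0<..K} u \<partial>lborel)"
    unfolding gauss_def by (subst emeasure_density) auto
  also have "\<dots> \<le> (\<integral>\<^sup>+u. ennreal (1 / sqrt (2 * pi * d)) * indicator {0<..K} u \<partial>lborel)"
    by (intro nn_integral_mono mult_right_mono ennreal_leI dens) simp
  also have "\<dots> = ennreal (1 / sqrt (2 * pi * d)) * ennreal K"
    using K by (subst nn_integral_cmult_indicator) auto
  also have "\<dots> = ennreal (K / sqrt (2 * pi * d))" using d K by (simp add: ennreal_mult[symmetric])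
  finally have "prob {0<..K} \<le> K / sqrt (2 * pi * d)" using d K by (simp add: emeasure_eq_measure)
  moreover have "prob {..K} = prob ({..0} \<union> {0<..K})" using K by (intro arg_cong[where f=prob]) auto
  moreover have "prob ({..0} \<union> {0<..K}) = prob {..0} + prob {0<..K}" by (rule finite_measure_Union) auto
  ultimately show ?thesis unfolding emeasure_eq_measure using half by (intro ennreal_leI) linarith
qed

text \<open>Whatever happened before time \<open>m\<close>, a sufficiently long increment exceeds any given level with
  probability at least \<open>1/4\<close>; hence staying below \<open>y\<close> forever costs a factor \<open>3/4\<close> over staying
  below \<open>y\<close> up to time \<open>m\<close>, for every \<open>m\<close>.\<close>

lemma wiener_stay_below_null:
  assumes P: "wiener_law x P"
  shows "emeasure P {w \<in> paths. \<forall>i::nat. w (real i) \<le> y} = 0"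
proof -
  interpret prob_space P using wiener_prob[OF P] .
  let ?B = "\<lambda>m::nat. {w \<in> paths. \<forall>i\<in>{..m}. w (real i) \<le> y}" and ?I = "{w \<in> paths. \<forall>i::nat. w (real i) \<le> y}"
  have Bm: "?B m \<in> sets (path_filt (real m))" for m
  proof -
    have "{w \<in> space (path_filt (real m)). \<forall>i\<in>{..m}. w (real i) \<le> y} \<in> sets (path_filt (real m))"
    proof (rule sets.sets_Collect_finite_All')
      fix i assume "i \<in> {..m}"
      then have [measurable]: "(\<lambda>w. w (real i)) \<in> borel_measurable (path_filt (real m))"
        by (intro coord_measurable_filt) auto
      show "{w \<in> space (path_filt (real m)). w (real i) \<le> y} \<in> sets (path_filt (real m))" by measurable
    qed auto
    then show ?thesis by simp
  qed
  have BP: "?B m \<in> events" for m by (rule wiener_path_filt[OF P Bm])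
  have I: "?I = (\<Inter>m. ?B m)" by auto
  have IP: "?I \<in> events" unfolding I using BP by auto
  have low: "{w \<in> paths. w (real m) \<le> y - real k} \<in> events" for m k
  proof -
    have [measurable]: "(\<lambda>w. w (real m)) \<in> borel_measurable P"
      unfolding wiener_measurable[OF P] by (rule coord_measurable_path_sigma) simp
    have "{w \<in> space P. w (real m) \<le> y - real k} \<in> events" by measurable
    then show ?thesis by (simp add: wiener_space[OF P])
  qed
  have step: "prob ?I \<le> prob (?B m) * (3 / 4) + prob {w \<in> paths. w (real m) \<le> y - real k}" for m k
  proof -
    \<comment> \<open>Chosen to make k / sqrt(2 pi n) at most 1/4, which together with 1/2 gives the
      factor 3/4.\<close>
    obtain n :: nat where n: "(4 * real k)\<^sup>2 < real n" using reals_Archimedean2 by blast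
    then have n0: "0 < real n" using zero_le_power2[of "4 * real k"] by linarith
    have "4 * real k = sqrt ((4 * real k)\<^sup>2)" unfolding real_sqrt_abs by simp
    also have "\<dots> \<le> sqrt (2 * pi * real n)"
    proof (rule real_sqrt_le_mono)
      have "1 * real n \<le> 2 * pi * real n" using pi_gt3 by (intro mult_right_mono) auto
      then show "(4 * real k)\<^sup>2 \<le> 2 * pi * real n" using n by simp
    qed
    finally have "real k / sqrt (2 * pi * real n) \<le> 1 / 4"
      using n0 by (simp add: divide_le_eq)
    then have g: "emeasure (gauss (real n)) {..real k} \<le> ennreal (3 / 4)"
      by (intro order_trans[OF emeasure_gauss_atMost_le[OF n0]] ennreal_leI) auto
    let ?D = "{w \<in> paths. w (real m + real n) - w (real m) \<in> {..real k}}"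
    have DP: "?D \<in> events"
      using wiener_incr_set[of "real m" "real m + real n" "{..real k}"] wiener_sets[OF P] by simp
    have "emeasure P (?B m \<inter> ?D) = emeasure P (?B m) * emeasure (gauss (real n)) {..real k}"
      using wiener_indep[where t="real m + real n" and B="{..real k}", OF P _ _ Bm[of m]] n0 by simp
    also have "\<dots> \<le> emeasure P (?B m) * ennreal (3 / 4)" by (intro mult_left_mono g) simp
    finally have "prob (?B m \<inter> ?D) \<le> prob (?B m) * (3 / 4)"
      by (simp add: emeasure_eq_measure ennreal_mult[symmetric])
    \<comment> \<open>A path that never exceeds y is either at most y - k at time m or makes an
      increment of at most k afterwards.\<close>
    moreover have "?I \<subseteq> (?B m \<inter> ?D) \<union> {w \<in> paths. w (real m) \<le> y - real k}"
    proof
      fix w assume "w \<in> ?I"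
      then have w: "w \<in> paths" "\<And>i::nat. w (real i) \<le> y" by auto
      have "w (real m + real n) \<le> y" using w(2)[of "m + n"] by simp
      then show "w \<in> (?B m \<inter> ?D) \<union> {w \<in> paths. w (real m) \<le> y - real k}"
        using w by auto
    qed
    then have "prob ?I \<le> prob ((?B m \<inter> ?D) \<union> {w \<in> paths. w (real m) \<le> y - real k})"
      using BP DP low by (intro finite_measure_mono) auto
    moreover have "prob ((?B m \<inter> ?D) \<union> {w \<in> paths. w (real m) \<le> y - real k})
        \<le> prob (?B m \<inter> ?D) + prob {w \<in> paths. w (real m) \<le> y - real k}"
      using BP DP low by (intro measure_Un_le) auto
    ultimately show ?thesis by linarith
  qed
  \<comment> \<open>Letting k tend to infinity removes the paths that are very low at time
    m.\<close>
  have step2: "prob ?I \<le> prob (?B m) * (3 / 4)" for m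
  proof -
    have "(\<lambda>k. prob {w \<in> paths. w (real m) \<le> y - real k}) \<longlonglongrightarrow> prob (\<Inter>k. {w \<in> paths. w (real m) \<le> y - real k})"
      using low by (intro finite_Lim_measure_decseq) (auto simp: decseq_def)
    moreover have "(\<Inter>k. {w \<in> paths. w (real m) \<le> y - real k}) = {}"
    proof -
      have "\<exists>k::nat. \<not> w (real m) \<le> y - real k" for w
      proof -
        obtain k :: nat where "y - w (real m) < real k" using reals_Archimedean2 by blast
        then show ?thesis by (intro exI[of _ k]) auto
      qed
      then show ?thesis by auto
    qed
    ultimately have "(\<lambda>k. prob (?B m) * (3 / 4) + prob {w \<in> paths. w (real m) \<le> y - real k}) \<longlonglongrightarrow> prob (?B m) * (3 / 4) + 0"
      by (intro tendsto_intros) simp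
    then show ?thesis using step by (intro LIMSEQ_le_const) auto
  qed
  have "(\<lambda>m. prob (?B m)) \<longlonglongrightarrow> prob ?I"
    unfolding I using BP by (intro finite_Lim_measure_decseq) (auto simp: decseq_def)
  then have "(\<lambda>m. prob (?B m) * (3 / 4)) \<longlonglongrightarrow> prob ?I * (3 / 4)" by (intro tendsto_intros)
  then have "prob ?I \<le> prob ?I * (3 / 4)" using step2 by (intro LIMSEQ_le_const) auto
  then have "prob ?I = 0" using measure_nonneg[of P ?I] by linarith
  then show ?thesis by (simp add: emeasure_eq_measure)
qed

text \<open>Integer levels suffice, and \<open>wiener_stay_below_null\<close> inspects the path only
  at integer times, so the exceptional set is a countable union of measurable null sets.\<close>

lemma wiener_unbounded:
  assumes P: "wiener_law x P" shows "AE w in P. \<forall>y. \<exists>u\<ge>0. y < w u"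
proof -
  have "AE w in P. \<not> (w \<in> paths \<and> (\<forall>i::nat. w (real i) \<le> real k))" for k :: nat
  proof (rule AE_I)
    show "emeasure P {w \<in> paths. \<forall>i::nat. w (real i) \<le> real k} = 0"
      by (rule wiener_stay_below_null[OF P])
    have "{w \<in> space path_sigma. \<forall>i::nat. w (real i) \<le> real k} \<in> sets path_sigma"
    proof (rule sets.sets_Collect_countable_All)
      fix i :: nat
      have [measurable]: "(\<lambda>w. w (real i)) \<in> borel_measurable path_sigma" by (rule coord_measurable_path_sigma) simp
      show "{w \<in> space path_sigma. w (real i) \<le> real k} \<in> sets path_sigma" by measurable
    qed
    then show "{w \<in> paths. \<forall>i::nat. w (real i) \<le> real k} \<in> sets P" using wiener_sets[OF P] by simp
  qed auto
  then have "AE w in P. \<forall>k::nat. \<not> (w \<in> paths \<and> (\<forall>i::nat. w (real i) \<le> real k))"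
    unfolding AE_all_countable by blast
  then show ?thesis
    using AE_space
  proof eventually_elim
    case (elim w)
    show ?case
    proof
      fix y :: real
      obtain k :: nat where k: "y < real k" using reals_Archimedean2 by blast
      from elim obtain i :: nat where "real k < w (real i)" using wiener_space[OF P] by (auto simp: not_le)
      then show "\<exists>u\<ge>0. y < w u" using k by (intro exI[of _ "real i"]) auto
    qed
  qed
qed

lemma hit_time_finite:
  assumes w: "w \<in> paths" and w0: "w 0 \<le> z" and ex: "\<exists>u\<ge>0. z < w u"
  shows "hit_time z w < \<infinity>"
proof -
  obtain u where u: "0 \<le> u" "z < w u" using ex by auto
  have "\<exists>s\<ge>0. s \<le> u \<and> w s = z"
    by (rule IVT'[where f=w, OF w0]) (use u paths_continuous_subset[OF w] in auto)
  then obtain s where s: "0 \<le> s" "w s = z" by auto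
  have "hit_time z w \<le> ennreal s" unfolding hit_time_def by (rule INF_lower) (use s in auto)
  then show ?thesis by (rule le_less_trans) simp
qed

section \<open>The maximum of Brownian motion on a compact interval is unique\<close>

lemma isup_shift:
  assumes w: "w \<in> paths" and "0 \<le> a" "a \<le> b" and r: "0 \<le> r"
  shows "isup (r + a) (r + b) w = w r + isup a b (shift_path r w)"
proof -
  obtain u where u: "u \<in> {a..b}" "shift_path r w u = isup a b (shift_path r w)"
    using isup_attained[OF shift_path_in_paths[OF r w] assms(2,3)] .
  show ?thesis
  proof (rule isup_eqI[OF w])
    show "r + u \<in> {r + a..r + b}" "0 \<le> r + a" using u r assms by auto
    show "w (r + u) = w r + isup a b (shift_path r w)" using u assms by (simp add: shift_path_def)
    fix v assume v: "v \<in> {r + a..r + b}"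
    have "shift_path r w (v - r) \<le> isup a b (shift_path r w)"
      by (rule isup_ge[OF shift_path_in_paths[OF r w] assms(2)]) (use v in auto)
    then show "w v \<le> w r + isup a b (shift_path r w)" using v assms by (simp add: shift_path_def)
  qed
qed

lemma isup_fixed_measurable: "0 \<le> a \<Longrightarrow> a \<le> b \<Longrightarrow> isup a b \<in> borel_measurable path_sigma"
  by (rule isup_measurable[where f="\<lambda>w. w"]) auto

lemma wiener_coord_atomless:
  assumes W: "wiener_law 0 W" and r: "0 < r" shows "AE w in W. w r \<noteq> c"
proof -
  have sp: "paths \<in> sets (path_filt 0)" using sets.top[of "path_filt 0"] by simp
  have "emeasure W (paths \<inter> {w \<in> paths. w r - w 0 \<in> {c}}) = 0"
    using wiener_indep[OF W _ r sp, of "{c}"] by (simp add: emeasure_gauss_singleton)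
  then have "AE w in W. \<not> (w \<in> paths \<and> w r - w 0 = c)"
    using wiener_incr_set[of 0 r "{c}"] r wiener_sets[OF W]
    by (intro AE_I[where N="{w \<in> paths. w r - w 0 \<in> {c}}"]) (auto simp: Int_absorb1)
  then show ?thesis using wiener_start[OF W] AE_space
    by eventually_elim (auto simp: wiener_space[OF W])
qed

text \<open>Fubini in the Markov property: a relation between past and future holds almost surely as
  soon as it holds for almost every future with each past frozen.\<close>

lemma weak_markov_AE:
  assumes P: "wiener_law x P" and W: "wiener_law 0 W" and s: "0 \<le> s"
    and m: "Measurable.pred (path_sigma \<Otimes>\<^sub>M path_sigma) R"
    and AE: "\<And>w. w \<in> paths \<Longrightarrow> AE v in W. R (stop_path s w, v)"
  shows "AE w in P. R (stop_path s w, shift_path s w)"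
proof -
  have mp: "(\<lambda>w. (stop_path s w, shift_path s w)) \<in> measurable path_sigma (path_sigma \<Otimes>\<^sub>M path_sigma)"
    by (intro measurable_Pair stop_path_measurable' shift_path_measurable s)
  define F :: "_ \<Rightarrow> ennreal" where "F = (\<lambda>y. if R y then 0 else 1)"
  have Fm: "F \<in> borel_measurable (path_sigma \<Otimes>\<^sub>M path_sigma)" unfolding F_def using m by measurable
  have "(\<integral>\<^sup>+w. F (stop_path s w, shift_path s w) \<partial>P) = (\<integral>\<^sup>+w. \<integral>\<^sup>+v. F (stop_path s w, v) \<partial>W \<partial>P)"
    by (rule weak_markov_nn_integral[OF P W s Fm])
  also have "\<dots> = (\<integral>\<^sup>+w. 0 \<partial>P)"
  proof (rule nn_integral_cong)
    fix w assume "w \<in> space P"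
    then have "AE v in W. F (stop_path s w, v) = 0"
      using AE[of w] wiener_space[OF P] unfolding F_def by (auto elim: eventually_mono)
    then have "(\<integral>\<^sup>+v. F (stop_path s w, v) \<partial>W) = (\<integral>\<^sup>+v. 0 \<partial>W)" by (rule nn_integral_cong_AE)
    then show "(\<integral>\<^sup>+v. F (stop_path s w, v) \<partial>W) = 0" by simp
  qed
  finally have "(\<integral>\<^sup>+w. F (stop_path s w, shift_path s w) \<partial>P) = 0" by simp
  moreover have "(\<lambda>w. F (stop_path s w, shift_path s w)) \<in> borel_measurable P"
    unfolding wiener_measurable[OF P] by (rule measurable_compose[OF mp Fm])
  ultimately have "AE w in P. F (stop_path s w, shift_path s w) = 0"
    by (simp add: nn_integral_0_iff_AE)
  then show ?thesis unfolding F_def by (auto elim!: eventually_mono split: if_splits)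
qed

text \<open>The supremum over [r, b] is the sum of w r, which is Gaussian because r > 0, and a
  supremum of the shifted path, which is independent of w r. A sum with an independent atomless term
  has no atoms.\<close>

lemma wiener_isup_atomless:
  assumes W: "wiener_law 0 W" and r: "0 < r" "r \<le> b" shows "AE w in W. isup r b w \<noteq> c"
proof -
  interpret W: prob_space W using wiener_prob[OF W] .
  interpret pair_sigma_finite W W ..
  define S where "S = isup 0 (b - r)"
  have Sm[measurable]: "S \<in> borel_measurable path_sigma" unfolding S_def using r by (intro isup_fixed_measurable) auto
  have rm[measurable]: "(\<lambda>w. w r) \<in> borel_measurable path_sigma" using r by (intro coord_measurable_path_sigma) simp
  have mp: "(\<lambda>w. (w r, shift_path r w)) \<in> measurable path_sigma (borel \<Otimes>\<^sub>M path_sigma)"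
    using r by (intro measurable_Pair rm shift_path_measurable) simp
  let ?F = "\<lambda>y. if fst y r + S (snd y) = c then 1 else 0 :: ennreal"
  have Fm: "?F \<in> borel_measurable (path_sigma \<Otimes>\<^sub>M path_sigma)" by measurable
  have FmW: "?F \<in> borel_measurable (W \<Otimes>\<^sub>M W)"
    using Fm wiener_sets[OF W] by (simp cong: measurable_cong_sets sets_pair_measure_cong)
  have "(\<integral>\<^sup>+w. ?F (stop_path r w, shift_path r w) \<partial>W) = (\<integral>\<^sup>+w. \<integral>\<^sup>+v. ?F (stop_path r w, v) \<partial>W \<partial>W)"
    using r by (intro weak_markov_nn_integral[OF W W _ Fm]) simp
  also have "\<dots> = (\<integral>\<^sup>+w. \<integral>\<^sup>+v. ?F (w, v) \<partial>W \<partial>W)" using r by (simp add: stop_path_def)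
  \<comment> \<open>The variable of the path before r is integrated first, since it carries the
    atomless term.\<close>
  also have "\<dots> = (\<integral>\<^sup>+v. \<integral>\<^sup>+w. ?F (w, v) \<partial>W \<partial>W)"
    using Fubini'[of "\<lambda>w v. ?F (w, v)"] FmW by (simp add: split_beta')
  also have "\<dots> = (\<integral>\<^sup>+v. 0 \<partial>W)"
  proof (rule nn_integral_cong)
    fix v
    have "AE w in W. ?F (w, v) = 0" using wiener_coord_atomless[OF W r(1), of "c - S v"] by eventually_elim auto
    then have "(\<integral>\<^sup>+w. ?F (w, v) \<partial>W) = (\<integral>\<^sup>+w. 0 \<partial>W)" by (rule nn_integral_cong_AE)
    then show "(\<integral>\<^sup>+w. ?F (w, v) \<partial>W) = 0" by simp
  qed
  finally have "(\<integral>\<^sup>+w. (if w r + S (shift_path r w) = c then 1 else 0 :: ennreal) \<partial>W) = 0"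
    using r by (simp add: stop_path_def)
  moreover have "(\<lambda>w. if w r + S (shift_path r w) = c then 1 else 0 :: ennreal) \<in> borel_measurable W"
  proof -
    have [measurable]: "(\<lambda>w. S (shift_path r w)) \<in> borel_measurable path_sigma"
      using r by (intro measurable_compose[OF shift_path_measurable Sm]) simp
    show ?thesis unfolding wiener_measurable[OF W] by measurable
  qed
  ultimately have "AE w in W. (if w r + S (shift_path r w) = c then 1 else 0 :: ennreal) = 0"
    by (simp add: nn_integral_0_iff_AE)
  then show ?thesis using AE_space
  proof eventually_elim
    case (elim w)
    then show ?case
      using isup_shift[of w 0 "b - r" r] r wiener_space[OF W] unfolding S_def by (auto split: if_splits)
  qed
qed

text \<open>Given the path up to q, the maximum over [0, q] is a constant, while the maximum over
  [q', b] is w q plus an atomless variable, because q' - q > 0.\<close>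

lemma wiener_no_double_max:
  assumes P: "wiener_law x P" and W: "wiener_law 0 W" and q: "0 < q" "q < q'" "q' \<le> b"
  shows "AE w in P. isup 0 q w \<noteq> isup q' b w"
proof -
  define S where "S = isup (q' - q) (b - q)"
  have Sm[measurable]: "S \<in> borel_measurable path_sigma" unfolding S_def using q by (intro isup_fixed_measurable) auto
  have [measurable]: "isup 0 q \<in> borel_measurable path_sigma" using q by (intro isup_fixed_measurable) auto
  have [measurable]: "(\<lambda>w. w q) \<in> borel_measurable path_sigma" using q by (intro coord_measurable_path_sigma) simp
  have "AE w in P. isup 0 q (fst (stop_path q w, shift_path q w)) \<noteq>
      fst (stop_path q w, shift_path q w) q + S (snd (stop_path q w, shift_path q w))"
  proof (rule weak_markov_AE[OF P W])
    fix w assume "w \<in> paths"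
    have "AE v in W. S v \<noteq> isup 0 q (stop_path q w) - stop_path q w q"
      unfolding S_def by (rule wiener_isup_atomless[OF W]) (use q in auto)
    then show "AE v in W. isup 0 q (fst (stop_path q w, v)) \<noteq> fst (stop_path q w, v) q + S (snd (stop_path q w, v))"
      by eventually_elim auto
  qed (use q in \<open>simp, measurable\<close>)
  then show ?thesis using AE_space
  proof eventually_elim
    case (elim w)
    then have w: "w \<in> paths" using wiener_space[OF P] by simp
    have "isup 0 q (stop_path q w) = isup 0 q w"
      unfolding isup_def by (rule arg_cong[where f=Sup], rule image_cong) (auto simp: stop_path_def)
    moreover have "isup q' b w = w q + S (shift_path q w)"
      using isup_shift[OF w, of "q' - q" "b - q" q] q unfolding S_def by simp
    ultimately show ?case using elim q by (simp add: stop_path_def)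
  qed
qed

section \<open>The path functionals at the maximum\<close>

lemma path_upto_measurable:
  assumes f: "f \<in> measurable M path_sigma" and c[measurable]: "c \<in> borel_measurable M"
  shows "(\<lambda>y. path_upto (c y) (f y)) \<in> measurable M upto_algebra"
  unfolding path_upto_def upto_algebra_def
proof (rule measurable_Pair[OF c], rule measurable_path_sigmaI)
  fix y assume "y \<in> space M"
  then have fy: "f y \<in> paths" using measurable_space[OF f] by simp
  show "(\<lambda>u\<in>{0..}. f y (if ennreal u \<le> c y then u else enn2real (c y))) \<in> paths"
  proof (cases "c y")
    case (real s)
    have "(\<lambda>u\<in>{0..}. f y (if ennreal u \<le> c y then u else enn2real (c y))) = stop_path s (f y)"
      unfolding stop_path_def
    proof (rule restrict_ext)
      fix u :: real assume "u \<in> {0..}"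
      then show "f y (if ennreal u \<le> c y then u else enn2real (c y)) = f y (min u s)"
        using real by (simp add: min_def)
    qed
    then show ?thesis using stop_path_in_paths[OF _ fy] real by simp
  next
    case top
    then have "(\<lambda>u\<in>{0..}. f y (if ennreal u \<le> c y then u else enn2real (c y))) = restrict (f y) {0..}" by simp
    then show ?thesis using restrict_in_paths[OF paths_continuous[OF fy]] by simp
  qed
next
  fix u :: real assume u: "0 \<le> u"
  have "(\<lambda>y. f y (if ennreal u \<le> c y then u else enn2real (c y))) \<in> borel_measurable M"
    by (rule measurable_path_eval[OF f]) (use u in auto)
  then show "(\<lambda>y. (\<lambda>u\<in>{0..}. f y (if ennreal u \<le> c y then u else enn2real (c y))) u) \<in> borel_measurable M"
    using u by simp
qed

lemma sup_inf_eq_SUP: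
  assumes w: "w \<in> paths" shows "sup_inf w = (SUP n::nat. ereal (isup 0 (real n) w))"
proof (rule antisym)
  show "sup_inf w \<le> (SUP n::nat. ereal (isup 0 (real n) w))"
    unfolding sup_inf_def
  proof (rule SUP_least)
    fix u :: real assume u: "u \<in> {0..}"
    obtain n :: nat where n: "u < real n" using reals_Archimedean2 by blast
    have "ereal (w u) \<le> ereal (isup 0 (real n) w)" using isup_ge[OF w order_refl, of u "real n"] u n by simp
    also have "\<dots> \<le> (SUP n::nat. ereal (isup 0 (real n) w))" by (rule SUP_upper) simp
    finally show "ereal (w u) \<le> (SUP n::nat. ereal (isup 0 (real n) w))" .
  qed
  show "(SUP n::nat. ereal (isup 0 (real n) w)) \<le> sup_inf w"
  proof (rule SUP_least)
    fix n :: nat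
    obtain u where u: "u \<in> {0..real n}" "w u = isup 0 (real n) w" using isup_attained[OF w order_refl, of "real n"] by auto
    have "ereal (w u) \<le> sup_inf w" unfolding sup_inf_def by (rule SUP_upper) (use u in auto)
    then show "ereal (isup 0 (real n) w) \<le> sup_inf w" using u by simp
  qed
qed

lemma sup_inf_measurable: "sup_inf \<in> borel_measurable path_sigma"
proof -
  have [measurable]: "isup 0 (real n) \<in> borel_measurable path_sigma" for n by (rule isup_fixed_measurable) auto
  have "(\<lambda>w. SUP n::nat. ereal (isup 0 (real n) w)) \<in> borel_measurable path_sigma" by measurable
  then show ?thesis by (subst measurable_cong[OF sup_inf_eq_SUP]) auto
qed

lemma le_sup_inf: "0 \<le> u \<Longrightarrow> ereal (w u) \<le> sup_inf w"
  unfolding sup_inf_def by (rule SUP_upper) auto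

text \<open>Compactness: a maximum over [q, m] that equals the overall supremum is attained at a
  time which is at least q > r. Rational q and integer m make the condition a countable union, hence
  measurable.\<close>

lemma less_last_max_iff:
  assumes w: "w \<in> paths" and r: "0 \<le> r"
  shows "ennreal r < last_max w \<longleftrightarrow> (\<exists>q\<in>\<rat> \<inter> {r<..}. \<exists>m\<in>{m::nat. q \<le> real m}. ereal (isup q (real m) w) = sup_inf w)"
proof
  assume "ennreal r < last_max w"
  then obtain u where u: "0 \<le> u" "ereal (w u) = sup_inf w" "ennreal r < ennreal u"
    unfolding last_max_def less_SUP_iff by auto
  then have ru: "r < u" using r by (simp add: ennreal_less_iff)
  obtain q where q: "q \<in> \<rat>" "r < q" "q < u" using Rats_dense_in_real[OF ru] by auto
  obtain m :: nat where m: "u < real m" using reals_Archimedean2 by blast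
  have "isup q (real m) w = w u"
  proof (rule isup_eqI[OF w])
    fix v assume "v \<in> {q..real m}"
    then have "ereal (w v) \<le> ereal (w u)" unfolding u(2) using q r by (intro le_sup_inf) auto
    then show "w v \<le> w u" by simp
  qed (use q m r in auto)
  then show "\<exists>q\<in>\<rat> \<inter> {r<..}. \<exists>m\<in>{m::nat. q \<le> real m}. ereal (isup q (real m) w) = sup_inf w"
    using q m u by (intro bexI[of _ q] bexI[of _ m]) auto
next
  assume "\<exists>q\<in>\<rat> \<inter> {r<..}. \<exists>m\<in>{m::nat. q \<le> real m}. ereal (isup q (real m) w) = sup_inf w"
  then obtain q m where q: "r < q" "q \<le> real m" "ereal (isup q (real m) w) = sup_inf w" by auto
  obtain u where u: "u \<in> {q..real m}" "w u = isup q (real m) w" using isup_attained[OF w _ q(2)] q r by auto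
  show "ennreal r < last_max w"
    unfolding last_max_def less_SUP_iff
    by (rule bexI[of _ u]) (use u q r in \<open>auto simp: ennreal_less_iff\<close>)
qed

lemma last_max_measurable: "last_max \<in> borel_measurable path_sigma"
proof (rule borel_measurableI_greater)
  fix y :: ennreal
  show "{w \<in> space path_sigma. y < last_max w} \<in> sets path_sigma"
  proof (cases y)
    case (real r)
    have c1: "countable (\<rat> \<inter> {r<..})" by (intro countable_Int1 countable_rat)
    have "Measurable.pred path_sigma (\<lambda>w. \<exists>q\<in>\<rat> \<inter> {r<..}. \<exists>m\<in>{m::nat. q \<le> real m}. ereal (isup q (real m) w) = sup_inf w)"
    proof (intro measurable_pred_countable c1)
      fix q m assume "q \<in> \<rat> \<inter> {r<..}" "m \<in> {m::nat. q \<le> real m}"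
      then have "isup q (real m) \<in> borel_measurable path_sigma"
        using real by (intro isup_fixed_measurable) auto
      then have m: "(\<lambda>w. ereal (isup q (real m) w)) \<in> borel_measurable path_sigma" by simp
      have "{w \<in> space path_sigma. ereal (isup q (real m) w) = sup_inf w}
        = {w \<in> space path_sigma. ereal (isup q (real m) w) \<le> sup_inf w}
          \<inter> {w \<in> space path_sigma. sup_inf w \<le> ereal (isup q (real m) w)}" by auto
      also have "\<dots> \<in> sets path_sigma"
        by (intro sets.Int borel_measurable_le m sup_inf_measurable)
      finally show "Measurable.pred path_sigma (\<lambda>w. ereal (isup q (real m) w) = sup_inf w)"
        unfolding pred_def .
    qed auto
    moreover have "{w \<in> space path_sigma. y < last_max w}
      = {w \<in> space path_sigma. \<exists>q\<in>\<rat> \<inter> {r<..}. \<exists>m\<in>{m::nat. q \<le> real m}. ereal (isup q (real m) w) = sup_inf w}"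
      unfolding real(2) using less_last_max_iff[OF _ real(1)] by auto
    ultimately show ?thesis by (simp add: pred_def)
  qed simp
qed

lemma pre_max_measurable: "pre_max \<in> measurable path_sigma upto_algebra"
  unfolding pre_max_def by (rule path_upto_measurable[OF _ last_max_measurable]) simp

lemma post_max_measurable: "post_max \<in> measurable path_sigma path_sigma"
proof (rule measurable_path_sigmaI)
  note [measurable] = last_max_measurable
  have id: "(\<lambda>w. w) \<in> measurable path_sigma path_sigma" by simp
  show "post_max w \<in> paths" if "w \<in> space path_sigma" for w
  proof -
    have w: "w \<in> paths" using that by simp
    show ?thesis unfolding post_max_def
      by (rule restrict_in_paths, rule continuous_on_diff[OF continuous_on_const],
          rule paths_comp[OF w, where g="\<lambda>u. u + enn2real (last_max w)"]) (auto intro!: continuous_intros)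
  qed
  fix u :: real assume u: "0 \<le> u"
  have "(\<lambda>w. w (enn2real (last_max w))) \<in> borel_measurable path_sigma"
    by (rule measurable_path_eval[OF id]) auto
  moreover have "(\<lambda>w. w (u + enn2real (last_max w))) \<in> borel_measurable path_sigma"
    by (rule measurable_path_eval[OF id]) (use u in auto)
  ultimately show "(\<lambda>w. post_max w u) \<in> borel_measurable path_sigma" using u by (simp add: post_max_def)
qed

definition unique_max :: "(real \<Rightarrow> real) \<Rightarrow> bool" where
  "unique_max w \<longleftrightarrow> \<not> (\<exists>u v. 0 \<le> u \<and> u < v \<and> w u = w v \<and> (\<forall>s\<ge>0. w s \<le> w v))"

text \<open>Two maximum times u < v are separated by rationals q < q' between them, and then the
  maxima over [0, q] and over [q', m] both equal the overall maximum. Countably many exceptional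
  events thus cover all double maxima.\<close>

lemma unique_maxI:
  assumes w: "w \<in> paths"
    and ne: "\<forall>q\<in>\<rat>. \<forall>q'\<in>\<rat>. \<forall>m::nat. 0 < q \<and> q < q' \<and> q' \<le> real m \<longrightarrow> isup 0 q w \<noteq> isup q' (real m) w"
  shows "unique_max w"
  unfolding unique_max_def
proof (clarify)
  fix u v assume uv: "0 \<le> u" "u < v" "w u = w v" "\<forall>s\<ge>0. w s \<le> w v"
  obtain q where q: "q \<in> \<rat>" "u < q" "q < v" using Rats_dense_in_real[OF uv(2)] by auto
  obtain q' where q': "q' \<in> \<rat>" "q < q'" "q' < v" using Rats_dense_in_real[OF q(3)] by auto
  obtain m :: nat where m: "v < real m" using reals_Archimedean2 by blast
  have "isup 0 q w = w v" by (rule isup_eqI[OF w, of _ u]) (use uv q in auto)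
  moreover have "isup q' (real m) w = w v" by (rule isup_eqI[OF w, of _ v]) (use uv q q' m in auto)
  moreover have "isup 0 q w \<noteq> isup q' (real m) w"
    by (rule ne[rule_format]) (use q q' m uv in auto)
  ultimately show False by simp
qed

lemma path_below_before_hit:
  assumes w: "w \<in> paths" and w0: "w 0 < z" and ne: "\<And>u. 0 \<le> u \<Longrightarrow> u < s \<Longrightarrow> w u \<noteq> z"
    and u: "0 \<le> u" "u < s"
  shows "w u < z"
proof (rule ccontr)
  assume "\<not> w u < z"
  then have "\<exists>r\<ge>0. r \<le> u \<and> w r = z"
    by (intro IVT'[where f=w]) (use w0 u paths_continuous_subset[OF w] in auto)
  then show False using ne u by (metis le_less_trans)
qed

text \<open>A deterministic statement: the path is below z before the hitting time by the
  intermediate value theorem, equals z there and is at most z afterwards since b >= 0. A return of b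
  to 0 would be a second maximum time, which \<open>unique_max\<close> forbids, so the last maximum
  time is the hitting time.\<close>

lemma joined_decomposition:
  assumes w: "w \<in> paths" "w 0 < z" "hit_time z w < \<infinity>"
    and v: "b \<in> paths" "b 0 = 0" "\<And>u. 0 \<le> u \<Longrightarrow> 0 \<le> b u"
    and Y: "Y = glue (enn2real (hit_time z w)) w (sub_path 0 b)" and um: "unique_max Y"
  shows "sup_inf Y = ereal z" "0 < last_max Y" "last_max Y < \<infinity>"
    "pre_max Y = path_upto (hit_time z w) w" "post_max Y = b"
proof -
  obtain s where s: "0 \<le> s" "w s = z" "\<And>u. 0 \<le> u \<Longrightarrow> u < s \<Longrightarrow> w u \<noteq> z" "hit_time z w = ennreal s"
    using hit_time_attained[OF w(1,3)] by metis
  have hs: "enn2real (hit_time z w) = s" using s by simp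
  have s0: "0 < s" using s(1,2) w(2) by (cases "s = 0") auto
  have pre: "Y u = w u" if "0 \<le> u" "u \<le> s" for u
    using that v(2) unfolding Y hs by (simp add: glue_def sub_path_def)
  have post: "Y u = z - b (u - s)" if "s \<le> u" for u
    using that v(2) s unfolding Y hs by (simp add: glue_def sub_path_def)
  have Ys: "Y s = z" using pre[of s] s by simp
  have le: "Y u \<le> z" if "0 \<le> u" for u
  proof (cases "u < s")
    case True
    then show ?thesis using path_below_before_hit[OF w(1,2) s(3) that True] pre[of u] that by simp
  next
    case False then show ?thesis using post[of u] v(3)[of "u - s"] by simp
  qed
  show S: "sup_inf Y = ereal z"
    unfolding sup_inf_def
  proof (rule antisym)
    show "(SUP u\<in>{0..}. ereal (Y u)) \<le> ereal z" by (rule SUP_least) (use le in auto)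
    have "ereal (Y s) \<le> (SUP u\<in>{0..}. ereal (Y u))" by (rule SUP_upper) (use s in auto)
    then show "ereal z \<le> (SUP u\<in>{0..}. ereal (Y u))" using Ys by simp
  qed
  have uniq: "u = s" if "0 \<le> u" "Y u = z" for u
  proof (rule ccontr)
    assume "u \<noteq> s"
    then consider "u < s" | "s < u" by linarith
    then show False
    proof cases
      case 1 then show False using um that le s(1) Ys unfolding unique_max_def by metis
    next
      case 2 then show False using um that le s(1) Ys unfolding unique_max_def by metis
    qed
  qed
  have "{u. 0 \<le> u \<and> ereal (Y u) = sup_inf Y} = {s}"
  proof (intro equalityI subsetI)
    fix u assume "u \<in> {u. 0 \<le> u \<and> ereal (Y u) = sup_inf Y}"
    then have "0 \<le> u" "Y u = z" using S by simp_all
    then show "u \<in> {s}" using uniq by blast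
  next
    fix u assume "u \<in> {s}"
    then show "u \<in> {u. 0 \<le> u \<and> ereal (Y u) = sup_inf Y}" using S s(1) Ys by simp
  qed
  then have L: "last_max Y = ennreal s" unfolding last_max_def by simp
  show "0 < last_max Y" "last_max Y < \<infinity>" unfolding L using s0 by auto
  show "pre_max Y = path_upto (hit_time z w) w"
    unfolding pre_max_def L s(4) path_upto_def
  proof (intro arg_cong2[where f=Pair] refl restrict_ext)
    fix u :: real assume "u \<in> {0..}"
    then show "Y (if ennreal u \<le> ennreal s then u else enn2real (ennreal s))
        = w (if ennreal u \<le> ennreal s then u else enn2real (ennreal s))"
      using pre s by auto
  qed
  have "post_max Y \<in> paths"
  proof -
    have "Y \<in> paths" unfolding Y by (intro glue_in_paths w(1) sub_path_in_paths v(1)) simp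
    then show ?thesis using measurable_space[OF post_max_measurable, of Y] by simp
  qed
  then show "post_max Y = b"
  proof (rule paths_eqI[OF _ v(1)])
    fix u :: real assume u: "0 \<le> u"
    then show "post_max Y u = b u" unfolding post_max_def L using s Ys post[of "u + s"] by simp
  qed
qed

lemma AE_fst:
  assumes N: "prob_space N" and AE: "AE x in M. R x" shows "AE y in M \<Otimes>\<^sub>M N. R (fst y)"
proof -
  interpret N: prob_space N by fact
  from AE obtain A where A: "A \<in> sets M" "emeasure M A = 0" "{x \<in> space M. \<not> R x} \<subseteq> A" by (auto elim: AE_E)
  show ?thesis
  proof (rule AE_I[where N="A \<times> space N"])
    show "{y \<in> space (M \<Otimes>\<^sub>M N). \<not> R (fst y)} \<subseteq> A \<times> space N" using A(3) by (auto simp: space_pair_measure)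
    show "A \<times> space N \<in> sets (M \<Otimes>\<^sub>M N)" using A(1) by simp
    show "emeasure (M \<Otimes>\<^sub>M N) (A \<times> space N) = 0"
      using N.emeasure_pair_measure_Times[OF A(1), of "space N"] A(2) by simp
  qed
qed

lemma AE_snd:
  assumes N: "prob_space N" and AE: "AE x in N. R x" shows "AE y in M \<Otimes>\<^sub>M N. R (snd y)"
proof -
  interpret N: prob_space N by fact
  from AE obtain A where A: "A \<in> sets N" "emeasure N A = 0" "{x \<in> space N. \<not> R x} \<subseteq> A" by (auto elim: AE_E)
  show ?thesis
  proof (rule AE_I[where N="space M \<times> A"])
    show "{y \<in> space (M \<Otimes>\<^sub>M N). \<not> R (snd y)} \<subseteq> space M \<times> A" using A(3) by (auto simp: space_pair_measure)
    show "space M \<times> A \<in> sets (M \<Otimes>\<^sub>M N)" using A(1) by simp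
    show "emeasure (M \<Otimes>\<^sub>M N) (space M \<times> A) = 0"
      using N.emeasure_pair_measure_Times[OF sets.top A(1), of M] A(2) by simp
  qed
qed

text \<open>Generators look only at coordinates up to t, and not distinguishing v from w is stable
  under complements and countable unions.\<close>

lemma path_filt_determined:
  assumes G: "G \<in> sets (path_filt t)" and v: "v \<in> paths" and w: "w \<in> paths"
    and eq: "\<And>u. 0 \<le> u \<Longrightarrow> u \<le> t \<Longrightarrow> v u = w u"
  shows "v \<in> G \<longleftrightarrow> w \<in> G"
proof -
  have "G \<in> sigma_sets paths {{w \<in> paths. w s \<in> A} | s A. s \<in> {0..t} \<and> A \<in> sets (borel :: real measure)}"
    using G unfolding path_filt_def sets_coord_algebra .
  then show ?thesis
  proof (induction rule: sigma_sets.induct)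
    case (Basic a) then show ?case using v w eq by auto
  qed (use v w in auto)
qed

section \<open>The penalised law\<close>

locale penalised_wiener =
  fixes \<phi> :: "real \<Rightarrow> real" and x :: real and P W Q :: "(real \<Rightarrow> real) measure"
  assumes phi_m [measurable]: "\<phi> \<in> borel_measurable borel" and phi_pos: "\<And>u. 0 < \<phi> u"
    and phi_int: "has_bochner_integral lborel \<phi> 1"
    and P: "wiener_law x P" and W: "wiener_law 0 W"
    and Q: "prob_space Q" and sets_Q: "sets Q = sets path_sigma"
    and Q_eq: "\<And>t G. 0 \<le> t \<Longrightarrow> G \<in> sets (path_filt t) \<Longrightarrow>
      measure Q G = 1 / (1 - Phi \<phi> x) * (\<integral>w. indicator G w * mart \<phi> t w \<partial>P)"
begin

sublocale P: prob_space P by (rule wiener_prob[OF P])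
sublocale W: prob_space W by (rule wiener_prob[OF W])
sublocale T: prob_space "triple W" by (rule triple_prob[OF W.prob_space_axioms])
sublocale Q: prob_space Q by (rule Q)

lemma phi_tail:
  "(\<integral>\<^sup>+z. ennreal (\<phi> z) * indicator {s<..} z \<partial>lborel) = ennreal (1 - Phi \<phi> s)" "Phi \<phi> s \<le> 1"
proof -
  have i: "integrable lborel \<phi>" "(\<integral>z. \<phi> z \<partial>lborel) = 1" using phi_int by (auto simp: has_bochner_integral_iff)
  have i1: "integrable lborel (\<lambda>z. indicator {..s} z * \<phi> z)"
    and i2: "integrable lborel (\<lambda>z. \<phi> z * indicator {s<..} z)"
    using integrable_mult_indicator[OF _ i(1), of "{..s}"] integrable_mult_indicator[OF _ i(1), of "{s<..}"]
    by (simp_all add: mult.commute)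
  have "1 = (\<integral>z. indicator {..s} z * \<phi> z + \<phi> z * indicator {s<..} z \<partial>lborel)"
    unfolding i(2)[symmetric] by (rule Bochner_Integration.integral_cong) (auto simp: indicator_def)
  also have "\<dots> = Phi \<phi> s + (\<integral>z. \<phi> z * indicator {s<..} z \<partial>lborel)"
    using i1 i2 unfolding Phi_def set_lebesgue_integral_def by simp
  finally have e: "(\<integral>z. \<phi> z * indicator {s<..} z \<partial>lborel) = 1 - Phi \<phi> s" by simp
  have "(\<integral>\<^sup>+z. ennreal (\<phi> z * indicator {s<..} z) \<partial>lborel) = ennreal (\<integral>z. \<phi> z * indicator {s<..} z \<partial>lborel)"
    using i2 phi_pos by (intro nn_integral_eq_integral AE_I2) (auto simp: less_imp_le)
  then show "(\<integral>\<^sup>+z. ennreal (\<phi> z) * indicator {s<..} z \<partial>lborel) = ennreal (1 - Phi \<phi> s)"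
    unfolding e by (simp add: ennreal_mult' ennreal_indicator less_imp_le[OF phi_pos])
  have "0 \<le> (\<integral>z. \<phi> z * indicator {s<..} z \<partial>lborel)"
    using phi_pos by (intro Bochner_Integration.integral_nonneg) (auto simp: less_imp_le)
  then show "Phi \<phi> s \<le> 1" using e by simp
qed

definition D :: real where "D = 1 - Phi \<phi> x"

text \<open>Since phi is positive everywhere, a vanishing tail would make the half-line beyond x
  Lebesgue null.\<close>

lemma D_pos: "0 < D"
proof (rule ccontr)
  assume "\<not> 0 < D"
  then have "(\<integral>\<^sup>+z. ennreal (\<phi> z) * indicator {x<..} z \<partial>lborel) = 0"
    using phi_tail(1)[of x] by (simp add: D_def ennreal_neg)
  then have "AE z in lborel. ennreal (\<phi> z) * indicator {x<..} z = 0"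
    by (subst (asm) nn_integral_0_iff_AE) auto
  then have "AE z in lborel. z \<notin> {x<..}"
  proof eventually_elim
    case (elim z)
    then show ?case using phi_pos[of z] by (auto simp: indicator_def ennreal_eq_0_iff split: if_splits)
  qed
  then have "emeasure lborel {x<..} = 0"
    by (subst (asm) AE_iff_measurable[OF _ refl]) (auto simp: greaterThan_def)
  moreover have "emeasure lborel {x<..x + 1} \<le> emeasure lborel {x<..}" by (rule emeasure_mono) auto
  ultimately show False by simp
qed

definition dens :: "real \<Rightarrow> ennreal" where
  "dens z = ennreal (\<phi> z / D * indicator {x..} z)"

lemma dens_m [measurable]: "dens \<in> borel_measurable borel"
  unfolding dens_def by measurable

text \<open>The density of the level without its indicator, because \<open>passage_law\<close>
  restricts the level to z > x by itself; \<open>AE_dens\<close> relates the two.\<close>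

definition g :: "real \<Rightarrow> ennreal" where "g z = ennreal (\<phi> z / D)"

lemma g_m [measurable]: "g \<in> borel_measurable borel"
  unfolding g_def by measurable

lemma g_tail: "(\<integral>\<^sup>+z. g z * indicator {s<..} z \<partial>lborel) = ennreal ((1 - Phi \<phi> s) / D)"
proof -
  have "(\<integral>\<^sup>+z. g z * indicator {s<..} z \<partial>lborel) = (\<integral>\<^sup>+z. ennreal (1 / D) * (ennreal (\<phi> z) * indicator {s<..} z) \<partial>lborel)"
    unfolding g_def using D_pos phi_pos
    by (intro nn_integral_cong) (simp add: mult.assoc[symmetric] ennreal_mult[symmetric] less_imp_le)
  also have "\<dots> = ennreal (1 / D) * ennreal (1 - Phi \<phi> s)"
    by (subst nn_integral_cmult) (auto simp: phi_tail)
  also have "\<dots> = ennreal ((1 - Phi \<phi> s) / D)"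
    using D_pos phi_tail(2)[of s] by (simp add: ennreal_mult[symmetric])
  finally show ?thesis .
qed

lemma g_finite: "(\<integral>\<^sup>+z. g z \<partial>lborel) < \<infinity>"
proof -
  have "(\<integral>\<^sup>+z. g z \<partial>lborel) = (\<integral>\<^sup>+z. ennreal (1 / D) * ennreal (\<phi> z) \<partial>lborel)"
    unfolding g_def using D_pos phi_pos by (intro nn_integral_cong) (simp add: ennreal_mult[symmetric] less_imp_le)
  also have "\<dots> = ennreal (1 / D) * (\<integral>\<^sup>+z. ennreal (\<phi> z) \<partial>lborel)" by (rule nn_integral_cmult) simp
  also have "(\<integral>\<^sup>+z. ennreal (\<phi> z) \<partial>lborel) = ennreal (\<integral>z. \<phi> z \<partial>lborel)"
    using phi_int phi_pos by (intro nn_integral_eq_integral AE_I2) (auto simp: less_imp_le has_bochner_integral_iff)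
  finally show ?thesis by (simp add: ennreal_mult_less_top)
qed

lemma AE_dens: "AE z in lborel. dens z = g z * indicator {x<..} z"
  using AE_lborel_singleton[of x]
  by eventually_elim (auto simp: dens_def g_def indicator_def)

definition Z :: "real measure" where "Z = density lborel dens"

lemma sets_Z [simp, measurable_cong]: "sets Z = sets borel"
  and space_Z [simp]: "space Z = UNIV"
  unfolding Z_def by simp_all

lemma nn_integral_Z: "f \<in> borel_measurable borel \<Longrightarrow> (\<integral>\<^sup>+z. f z \<partial>Z) = (\<integral>\<^sup>+z. dens z * f z \<partial>lborel)"
  unfolding Z_def by (rule nn_integral_density) simp_all

lemma prob_space_Z: "prob_space Z"
proof (rule prob_spaceI)
  have "emeasure Z (space Z) = (\<integral>\<^sup>+z. 1 \<partial>Z)" by simp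
  also have "\<dots> = (\<integral>\<^sup>+z. g z * indicator {x<..} z \<partial>lborel)"
    by (subst nn_integral_Z) (auto intro!: nn_integral_cong_AE eventually_mono[OF AE_dens])
  also have "\<dots> = 1" using g_tail[of x] D_pos by (simp add: D_def)
  finally show "emeasure Z (space Z) = 1" .
qed

sublocale Z: prob_space Z by (rule prob_space_Z)

text \<open>The product measure makes level, Brownian path and driving triple independent; the
  factorisations in the final statements come from it.\<close>

definition Om :: "(real \<times> (real \<Rightarrow> real) \<times> (real \<Rightarrow> real) \<times> (real \<Rightarrow> real) \<times> (real \<Rightarrow> real)) measure" where
  "Om = Z \<Otimes>\<^sub>M (P \<Otimes>\<^sub>M triple W)"

lemma prob_PT: "prob_space (P \<Otimes>\<^sub>M triple W)"
  by (rule prob_space_pair) unfold_locales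

sublocale Om: prob_space Om
  unfolding Om_def by (rule prob_space_pair[OF prob_space_Z prob_PT])

lemma measurable_Om: "measurable Om N = measurable (borel \<Otimes>\<^sub>M (path_sigma \<Otimes>\<^sub>M triple path_sigma)) N"
  unfolding Om_def by (rule measurable_joined_space[OF wiener_sets[OF P] wiener_sets[OF W]]) simp

lemma joined_m: "joined \<in> measurable Om path_sigma"
  unfolding measurable_Om by (rule joined_measurable)

lemma nn_integral_Om:
  assumes F: "F \<in> borel_measurable Om"
  shows "(\<integral>\<^sup>+y. F y \<partial>Om) = (\<integral>\<^sup>+z. dens z * (\<integral>\<^sup>+w. \<integral>\<^sup>+v. F (z, w, v) \<partial>triple W \<partial>P) \<partial>lborel)"
proof -
  interpret PT: prob_space "P \<Otimes>\<^sub>M triple W" by (rule prob_PT)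
  have F': "F \<in> borel_measurable (Z \<Otimes>\<^sub>M (P \<Otimes>\<^sub>M triple W))" using F unfolding Om_def .
  have "(\<integral>\<^sup>+y. F y \<partial>Om) = (\<integral>\<^sup>+z. \<integral>\<^sup>+w. \<integral>\<^sup>+v. F (z, w, v) \<partial>triple W \<partial>P \<partial>Z)"
    unfolding Om_def
    by (rule nn_integral_triple_pair[OF Z.sigma_finite_measure_axioms P.prob_space_axioms T.prob_space_axioms F'])
  also have "\<dots> = (\<integral>\<^sup>+z. dens z * (\<integral>\<^sup>+w. \<integral>\<^sup>+v. F (z, w, v) \<partial>triple W \<partial>P) \<partial>lborel)"
  proof (rule nn_integral_Z)
    have "(\<lambda>z. \<integral>\<^sup>+y. F (z, y) \<partial>(P \<Otimes>\<^sub>M triple W)) \<in> borel_measurable Z"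
      by (rule PT.borel_measurable_nn_integral_fst[OF F'])
    moreover have "(\<integral>\<^sup>+y. F (z, y) \<partial>(P \<Otimes>\<^sub>M triple W)) = (\<integral>\<^sup>+w. \<integral>\<^sup>+v. F (z, w, v) \<partial>triple W \<partial>P)" for z
      by (rule T.nn_integral_fst[symmetric]) (rule measurable_Pair2[OF F'], simp)
    ultimately show "(\<lambda>z. \<integral>\<^sup>+w. \<integral>\<^sup>+v. F (z, w, v) \<partial>triple W \<partial>P) \<in> borel_measurable borel" by simp
  qed
  finally show ?thesis .
qed

definition R :: "(real \<Rightarrow> real) measure" where "R = distr Om path_sigma joined"

lemma mart_nonneg: "0 \<le> t \<Longrightarrow> w \<in> paths \<Longrightarrow> 0 \<le> mart \<phi> t w"
proof -
  assume t: "0 \<le> t" and w: "w \<in> paths"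
  have "w t \<le> run_sup t w" unfolding run_sup_eq_isup using t by (intro isup_ge[OF w]) auto
  then have "0 \<le> (run_sup t w - w t) * \<phi> (run_sup t w)" using phi_pos less_imp_le by (intro mult_nonneg_nonneg) auto
  then show ?thesis unfolding mart_def using phi_tail(2)[of "run_sup t w"] by simp
qed

text \<open>The Bochner integral of a non-integrable function is 0 by convention, so the formula for
  Q on the whole space would give Q total mass 0. Integrability is thus forced by Q being a
  probability.\<close>

lemma mart_integrable: "0 \<le> t \<Longrightarrow> integrable P (mart \<phi> t)"
proof (rule ccontr)
  assume t: "0 \<le> t" and n: "\<not> integrable P (mart \<phi> t)"
  have sp: "paths \<in> sets (path_filt t)" using sets.top[of "path_filt t"] by simp
  have "(\<integral>w. indicator paths w * mart \<phi> t w \<partial>P) = (\<integral>w. mart \<phi> t w \<partial>P)"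
    by (rule Bochner_Integration.integral_cong) (auto simp: wiener_space[OF P])
  also have "\<dots> = 0" using n by (rule not_integrable_integral_eq)
  finally have "measure Q paths = 0" using Q_eq[OF t sp] by simp
  then show False using Q.prob_space space_eq_paths[OF sets_Q] by simp
qed

lemma Q_emeasure:
  assumes t: "0 \<le> t" and G: "G \<in> sets (path_filt t)"
  shows "emeasure Q G = (\<integral>\<^sup>+w. indicator G w * ennreal (mart \<phi> t w / D) \<partial>P)"
proof -
  have GP: "G \<in> sets P" by (rule wiener_path_filt[OF P G])
  have int: "integrable P (\<lambda>w. indicator G w * mart \<phi> t w)"
    using integrable_mult_indicator[OF GP mart_integrable[OF t]] by simp
  have "emeasure Q G = ennreal (\<integral>w. indicator G w * mart \<phi> t w / D \<partial>P)"
    unfolding Q.emeasure_eq_measure Q_eq[OF t G] D_def[symmetric] by simp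
  also have "\<dots> = (\<integral>\<^sup>+w. ennreal (indicator G w * mart \<phi> t w / D) \<partial>P)"
    using int mart_nonneg[OF t] D_pos wiener_space[OF P]
    by (intro nn_integral_eq_integral[symmetric]) (auto intro!: AE_I2)
  also have "\<dots> = (\<integral>\<^sup>+w. indicator G w * ennreal (mart \<phi> t w / D) \<partial>P)"
    by (intro nn_integral_cong) (simp add: indicator_def)
  finally show ?thesis .
qed

text \<open>As S_t < z, the hitting time of z lies beyond t, and gluing changes nothing before
  it.\<close>

lemma joined_agree:
  assumes w: "w \<in> paths" "w 0 = x" "x < z" "hit_time z w < \<infinity>" and t: "0 \<le> t" "run_sup t w < z"
    and u: "0 \<le> u" "u \<le> t"
  shows "joined (z, w, v) u = w u"
proof -
  obtain s where s: "0 \<le> s" "w s = z" "hit_time z w = ennreal s"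
    using hit_time_attained[OF w(1,4)] by metis
  have "t < s"
  proof (rule ccontr)
    assume "\<not> t < s"
    then have "w s \<le> run_sup t w" unfolding run_sup_eq_isup using s by (intro isup_ge[OF w(1)]) auto
    then show False using s t by simp
  qed
  then show ?thesis using u s by (simp add: joined_def glue_def)
qed

lemma joined_snd_measurable:
  assumes "w \<in> paths" shows "(\<lambda>v. joined (z, w, v)) \<in> measurable (triple W) path_sigma"
proof -
  have "(\<lambda>v. (z, w, v)) \<in> measurable (triple path_sigma) (borel \<Otimes>\<^sub>M (path_sigma \<Otimes>\<^sub>M triple path_sigma))"
    using assms by simp
  from measurable_compose[OF this joined_measurable] show ?thesis
    by (simp add: measurable_triple[OF wiener_sets[OF W]])
qed

lemma joined_in_paths:
  assumes "w \<in> paths" "v \<in> space (triple W)" shows "joined (z, w, v) \<in> paths"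
  using measurable_space[OF joined_snd_measurable[OF assms(1)] assms(2)] by simp

text \<open>Levels above S_t leave the path up to t unchanged and contribute the term 1 - Phi(S_t);
  levels below S_t contribute, by \<open>passage_law\<close>, the term with S_t - X_t; the level S_t
  itself is negligible for almost every z. An inequality is enough, since both laws are
  probabilities, and it spares a discussion of paths with S_t = x.\<close>

lemma R_le_Q:
  assumes t: "0 \<le> t" and G: "G \<in> sets (path_filt t)"
  shows "emeasure R G \<le> emeasure Q G"
proof -
  interpret L: pair_sigma_finite P lborel ..
  note [measurable] = run_sup_measurable[OF t] coord_measurable_path_sigma[OF t]
  have Gs[measurable]: "G \<in> sets path_sigma" using G sets_path_filt_le by auto
  let ?S = "run_sup t"
  let ?i = "indicator G :: _ \<Rightarrow> ennreal"
  have Sm: "?S \<in> borel_measurable P" unfolding wiener_measurable[OF P] by measurable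
  have Fm: "(\<lambda>y. ?i (joined y)) \<in> borel_measurable Om"
    by (rule measurable_compose[OF joined_m]) simp
  \<comment> \<open>\<open>A\<close> collects the levels passed before time t, \<open>B\<close>
    those not yet reached.\<close>
  define A where "A = (\<lambda>z. \<integral>\<^sup>+w. \<integral>\<^sup>+v. (if x < z \<and> z < ?S w then g z else 0) * ?i (joined (z, w, v)) \<partial>triple W \<partial>P)"
  define B where "B = (\<lambda>z. \<integral>\<^sup>+w. (if x < z \<and> ?S w < z then g z else 0) * ?i w \<partial>P)"
  have Gm: "?i \<in> borel_measurable P" unfolding wiener_measurable[OF P] by simp
  have jm: "(\<lambda>w. \<integral>\<^sup>+v. ?i (joined (z, w, v)) \<partial>triple W) \<in> borel_measurable P" for z
  proof -
    have "(\<lambda>y. (z, fst y, snd y)) \<in> measurable (path_sigma \<Otimes>\<^sub>M triple path_sigma) (borel \<Otimes>\<^sub>M (path_sigma \<Otimes>\<^sub>M triple path_sigma))"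
      by measurable
    from measurable_compose[OF measurable_compose[OF this joined_measurable] borel_measurable_indicator[OF Gs]]
    have "(\<lambda>y. ?i (joined (z, fst y, snd y))) \<in> borel_measurable (path_sigma \<Otimes>\<^sub>M triple path_sigma)" .
    then have "(\<lambda>y. ?i (joined (z, fst y, snd y))) \<in> borel_measurable (P \<Otimes>\<^sub>M triple W)"
      using measurable_cong_sets[OF sets_pair_measure_cong[OF wiener_sets[OF P]
        sets_pair_measure_cong[OF wiener_sets[OF W] sets_pair_measure_cong[OF wiener_sets[OF W] wiener_sets[OF W]]]] refl]
      by blast
    from T.borel_measurable_nn_integral_fst[OF this] show ?thesis by simp
  qed
  have AB: "AE z in lborel. dens z * (\<integral>\<^sup>+w. \<integral>\<^sup>+v. ?i (joined (z, w, v)) \<partial>triple W \<partial>P) = A z + B z"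
    using AE_dens AE_lborel_neq[OF P.prob_space_axioms Sm]
  proof eventually_elim
    case (elim z)
    show ?case
    proof (cases "x < z")
      case False
      then show ?thesis using elim(1) unfolding A_def B_def by simp
    next
      case True
      have "dens z * (\<integral>\<^sup>+w. \<integral>\<^sup>+v. ?i (joined (z, w, v)) \<partial>triple W \<partial>P)
          = (\<integral>\<^sup>+w. g z * (\<integral>\<^sup>+v. ?i (joined (z, w, v)) \<partial>triple W) \<partial>P)"
        using True elim(1) by (simp add: nn_integral_cmult[OF jm])
      also have "\<dots> = (\<integral>\<^sup>+w. (if z < ?S w then g z else 0) * (\<integral>\<^sup>+v. ?i (joined (z, w, v)) \<partial>triple W)
          + (if ?S w < z then g z else 0) * ?i w \<partial>P)"
      proof (rule nn_integral_cong_AE)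
        show "AE w in P. g z * (\<integral>\<^sup>+v. ?i (joined (z, w, v)) \<partial>triple W) =
          (if z < ?S w then g z else 0) * (\<integral>\<^sup>+v. ?i (joined (z, w, v)) \<partial>triple W) + (if ?S w < z then g z else 0) * ?i w"
          using elim(2) wiener_start[OF P] wiener_unbounded[OF P] AE_space
        proof eventually_elim
          case (elim w)
          then have w: "w \<in> paths" using wiener_space[OF P] by simp
          \<comment> \<open>Unboundedness of Brownian paths makes every level above x be
            hit.\<close>
          have hit: "hit_time z w < \<infinity>" by (rule hit_time_finite[OF w]) (use elim True in auto)
          show ?case
          proof (cases "?S w < z")
            case lt: True
            have "?i (joined (z, w, v)) = ?i w" if v: "v \<in> space (triple W)" for v
              using path_filt_determined[OF G joined_in_paths[OF w v] w] joined_agree[OF w _ True hit t lt] elim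
              by (simp add: indicator_def)
            then have "(\<integral>\<^sup>+v. ?i (joined (z, w, v)) \<partial>triple W) = (\<integral>\<^sup>+v. ?i w \<partial>triple W)"
              by (rule nn_integral_cong)
            then show ?thesis using lt by (simp add: T.emeasure_space_1)
          next
            case False
            then show ?thesis using elim by simp
          qed
        qed
      qed
      also have "\<dots> = (\<integral>\<^sup>+w. (if z < ?S w then g z else 0) * (\<integral>\<^sup>+v. ?i (joined (z, w, v)) \<partial>triple W) \<partial>P) + B z"
        unfolding B_def using True Sm Gm jm[of z] by (subst nn_integral_add) auto
      also have "(\<integral>\<^sup>+w. (if z < ?S w then g z else 0) * (\<integral>\<^sup>+v. ?i (joined (z, w, v)) \<partial>triple W) \<partial>P) = A z"
        unfolding A_def
      proof (rule nn_integral_cong)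
        fix w assume "w \<in> space P"
        then have w: "w \<in> paths" using wiener_space[OF P] by simp
        have m: "(\<lambda>v. ?i (joined (z, w, v))) \<in> borel_measurable (triple W)"
          by (rule measurable_compose[OF joined_snd_measurable[OF w]]) simp
        show "(if z < ?S w then g z else 0) * (\<integral>\<^sup>+v. ?i (joined (z, w, v)) \<partial>triple W)
          = (\<integral>\<^sup>+v. (if x < z \<and> z < ?S w then g z else 0) * ?i (joined (z, w, v)) \<partial>triple W)"
          using True by (simp add: nn_integral_cmult[OF m])
      qed
      finally show ?thesis .
    qed
  qed
  have BmP: "(\<lambda>y. (if x < snd y \<and> ?S (fst y) < snd y then g (snd y) else 0) * ?i (fst y)) \<in> borel_measurable (P \<Otimes>\<^sub>M lborel)"
  proof -
    have "(\<lambda>y. (if x < snd y \<and> ?S (fst y) < snd y then g (snd y) else 0) * ?i (fst y)) \<in> borel_measurable (path_sigma \<Otimes>\<^sub>M borel)"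
      by measurable
    then show ?thesis using wiener_sets[OF P] by (simp cong: measurable_cong_sets sets_pair_measure_cong)
  qed
  have intA: "(\<integral>\<^sup>+z. A z \<partial>lborel) = (\<integral>\<^sup>+w. ?i w * ((if x < ?S w then ennreal (?S w - w t) else 0) * g (?S w)) \<partial>P)"
    unfolding A_def by (rule passage_law[OF P W t G g_m g_finite, symmetric])
  have intB: "(\<integral>\<^sup>+z. B z \<partial>lborel) = (\<integral>\<^sup>+w. ?i w * ennreal ((1 - Phi \<phi> (?S w)) / D) \<partial>P)"
  proof -
    have "(\<integral>\<^sup>+z. B z \<partial>lborel) = (\<integral>\<^sup>+w. \<integral>\<^sup>+z. (if x < z \<and> ?S w < z then g z else 0) * ?i w \<partial>lborel \<partial>P)"
      unfolding B_def
      using L.Fubini'[of "\<lambda>w z. (if x < z \<and> ?S w < z then g z else 0) * ?i w"] BmP by (simp add: split_beta')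
    also have "\<dots> = (\<integral>\<^sup>+w. ?i w * ennreal ((1 - Phi \<phi> (?S w)) / D) \<partial>P)"
    proof (rule nn_integral_cong_AE)
      show "AE w in P. (\<integral>\<^sup>+z. (if x < z \<and> ?S w < z then g z else 0) * ?i w \<partial>lborel) = ?i w * ennreal ((1 - Phi \<phi> (?S w)) / D)"
        using wiener_start[OF P] AE_space
      proof eventually_elim
        case (elim w)
        then have w: "w \<in> paths" using wiener_space[OF P] by simp
        have "w 0 \<le> ?S w" unfolding run_sup_eq_isup using t by (intro isup_ge[OF w]) auto
        \<comment> \<open>As S_t is at least x, the condition x < z is implied by S_t < z.\<close>
        then have "(if x < z \<and> ?S w < z then g z else 0) * ?i w = ?i w * (g z * indicator {?S w<..} z)" for z
          using elim by (auto simp: indicator_def)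
        then have "(\<integral>\<^sup>+z. (if x < z \<and> ?S w < z then g z else 0) * ?i w \<partial>lborel) = ?i w * (\<integral>\<^sup>+z. g z * indicator {?S w<..} z \<partial>lborel)"
          by (simp add: nn_integral_cmult)
        then show ?case unfolding g_tail .
      qed
    qed
    finally show ?thesis .
  qed
  have mA: "A \<in> borel_measurable lborel"
  proof -
    interpret PT: prob_space "P \<Otimes>\<^sub>M triple W" by (rule prob_PT)
    have mL: "measurable (lborel \<Otimes>\<^sub>M (P \<Otimes>\<^sub>M triple W)) N = measurable (borel \<Otimes>\<^sub>M (path_sigma \<Otimes>\<^sub>M triple path_sigma)) N" for N :: "ennreal measure"
      by (rule measurable_joined_space[OF wiener_sets[OF P] wiener_sets[OF W]]) simp
    have ji: "(\<lambda>y. ?i (joined y)) \<in> borel_measurable (borel \<Otimes>\<^sub>M (path_sigma \<Otimes>\<^sub>M triple path_sigma))"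
      by (rule measurable_compose[OF joined_measurable]) simp
    have "(\<lambda>y. (if x < fst y \<and> fst y < ?S (fst (snd y)) then g (fst y) else 0) * ?i (joined y))
      \<in> borel_measurable (borel \<Otimes>\<^sub>M (path_sigma \<Otimes>\<^sub>M triple path_sigma))"
      by (intro borel_measurable_times_ennreal ji) measurable
    then have h: "(\<lambda>y. (if x < fst y \<and> fst y < ?S (fst (snd y)) then g (fst y) else 0) * ?i (joined y))
      \<in> borel_measurable (lborel \<Otimes>\<^sub>M (P \<Otimes>\<^sub>M triple W))" unfolding mL .
    have "A z = (\<integral>\<^sup>+y. (if x < z \<and> z < ?S (fst y) then g z else 0) * ?i (joined (z, y)) \<partial>(P \<Otimes>\<^sub>M triple W))" for z
    proof -
      have "z \<in> space lborel" by simp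
      from T.nn_integral_fst[OF measurable_Pair2[OF h this], unfolded fst_conv snd_conv] show ?thesis
        unfolding A_def .
    qed
    then have "A = (\<lambda>z. \<integral>\<^sup>+y. (if x < z \<and> z < ?S (fst y) then g z else 0) * ?i (joined (z, y)) \<partial>(P \<Otimes>\<^sub>M triple W))"
      by (rule ext)
    then show ?thesis using PT.borel_measurable_nn_integral_fst[OF h, unfolded fst_conv snd_conv] by (simp only:)
  qed
  have mB: "B \<in> borel_measurable lborel"
  proof -
    have "(\<lambda>y. (if x < fst y \<and> ?S (snd y) < fst y then g (fst y) else 0) * ?i (snd y)) \<in> borel_measurable (borel \<Otimes>\<^sub>M path_sigma)"
      by measurable
    then have "(\<lambda>y. (if x < fst y \<and> ?S (snd y) < fst y then g (fst y) else 0) * ?i (snd y)) \<in> borel_measurable (lborel \<Otimes>\<^sub>M P)"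
      using wiener_sets[OF P] by (simp cong: measurable_cong_sets sets_pair_measure_cong)
    from P.borel_measurable_nn_integral_fst[OF this, unfolded fst_conv snd_conv] show ?thesis unfolding B_def .
  qed
  have "emeasure R G = (\<integral>\<^sup>+y. ?i (joined y) \<partial>Om)"
  proof -
    have "emeasure R G = (\<integral>\<^sup>+w. ?i w \<partial>R)" using Gs by (simp add: R_def)
    also have "\<dots> = (\<integral>\<^sup>+y. ?i (joined y) \<partial>Om)" unfolding R_def by (subst nn_integral_distr[OF joined_m]) simp_all
    finally show ?thesis .
  qed
  also have "\<dots> = (\<integral>\<^sup>+z. dens z * (\<integral>\<^sup>+w. \<integral>\<^sup>+v. ?i (joined (z, w, v)) \<partial>triple W \<partial>P) \<partial>lborel)"
    by (rule nn_integral_Om[OF Fm])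
  also have "\<dots> = (\<integral>\<^sup>+z. A z + B z \<partial>lborel)" by (rule nn_integral_cong_AE[OF AB])
  also have "\<dots> = (\<integral>\<^sup>+z. A z \<partial>lborel) + (\<integral>\<^sup>+z. B z \<partial>lborel)" by (rule nn_integral_add[OF mA mB])
  also have "\<dots> = (\<integral>\<^sup>+w. ?i w * ((if x < ?S w then ennreal (?S w - w t) else 0) * g (?S w)) + ?i w * ennreal ((1 - Phi \<phi> (?S w)) / D) \<partial>P)"
    unfolding intA intB
  proof (rule nn_integral_add[symmetric])
    show "(\<lambda>w. ?i w * ((if x < ?S w then ennreal (?S w - w t) else 0) * g (?S w))) \<in> borel_measurable P"
      unfolding wiener_measurable[OF P] by measurable
    have "Phi \<phi> \<in> borel_measurable borel"
    proof (rule borel_measurable_mono)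
      show "mono (Phi \<phi>)"
      proof (rule monoI)
        fix a b :: real assume "a \<le> b"
        have i: "integrable lborel \<phi>" using phi_int by (auto simp: has_bochner_integral_iff)
        show "Phi \<phi> a \<le> Phi \<phi> b"
          unfolding Phi_def set_lebesgue_integral_def
        proof (rule integral_mono)
          show "integrable lborel (\<lambda>u. indicator {..a} u *\<^sub>R \<phi> u)" "integrable lborel (\<lambda>u. indicator {..b} u *\<^sub>R \<phi> u)"
            by (rule integrable_mult_indicator[OF _ i], simp)+
          show "indicator {..a} u *\<^sub>R \<phi> u \<le> indicator {..b} u *\<^sub>R \<phi> u" for u
            using phi_pos[of u] \<open>a \<le> b\<close> by (auto simp: indicator_def)
        qed
      qed
    qed
    note [measurable] = this
    show "(\<lambda>w. ?i w * ennreal ((1 - Phi \<phi> (?S w)) / D)) \<in> borel_measurable P"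
      unfolding wiener_measurable[OF P] by measurable
  qed
  also have "\<dots> \<le> (\<integral>\<^sup>+w. ?i w * ennreal (mart \<phi> t w / D) \<partial>P)"
  proof (rule nn_integral_mono)
    fix w assume "w \<in> space P"
    then have w: "w \<in> paths" using wiener_space[OF P] by simp
    have Sw: "w t \<le> ?S w" unfolding run_sup_eq_isup using t by (intro isup_ge[OF w]) auto
    have p1: "0 \<le> (1 - Phi \<phi> (?S w)) / D" using phi_tail(2)[of "?S w"] D_pos by simp
    have p2: "0 \<le> (?S w - w t) * (\<phi> (?S w) / D)" using Sw D_pos phi_pos[of "?S w"] by simp
    \<comment> \<open>Dropping the condition x < S_t can only increase the term; all other steps are
      equalities.\<close>
    have "(if x < ?S w then ennreal (?S w - w t) else 0) * g (?S w) \<le> ennreal (?S w - w t) * ennreal (\<phi> (?S w) / D)"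
      unfolding g_def by (intro mult_right_mono) auto
    also have "\<dots> = ennreal ((?S w - w t) * (\<phi> (?S w) / D))"
      using Sw D_pos phi_pos[of "?S w"] by (intro ennreal_mult[symmetric]) auto
    finally have "(if x < ?S w then ennreal (?S w - w t) else 0) * g (?S w) + ennreal ((1 - Phi \<phi> (?S w)) / D)
        \<le> ennreal ((?S w - w t) * (\<phi> (?S w) / D)) + ennreal ((1 - Phi \<phi> (?S w)) / D)"
      by (rule add_right_mono)
    also have "\<dots> = ennreal (mart \<phi> t w / D)"
    proof -
      have "mart \<phi> t w / D = (?S w - w t) * (\<phi> (?S w) / D) + (1 - Phi \<phi> (?S w)) / D"
        by (simp add: mart_def add_divide_distrib diff_divide_distrib)
      then show ?thesis by (simp only: ennreal_plus[OF p2 p1])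
    qed
    finally have "?i w * ((if x < ?S w then ennreal (?S w - w t) else 0) * g (?S w) + ennreal ((1 - Phi \<phi> (?S w)) / D))
      \<le> ?i w * ennreal (mart \<phi> t w / D)" by (rule mult_left_mono) simp
    then show "?i w * ((if x < ?S w then ennreal (?S w - w t) else 0) * g (?S w)) + ?i w * ennreal ((1 - Phi \<phi> (?S w)) / D)
      \<le> ?i w * ennreal (mart \<phi> t w / D)" by (simp only: distrib_left)
  qed
  also have "\<dots> = emeasure Q G" by (rule Q_emeasure[OF t G, symmetric])
  finally show ?thesis .
qed

sublocale R: prob_space R
  unfolding R_def by (rule Om.prob_space_distr[OF joined_m])

lemma sets_R: "sets R = sets path_sigma"
  unfolding R_def by simp

text \<open>Both are probability measures, so the inequality on an event and on its complement gives
  equality.\<close>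

lemma R_eq_Q: "R = Q"
proof (rule measure_eqI_generator_eq[OF Int_stable_boxes[of "{0..}" 0], where \<Omega>=paths
      and A="\<lambda>n. {w \<in> paths. w 0 \<in> ball 0 (real n)}"])
  show "boxes {0..} 0 \<subseteq> Pow paths" unfolding boxes_def by auto
  show "sets R = sigma_sets paths (boxes {0..} 0)" "sets Q = sigma_sets paths (boxes {0..} 0)"
    using sets_R sets_Q coord_algebra_boxes[of 0 "{0..}"] unfolding path_sigma_def by auto
  show "range (\<lambda>n. {w \<in> paths. w 0 \<in> ball 0 (real n)}) \<subseteq> boxes {0..} 0"
  proof (clarify)
    fix n :: nat
    show "{w \<in> paths. w 0 \<in> ball 0 (real n)} \<in> boxes {0..} 0"
      unfolding boxes_def by (intro CollectI exI[of _ "{0}"] exI[of _ "\<lambda>_. ball 0 (real n)"]) auto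
  qed
  show "(\<Union>n. {w \<in> paths. w 0 \<in> ball 0 (real n)}) = paths"
    using reals_Archimedean2 by auto
  show "emeasure R {w \<in> paths. w 0 \<in> ball 0 (real n)} \<noteq> \<infinity>" for n
    using R.emeasure_finite by auto
  fix X assume "X \<in> boxes {0..} 0"
  then obtain J U where X: "X = {w \<in> paths. \<forall>j\<in>J. w j \<in> U j}" and J: "finite J" "J \<subseteq> {0..}" "0 \<in> J"
    and U: "\<forall>j\<in>J. open (U j) \<and> bounded (U j)" unfolding boxes_def by blast
  \<comment> \<open>A box involves finitely many times, so the box and its complement are both
    events before the largest of them.\<close>
  define t where "t = Max J"
  have t: "0 \<le> t" "J \<subseteq> {0..t}" unfolding t_def using J by auto
  have "X \<in> boxes {0..t} 0" unfolding boxes_def X using J U t by blast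
  then have G: "X \<in> sets (path_filt t)"
    unfolding path_filt_def using coord_algebra_boxes[of 0 "{0..t}"] t by auto
  then have G': "paths - X \<in> sets (path_filt t)" using sets.compl_sets[of X "path_filt t"] by simp
  have XR: "X \<in> sets R" and XQ: "X \<in> sets Q" using G sets_path_filt_le sets_R sets_Q by auto
  have "measure R X \<le> measure Q X"
    using R_le_Q[OF t(1) G] by (simp add: R.emeasure_eq_measure Q.emeasure_eq_measure)
  moreover have "measure R (paths - X) \<le> measure Q (paths - X)"
    using R_le_Q[OF t(1) G'] by (simp add: R.emeasure_eq_measure Q.emeasure_eq_measure)
  then have "1 - measure R X \<le> 1 - measure Q X"
    using R.prob_compl[OF XR] Q.prob_compl[OF XQ] space_eq_paths[OF sets_R] space_eq_paths[OF sets_Q] by simp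
  ultimately show "emeasure R X = emeasure Q X"
    by (simp add: R.emeasure_eq_measure Q.emeasure_eq_measure)
qed

section \<open>Reading the assertions off the concatenated path\<close>

lemma AE_Q_unique_max: "AE w in Q. unique_max w"
proof -
  have null: "AE w in Q. isup 0 q w \<noteq> isup q' (real m) w" if q: "0 < q" "q < q'" "q' \<le> real m" for q q' and m :: nat
  proof -
    let ?N = "{w \<in> space (path_filt (real m)). isup 0 q w = isup q' (real m) w}"
    \<comment> \<open>A supremum over an interval inside [0, m] sees only the path stopped at m, so
      the exceptional event lies in \<open>path_filt m\<close>, where \<open>Q_eq\<close> transfers
      null sets from P to Q.\<close>
    have im: "isup a b \<in> borel_measurable (path_filt (real m))" if ab: "0 \<le> a" "a \<le> b" "b \<le> real m" for a b
    proof -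
      have "isup a b (stop_path (real m) w) = isup a b w" for w
        unfolding isup_def by (rule arg_cong[where f=Sup], rule image_cong) (use ab in \<open>auto simp: stop_path_def\<close>)
      then show ?thesis
        using measurable_compose[OF stop_path_measurable isup_fixed_measurable[OF ab(1,2)], of "real m"] by simp
    qed
    have N: "?N \<in> sets (path_filt (real m))"
      using im[of 0 q] im[of q' "real m"] q by (intro borel_measurable_eq) auto
    have "(\<integral>w. indicator ?N w * mart \<phi> (real m) w \<partial>P) = 0"
    proof (rule integral_eq_zero_AE)
      show "AE w in P. indicator ?N w * mart \<phi> (real m) w = 0"
        using wiener_no_double_max[OF P W q] by eventually_elim simp
    qed
    then have "emeasure Q ?N = 0" using Q_eq[OF _ N] by (simp add: Q.emeasure_eq_measure)
    moreover have "?N \<in> sets Q" using N sets_path_filt_le sets_Q by auto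
    ultimately show ?thesis
      by (intro AE_I[of _ _ ?N]) (auto simp: space_eq_paths[OF sets_Q])
  qed
  have "AE w in Q. \<forall>q\<in>\<rat>. \<forall>q'\<in>\<rat>. \<forall>m::nat. 0 < q \<and> q < q' \<and> q' \<le> real m \<longrightarrow> isup 0 q w \<noteq> isup q' (real m) w"
    using null by (simp add: AE_ball_countable[OF countable_rat] AE_all_countable)
  then show ?thesis using AE_space
    by eventually_elim (use unique_maxI space_eq_paths[OF sets_Q] in blast)
qed

text \<open>Uniqueness of the maximum is known under Q and is pulled back along
  \<open>joined\<close> through R = Q. Unboundedness of Brownian paths makes the hitting time
  finite, and z > x puts the start strictly below the level, so \<open>joined_decomposition\<close>
  applies outcome by outcome.\<close>

lemma AE_Om:
  "AE y in Om. sup_inf (joined y) = ereal (fst y) \<and> 0 < last_max (joined y) \<and> last_max (joined y) < \<infinity> \<and>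
    pre_max (joined y) = path_upto (hit_time (fst y) (fst (snd y))) (fst (snd y)) \<and>
    post_max (joined y) = bes 0 (snd (snd y))"
proof -
  have u: "AE y in Om. unique_max (joined y)"
    using AE_Q_unique_max unfolding R_eq_Q[symmetric] R_def by (rule AE_distrD[OF joined_m])
  have "AE z in Z. x < z"
  proof -
    have "AE z in lborel. 0 < dens z \<longrightarrow> x < z"
      using AE_lborel_singleton[of x] by eventually_elim (auto simp: dens_def indicator_def split: if_splits)
    then show ?thesis unfolding Z_def by (subst AE_density) auto
  qed
  from AE_fst[OF prob_PT this] have z: "AE y in Om. x < fst y" unfolding Om_def .
  have "AE w in P. w \<in> paths \<and> w 0 = x \<and> (\<forall>y. \<exists>u\<ge>0. y < w u)"
    using wiener_start[OF P] wiener_unbounded[OF P] AE_space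
    by eventually_elim (simp add: wiener_space[OF P])
  from AE_snd[OF prob_PT AE_fst[OF T.prob_space_axioms this]]
  have w: "AE y in Om. fst (snd y) \<in> paths \<and> fst (snd y) 0 = x \<and> (\<forall>r. \<exists>u\<ge>0. r < fst (snd y) u)" unfolding Om_def .
  have WW: "prob_space (W \<Otimes>\<^sub>M W)" by (rule prob_space_pair) unfold_locales
  have a: "AE w in W. w \<in> paths \<and> w 0 = 0"
    using wiener_start[OF W] AE_space by eventually_elim (simp add: wiener_space[OF W])
  have "AE v in triple W. (fst v \<in> paths \<and> fst v 0 = 0) \<and>
      (fst (snd v) \<in> paths \<and> fst (snd v) 0 = 0) \<and> (snd (snd v) \<in> paths \<and> snd (snd v) 0 = 0)"
    using AE_fst[OF WW a] AE_snd[OF WW AE_fst[OF W.prob_space_axioms a]] AE_snd[OF WW AE_snd[OF W.prob_space_axioms a]]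
    by eventually_elim blast
  then have "AE v in triple W. bes 0 v \<in> paths \<and> bes 0 v 0 = 0"
  proof eventually_elim
    case (elim v)
    then obtain a b c where v: "v = (a, b, c)" "a \<in> paths" "b \<in> paths" "c \<in> paths" "a 0 = 0" "b 0 = 0" "c 0 = 0"
      by (cases v) auto
    then have "bes 0 v 0 = 0" by (simp add: bes_def)
    then show ?case using bes_in_paths[OF v(2-4)] v(1) by simp
  qed
  from AE_snd[OF prob_PT AE_snd[OF T.prob_space_axioms this]]
  have v: "AE y in Om. bes 0 (snd (snd y)) \<in> paths \<and> bes 0 (snd (snd y)) 0 = 0" unfolding Om_def .
  show ?thesis using u z w v
  proof eventually_elim
    case (elim y)
    let ?z = "fst y" and ?w = "fst (snd y)" and ?v = "snd (snd y)"
    have Y: "joined y = glue (enn2real (hit_time ?z ?w)) ?w (sub_path 0 (bes 0 ?v))"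
      by (simp add: joined_def split_beta')
    have w: "?w \<in> paths" "?w 0 < ?z" using elim by auto
    have hit: "hit_time ?z ?w < \<infinity>" by (rule hit_time_finite[OF w(1)]) (use elim in auto)
    show ?case
      using joined_decomposition[OF w hit _ _ bes_nonneg Y] elim by blast
  qed
qed

definition pre_law :: "(ennreal \<times> (real \<Rightarrow> real)) set \<Rightarrow> real \<Rightarrow> ennreal" where
  "pre_law A z = emeasure (stopped_bm_law P z) A"

lemma hit_path_measurable:
  "(\<lambda>y. path_upto (hit_time (fst y) (snd y)) (snd y)) \<in> measurable (borel \<Otimes>\<^sub>M path_sigma) upto_algebra"
  by (rule path_upto_measurable[OF _ hit_time_measurable]) auto

lemma stopped_map_measurable: "(\<lambda>w. path_upto (hit_time z w) w) \<in> measurable P upto_algebra"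
proof -
  have "(\<lambda>w. (z, w)) \<in> measurable path_sigma (borel \<Otimes>\<^sub>M path_sigma)" by simp
  from measurable_compose[OF this hit_path_measurable] show ?thesis by (simp add: wiener_measurable[OF P])
qed

lemma pre_law_eq:
  assumes A: "A \<in> sets upto_algebra"
  shows "pre_law A z = (\<integral>\<^sup>+w. indicator A (path_upto (hit_time z w) w) \<partial>P)"
proof -
  have "pre_law A z = (\<integral>\<^sup>+w. indicator A w \<partial>stopped_bm_law P z)"
    unfolding pre_law_def using A by (simp add: stopped_bm_law_def)
  also have "\<dots> = (\<integral>\<^sup>+w. indicator A (path_upto (hit_time z w) w) \<partial>P)"
    unfolding stopped_bm_law_def using A by (subst nn_integral_distr[OF stopped_map_measurable]) simp_all
  finally show ?thesis .
qed

lemma pre_law_measurable: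
  assumes A: "A \<in> sets upto_algebra" shows "pre_law A \<in> borel_measurable borel"
proof -
  have "(\<lambda>y. indicator A (path_upto (hit_time (fst y) (snd y)) (snd y)) :: ennreal) \<in> borel_measurable (borel \<Otimes>\<^sub>M path_sigma)"
    by (rule measurable_compose[OF hit_path_measurable]) (use A in simp)
  then have "(\<lambda>y. indicator A (path_upto (hit_time (fst y) (snd y)) (snd y)) :: ennreal) \<in> borel_measurable (borel \<Otimes>\<^sub>M P)"
    using wiener_sets[OF P] by (simp cong: measurable_cong_sets sets_pair_measure_cong)
  from P.borel_measurable_nn_integral_fst[OF this]
  have "(\<lambda>z. \<integral>\<^sup>+w. indicator A (path_upto (hit_time z w) w) \<partial>P) \<in> borel_measurable borel" by simp
  moreover have "pre_law A = (\<lambda>z. \<integral>\<^sup>+w. indicator A (path_upto (hit_time z w) w) \<partial>P)"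
    by (rule ext) (rule pre_law_eq[OF A])
  ultimately show ?thesis by simp
qed

lemma prob_space_stopped: "prob_space (stopped_bm_law P z)"
  unfolding stopped_bm_law_def by (rule P.prob_space_distr[OF stopped_map_measurable])

lemma pre_law_space: "pre_law (space upto_algebra) z = 1"
  using prob_space.emeasure_space_1[OF prob_space_stopped] by (simp add: pre_law_def stopped_bm_law_def)

lemma prob_space_bessel3: "prob_space (bessel3_law W)"
  unfolding bessel3_law_eq by (rule T.prob_space_distr[OF bes_measurable[OF wiener_sets[OF W]]])

text \<open>\<open>real_of_ereal\<close> sends an infinite supremum to 0, which matters only on a
  null event.\<close>

definition S :: "(real \<Rightarrow> real) \<Rightarrow> real" where "S w = real_of_ereal (sup_inf w)"

lemma S_measurable: "S \<in> borel_measurable path_sigma"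
  using sup_inf_measurable unfolding S_def by measurable

lemma measurable_Q: "measurable Q N = measurable path_sigma N"
  by (rule measurable_cong_sets[OF sets_Q refl])

text \<open>By \<open>AE_Om\<close> the part before the maximum depends only on level and Brownian
  path, the supremum is the level, and the part after the maximum depends only on the driving
  triple, so the integral factorises. Density, independence, Bessel law and conditional law are
  obtained by taking some of A, B, C to be the whole space.\<close>

lemma joint_law:
  assumes A: "A \<in> sets upto_algebra" and B: "B \<in> sets path_sigma" and C: "C \<in> sets borel"
  shows "emeasure Q {w \<in> space Q. pre_max w \<in> A \<and> post_max w \<in> B \<and> S w \<in> C}
    = (\<integral>\<^sup>+z. pre_law A z * indicator C z \<partial>Z) * emeasure (bessel3_law W) B"
proof -
  let ?E = "{w \<in> space Q. pre_max w \<in> A \<and> post_max w \<in> B \<and> S w \<in> C}"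
  have "?E = (pre_max -` A \<inter> space path_sigma) \<inter> (post_max -` B \<inter> space path_sigma) \<inter> (S -` C \<inter> space path_sigma)"
    using space_eq_paths[OF sets_Q] by auto
  then have E: "?E \<in> sets path_sigma"
    using measurable_sets[OF pre_max_measurable A] measurable_sets[OF post_max_measurable B]
      measurable_sets[OF S_measurable C] by auto
  have bm: "bes 0 \<in> measurable (triple W) path_sigma" by (rule bes_measurable[OF wiener_sets[OF W]])
  have "emeasure Q ?E = (\<integral>\<^sup>+w. indicator ?E w \<partial>R)" using E sets_R R_eq_Q by simp
  also have "\<dots> = (\<integral>\<^sup>+y. indicator ?E (joined y) \<partial>Om)"
    unfolding R_def using E by (subst nn_integral_distr[OF joined_m]) simp_all
  also have "\<dots> = (\<integral>\<^sup>+y. indicator A (path_upto (hit_time (fst y) (fst (snd y))) (fst (snd y))) *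
      (indicator C (fst y) * indicator B (bes 0 (snd (snd y)))) \<partial>Om)"
  proof (rule nn_integral_cong_AE)
    show "AE y in Om. indicator ?E (joined y) = (indicator A (path_upto (hit_time (fst y) (fst (snd y))) (fst (snd y))) *
      (indicator C (fst y) * indicator B (bes 0 (snd (snd y)))) :: ennreal)"
      using AE_Om AE_space
    proof eventually_elim
      case (elim y)
      have "joined y \<in> space Q" using measurable_space[OF joined_m elim(2)] space_eq_paths[OF sets_Q] by simp
      then show ?case using elim(1) by (auto simp: S_def indicator_def)
    qed
  qed
  also have "\<dots> = (\<integral>\<^sup>+z. dens z * (\<integral>\<^sup>+w. \<integral>\<^sup>+v. indicator A (path_upto (hit_time z w) w) *
      (indicator C z * indicator B (bes 0 v)) \<partial>triple W \<partial>P) \<partial>lborel)"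
  proof (subst nn_integral_Om)
    have m1: "(\<lambda>y. path_upto (hit_time (fst y) (fst (snd y))) (fst (snd y))) \<in> measurable (borel \<Otimes>\<^sub>M (path_sigma \<Otimes>\<^sub>M triple path_sigma)) upto_algebra"
      by (rule path_upto_measurable[OF _ hit_time_measurable]) auto
    have m2: "(\<lambda>y. bes 0 (snd (snd y))) \<in> measurable (borel \<Otimes>\<^sub>M (path_sigma \<Otimes>\<^sub>M triple path_sigma)) path_sigma"
      by (rule measurable_compose[OF _ bes_measurable_path_sigma]) measurable
    have "(\<lambda>y. indicator C (fst y) :: ennreal) \<in> borel_measurable (borel \<Otimes>\<^sub>M (path_sigma \<Otimes>\<^sub>M triple path_sigma))"
      using C by measurable
    then show "(\<lambda>y. indicator A (path_upto (hit_time (fst y) (fst (snd y))) (fst (snd y))) *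
      (indicator C (fst y) * indicator B (bes 0 (snd (snd y)))) :: ennreal) \<in> borel_measurable Om"
      unfolding measurable_Om using A B
      by (intro borel_measurable_times_ennreal measurable_compose[OF m1] measurable_compose[OF m2]) simp_all
  qed simp
  also have "\<dots> = (\<integral>\<^sup>+z. dens z * (pre_law A z * indicator C z * emeasure (bessel3_law W) B) \<partial>lborel)"
  proof (intro nn_integral_cong arg_cong2[where f="(*)"] refl)
    fix z :: real
    have bB: "(\<integral>\<^sup>+v. indicator B (bes 0 v) \<partial>triple W) = emeasure (bessel3_law W) B"
    proof -
      have "emeasure (bessel3_law W) B = (\<integral>\<^sup>+v. indicator B v \<partial>bessel3_law W)" using B by (simp add: bessel3_law_eq)
      also have "\<dots> = (\<integral>\<^sup>+v. indicator B (bes 0 v) \<partial>triple W)"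
        unfolding bessel3_law_eq using B by (subst nn_integral_distr[OF bm]) simp_all
      finally show ?thesis by simp
    qed
    have mB: "(\<lambda>v. indicator B (bes 0 v) :: ennreal) \<in> borel_measurable (triple W)"
      by (rule measurable_compose[OF bm]) (use B in simp)
    have mA: "(\<lambda>w. indicator A (path_upto (hit_time z w) w) :: ennreal) \<in> borel_measurable P"
      by (rule measurable_compose[OF stopped_map_measurable]) (use A in simp)
    have "(\<integral>\<^sup>+w. \<integral>\<^sup>+v. indicator A (path_upto (hit_time z w) w) * (indicator C z * indicator B (bes 0 v)) \<partial>triple W \<partial>P)
      = (\<integral>\<^sup>+w. indicator A (path_upto (hit_time z w) w) * (indicator C z * emeasure (bessel3_law W) B) \<partial>P)"
      using mB by (simp add: nn_integral_cmult bB)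
    also have "\<dots> = pre_law A z * (indicator C z * emeasure (bessel3_law W) B)"
      unfolding pre_law_eq[OF A] by (rule nn_integral_multc[OF mA])
    finally show "(\<integral>\<^sup>+w. \<integral>\<^sup>+v. indicator A (path_upto (hit_time z w) w) * (indicator C z * indicator B (bes 0 v)) \<partial>triple W \<partial>P)
      = pre_law A z * indicator C z * emeasure (bessel3_law W) B" by (simp only: mult.assoc)
  qed
  also have "\<dots> = (\<integral>\<^sup>+z. dens z * (pre_law A z * indicator C z) * emeasure (bessel3_law W) B \<partial>lborel)"
    by (simp only: mult.assoc)
  also have "\<dots> = (\<integral>\<^sup>+z. dens z * (pre_law A z * indicator C z) \<partial>lborel) * emeasure (bessel3_law W) B"
    using pre_law_measurable[OF A] C by (intro nn_integral_multc) simp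
  also have "(\<integral>\<^sup>+z. dens z * (pre_law A z * indicator C z) \<partial>lborel) = (\<integral>\<^sup>+z. pre_law A z * indicator C z \<partial>Z)"
    using pre_law_measurable[OF A] C by (intro nn_integral_Z[symmetric]) simp
  finally show ?thesis .
qed

lemma bessel_paths: "emeasure (bessel3_law W) paths = 1"
  using prob_space.emeasure_space_1[OF prob_space_bessel3] by (simp add: bessel3_law_eq)

lemma pre_max_space: "w \<in> space Q \<Longrightarrow> pre_max w \<in> space upto_algebra"
  and post_max_space: "w \<in> space Q \<Longrightarrow> post_max w \<in> paths"
  using measurable_space[OF pre_max_measurable] measurable_space[OF post_max_measurable] space_eq_paths[OF sets_Q]
  by auto

lemma law_pre_sup:
  assumes A: "A \<in> sets upto_algebra" and C: "C \<in> sets borel"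
  shows "emeasure Q {w \<in> space Q. pre_max w \<in> A \<and> S w \<in> C} = (\<integral>\<^sup>+z. pre_law A z * indicator C z \<partial>Z)"
proof -
  have p: "paths \<in> sets path_sigma" using sets.top[of path_sigma] by simp
  have "{w \<in> space Q. pre_max w \<in> A \<and> S w \<in> C} = {w \<in> space Q. pre_max w \<in> A \<and> post_max w \<in> paths \<and> S w \<in> C}"
    using post_max_space by auto
  then show ?thesis using joint_law[OF A p C] by (simp add: bessel_paths)
qed

text \<open>Each stopped Brownian law has mass 1, so leaving the part before the maximum
  unconstrained leaves just the law of the level.\<close>

lemma distr_S: "distr Q borel S = Z"
proof (rule measure_eqI)
  fix C assume "C \<in> sets (distr Q borel S)"
  then have C: "C \<in> sets borel" by simp
  have "S -` C \<inter> space Q = {w \<in> space Q. pre_max w \<in> space upto_algebra \<and> S w \<in> C}" using pre_max_space by auto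
  then have "emeasure (distr Q borel S) C = (\<integral>\<^sup>+z. pre_law (space upto_algebra) z * indicator C z \<partial>Z)"
    using law_pre_sup[OF sets.top C] S_measurable C by (subst emeasure_distr) (auto simp: measurable_Q)
  then show "emeasure (distr Q borel S) C = emeasure Z C" using C by (simp add: pre_law_space)
qed simp

lemma law_pre_post:
  assumes A: "A \<in> sets upto_algebra" and B: "B \<in> sets path_sigma"
  shows "emeasure Q {w \<in> space Q. pre_max w \<in> A \<and> post_max w \<in> B} = (\<integral>\<^sup>+z. pre_law A z \<partial>Z) * emeasure (bessel3_law W) B"
  using joint_law[OF A B, of UNIV] by simp

lemma law_pre: "A \<in> sets upto_algebra \<Longrightarrow> emeasure Q {w \<in> space Q. pre_max w \<in> A} = (\<integral>\<^sup>+z. pre_law A z \<partial>Z)"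
  using law_pre_sup[of A UNIV] by simp

lemma law_post:
  assumes B: "B \<in> sets path_sigma"
  shows "emeasure Q {w \<in> space Q. post_max w \<in> B} = emeasure (bessel3_law W) B"
proof -
  have "{w \<in> space Q. post_max w \<in> B} = {w \<in> space Q. pre_max w \<in> space upto_algebra \<and> post_max w \<in> B}"
    using pre_max_space by auto
  then show ?thesis using law_pre_post[OF sets.top B] by (simp add: pre_law_space Z.emeasure_space_1[simplified])
qed

lemma AE_Q_transfer:
  assumes "Measurable.pred path_sigma H" "AE y in Om. H (joined y)" shows "AE w in Q. H w"
  unfolding R_eq_Q[symmetric] R_def using assms by (subst AE_distr_iff[OF joined_m]) (auto simp: pred_def)

theorem sup_finite: "AE w in Q. sup_inf w < \<infinity>"
proof (rule AE_Q_transfer)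
  note [measurable] = sup_inf_measurable
  show "Measurable.pred path_sigma (\<lambda>w. sup_inf w < \<infinity>)" by measurable
  show "AE y in Om. sup_inf (joined y) < \<infinity>" using AE_Om by eventually_elim simp
qed

theorem sup_distributed:
  "distributed Q lborel (\<lambda>w. real_of_ereal (sup_inf w)) (\<lambda>y. ennreal (\<phi> y / (1 - Phi \<phi> x) * indicator {x..} y))"
  unfolding distributed_def
proof (intro conjI)
  have "distr Q lborel S = distr Q borel S" by (rule distr_cong) auto
  then show "distr Q lborel (\<lambda>w. real_of_ereal (sup_inf w)) = density lborel (\<lambda>y. ennreal (\<phi> y / (1 - Phi \<phi> x) * indicator {x..} y))"
    using distr_S unfolding S_def Z_def dens_def D_def by simp
  show "(\<lambda>y. ennreal (\<phi> y / (1 - Phi \<phi> x) * indicator {x..} y)) \<in> borel_measurable lborel" by simp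
  show "(\<lambda>w. real_of_ereal (sup_inf w)) \<in> measurable Q lborel"
    using S_measurable unfolding S_def by (simp add: measurable_Q)
qed

theorem last_max_finite: "measure Q {w \<in> space Q. 0 < last_max w \<and> last_max w < \<infinity>} = 1"
proof -
  note [measurable] = last_max_measurable
  have m: "Measurable.pred path_sigma (\<lambda>w. 0 < last_max w \<and> last_max w < \<infinity>)" by measurable
  have "AE w in Q. 0 < last_max w \<and> last_max w < \<infinity>"
    by (rule AE_Q_transfer[OF m]) (use AE_Om in eventually_elim, simp)
  moreover have "{w \<in> space Q. 0 < last_max w \<and> last_max w < \<infinity>} \<in> sets Q"
    using m sets_Q space_eq_paths[OF sets_Q] unfolding pred_def by simp
  ultimately show ?thesis by (simp add: Q.prob_Collect_eq_1)
qed

theorem pre_post_indep: "indep_rv Q upto_algebra pre_max path_sigma post_max"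
  unfolding indep_rv_def
proof (intro conjI)
  show p: "pre_max \<in> measurable Q upto_algebra" unfolding measurable_Q by (rule pre_max_measurable)
  show q: "post_max \<in> measurable Q path_sigma" unfolding measurable_Q by (rule post_max_measurable)
  have s1: "sets (vimage_algebra (space Q) pre_max upto_algebra) = {pre_max -` A \<inter> space Q | A. A \<in> sets upto_algebra}"
    by (rule sets_vimage_algebra2) (use pre_max_space in auto)
  have s2: "sets (vimage_algebra (space Q) post_max path_sigma) = {post_max -` A \<inter> space Q | A. A \<in> sets path_sigma}"
    by (rule sets_vimage_algebra2) (use post_max_space in auto)
  show "Q.indep_set (sets (vimage_algebra (space Q) pre_max upto_algebra)) (sets (vimage_algebra (space Q) post_max path_sigma))"
    unfolding Q.indep_sets2_eq s1 s2
  proof (intro conjI ballI)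
    show "{pre_max -` A \<inter> space Q | A. A \<in> sets upto_algebra} \<subseteq> Q.events" using measurable_sets[OF p] by auto
    show "{post_max -` A \<inter> space Q | A. A \<in> sets path_sigma} \<subseteq> Q.events" using measurable_sets[OF q] by auto
    fix a b assume "a \<in> {pre_max -` A \<inter> space Q | A. A \<in> sets upto_algebra}" "b \<in> {post_max -` A \<inter> space Q | A. A \<in> sets path_sigma}"
    then obtain A B where A: "A \<in> sets upto_algebra" "a = {w \<in> space Q. pre_max w \<in> A}"
      and B: "B \<in> sets path_sigma" "b = {w \<in> space Q. post_max w \<in> B}" by auto
    have "a \<inter> b = {w \<in> space Q. pre_max w \<in> A \<and> post_max w \<in> B}" unfolding A B by auto
    then have "emeasure Q (a \<inter> b) = emeasure Q a * emeasure Q b"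
      using law_pre_post[OF A(1) B(1)] law_pre[OF A(1)] law_post[OF B(1)] A(2) B(2) by simp
    then show "Q.prob (a \<inter> b) = Q.prob a * Q.prob b"
      by (simp add: Q.emeasure_eq_measure ennreal_mult''[symmetric])
  qed
qed

theorem post_bessel: "distr Q path_sigma post_max = bessel3_law W"
proof (rule measure_eqI)
  show "sets (distr Q path_sigma post_max) = sets (bessel3_law W)" by (simp add: bessel3_law_eq)
  fix B assume "B \<in> sets (distr Q path_sigma post_max)"
  then have B: "B \<in> sets path_sigma" by simp
  have "post_max -` B \<inter> space Q = {w \<in> space Q. post_max w \<in> B}" by auto
  then show "emeasure (distr Q path_sigma post_max) B = emeasure (bessel3_law W) B"
    using law_post[OF B] post_max_measurable B by (subst emeasure_distr) (auto simp: measurable_Q)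
qed

text \<open>The Brownian path is independent of the level, so fixing the level z leaves it Wiener
  distributed and the part before the maximum is its piece up to the hitting time of z. The kernel
  is measurable because that piece is jointly measurable in level and path.\<close>

theorem pre_conditional:
  "cond_law Q (\<lambda>w. real_of_ereal (sup_inf w)) {x<..} upto_algebra pre_max (stopped_bm_law P)"
  unfolding cond_law_def S_def[symmetric]
proof (intro conjI ballI impI)
  show "S \<in> borel_measurable Q" unfolding measurable_Q by (rule S_measurable)
  show "pre_max \<in> measurable Q upto_algebra" unfolding measurable_Q by (rule pre_max_measurable)
  show "stopped_bm_law P \<in> measurable (restrict_space borel {x<..}) (prob_algebra upto_algebra)"
  proof (rule measurable_restrict_space1, rule measurable_prob_algebraI)
    show "prob_space (stopped_bm_law P z)" for z by (rule prob_space_stopped)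
    have "(\<lambda>(z, w). path_upto (hit_time z w) w) \<in> measurable (borel \<Otimes>\<^sub>M P) upto_algebra"
      using hit_path_measurable wiener_sets[OF P]
      by (simp add: split_beta' cong: measurable_cong_sets sets_pair_measure_cong)
    then have "(\<lambda>z. distr P upto_algebra (\<lambda>w. path_upto (hit_time z w) w)) \<in> measurable borel (subprob_algebra upto_algebra)"
      by (rule measurable_distr2) (simp add: space_subprob_algebra P.subprob_space_axioms)
    then show "stopped_bm_law P \<in> measurable borel (subprob_algebra upto_algebra)"
      unfolding stopped_bm_law_def .
  qed
  fix A and C :: "real set" assume A: "A \<in> sets upto_algebra" and C: "C \<in> sets borel"
  have "emeasure Q {w \<in> space Q. pre_max w \<in> A \<and> S w \<in> C} = (\<integral>\<^sup>+z. pre_law A z * indicator C z \<partial>Z)"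
    by (rule law_pre_sup[OF A C])
  then show "emeasure Q {w \<in> space Q. pre_max w \<in> A \<and> S w \<in> C} = (\<integral>\<^sup>+z\<in>C. emeasure (stopped_bm_law P z) A \<partial>distr Q borel S)"
    unfolding distr_S pre_law_def .
qed

end

theorem theorem4p6:
  fixes \<phi> :: "real \<Rightarrow> real" and x :: real
    and P :: "real \<Rightarrow> (real \<Rightarrow> real) measure" and Q :: "(real \<Rightarrow> real) measure"
  assumes "\<phi> \<in> borel_measurable borel" and "\<And>u. 0 < \<phi> u"
    and "has_bochner_integral lborel \<phi> 1"
    and "\<And>y. wiener_law y (P y)"
    and "prob_space Q" and "sets Q = sets path_sigma"
    and "\<And>t \<Gamma>. 0 \<le> t \<Longrightarrow> \<Gamma> \<in> sets (path_filt t) \<Longrightarrow>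
           measure Q \<Gamma> = 1 / (1 - Phi \<phi> x) * (\<integral>w. indicator \<Gamma> w * mart \<phi> t w \<partial>P x)"
  shows
    "((AE w in Q. sup_inf w < \<infinity>) \<and>
      distributed Q lborel (\<lambda>w. real_of_ereal (sup_inf w))
        (\<lambda>y. ennreal (\<phi> y / (1 - Phi \<phi> x) * indicator {x..} y))) \<and>
     (measure Q {w \<in> space Q. 0 < last_max w \<and> last_max w < \<infinity>} = 1 \<and>
      indep_rv Q upto_algebra pre_max path_sigma post_max \<and>
      distr Q path_sigma post_max = bessel3_law (P 0) \<and>
      cond_law Q (\<lambda>w. real_of_ereal (sup_inf w)) {x<..} upto_algebra pre_max
        (stopped_bm_law (P x)))"
proof -
  \<comment> \<open>The Wiener measure from x drives the path itself, the one from 0 the Bessel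
    process and all shifted paths.\<close>
  interpret penalised_wiener \<phi> x "P x" "P 0" Q
    by (rule penalised_wiener.intro) (fact assms)+
  show ?thesis
    by (intro conjI sup_finite sup_distributed last_max_finite pre_post_indep post_bessel pre_conditional)
qed

end
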